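(* Let $p(y^N|x^N)$ be an $N$-node discrete memoryless broadcast relay network with source node $1$ and destination set $\mathcal{D}\subseteq[2:N]$. A rate tuple $(R_k:k\in\mathcal{D})$ is achievable if there is some joint pmf $p(x^N,u_2^N,q)$ such that $$\sum_{k\in\mathcal{S}^c\cap\mathcal{D}}R_k < I(X(\mathcal{S});U(\mathcal{S}^c)\,|\,X(\mathcal{S}^c),Q)-\sum_{k\in\mathcal{S}^c}\bigl[I(U_k;U(\mathcal{S}_k^c),X^N\,|\,X_k,Y_k,Q)+I(X_k;X(\mathcal{S}_k^c)\,|\,Q)\bigr]$$ for all $\mathcal{S}\subseteq[1:N]$ such that $1\in\mathcal{S}$ and $\mathcal{S}^c\cap\mathcal{D}\neq\emptyset$.
   Context: Notation. $[1:N]=\{1,\dots,N\}$; $X^N=(X_1,\dots,X_N)$, $U_2^N=(U_2,\dots,U_N)$, $X(\mathcal{A})=(X_k:k\in\mathcal{A})$; complements are taken in $[1:N]$; for $\mathcal{S}\subseteq[1:N]$, $\mathcal{S}_k^c=\mathcal{S}^c\cap[1:k-1]$. Logarithms are to base 2, and $[1:2^{nR}]$ denotes $\{1,\dots,2^{\lceil nR\rceil}\}$. Network. An $N$-node discrete memoryless network has finite alphabets $\mathcal{X}_k,\mathcal{Y}_k$, $k\in[1:N]$, and a conditional pmf $p(y^N|x^N)$; at each time $i$, given the messages, all past inputs and outputs and the current inputs $x_{1i},\dots,x_{Ni}$, the outputs $(Y_{1i},\dots,Y_{Ni})$ are distributed according to $p(y^N|x^N)$. Code. A $((2^{nR_k}:k\in\mathcal{D}),n)$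 code for the broadcast relay network with destination set $\mathcal{D}\subseteq[2:N]$ consists of message sets $[1:2^{nR_k}]$, $k\in\mathcal{D}$; a source encoder assigning a symbol $x_{1i}(m(\mathcal{D}),y_1^{i-1})$ to each message tuple $m(\mathcal{D})=(m_k:k\in\mathcal{D})$ and $y_1^{i-1}$ for $i\in[1:n]$; relay encoders $k\in[2:N]$ assigning $x_{ki}(y_k^{i-1})$ to each $y_k^{i-1}$ for $i\in[1:n]$; and decoders $k\in\mathcal{D}$ assigning an estimate $\hat m_k$ (or an error message) to each $y_k^n$. The messages are independent and uniform, and $P_e^{(n)}=\mathsf{P}\{\hat M_k\ne M_k\text{ for some }k\in\mathcal{D}\}$. A rate tuple (of nonnegative reals) $(R_k:k\in\mathcal{D})$ is achievable if there is a sequence of $((2^{nR_k}:k\in\mathcal{D}),n)$ codes with $P_e^{(n)}\to0$. Auxiliary variables. The pmf $p(x^N,u_2^N,q)$ has $X_k\in\mathcal{X}_k$ and arbitrary finite alphabets for $U_2,\dots,U_N,Q$; information quantities are computed under $p(x^N,u_2^N,q)\,p(y^N|x^N)$, so $(U_2^N,Q)\to X^N\to Y^N$ is a Markov chain. *)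

theory Defs
  imports "HOL-Probability.Probability"
begin

section \<open>Discrete memoryless networks\<close>

text \<open>
  Nodes are the naturals 1, ..., N. Tuples indexed by a set A of nodes are functions that are
  undefined outside A (elements of a \<open>PiE\<close>); \<open>W x\<close> is the pmf p(. | x^N). The alphabets of
  different nodes are arbitrary finite subsets of a common type.
\<close>

definition dm_network ::
  "nat \<Rightarrow> (nat \<Rightarrow> 'x set) \<Rightarrow> (nat \<Rightarrow> 'y set) \<Rightarrow> ((nat \<Rightarrow> 'x) \<Rightarrow> (nat \<Rightarrow> 'y) pmf) \<Rightarrow> bool" where
  "dm_network N X Y W \<longleftrightarrow>
     1 \<le> N \<and>
     (\<forall>k\<in>{1..N}. finite (X k) \<and> finite (Y k)) \<and>
     (\<forall>x\<in>PiE {1..N} X. set_pmf (W x) \<subseteq> PiE {1..N} Y)"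

section \<open>Codes for the broadcast relay network with source node 1\<close>

definition msg_set :: "nat \<Rightarrow> real \<Rightarrow> nat set" where
  "msg_set n r = {1..2 ^ nat \<lceil>real n * r\<rceil>}"

definition msg_tuples :: "nat set \<Rightarrow> (nat \<Rightarrow> real) \<Rightarrow> nat \<Rightarrow> (nat \<Rightarrow> nat) set" where
  "msg_tuples D R n = PiE D (\<lambda>k. msg_set n (R k))"

text \<open>
  Encoders receive the past outputs as a list; the time index i is the length of that list plus
  one, so it is not passed separately. The decoding result \<open>None\<close> is the error message.
\<close>

record ('x, 'y) code =
  src_enc :: "(nat \<Rightarrow> nat) \<Rightarrow> 'y list \<Rightarrow> 'x"
  relay_enc :: "nat \<Rightarrow> 'y list \<Rightarrow> 'x"
  decoder :: "nat \<Rightarrow> 'y list \<Rightarrow> nat option"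

definition is_code ::
  "nat \<Rightarrow> (nat \<Rightarrow> 'x set) \<Rightarrow> (nat \<Rightarrow> 'y set) \<Rightarrow> nat set \<Rightarrow> (nat \<Rightarrow> real) \<Rightarrow> nat \<Rightarrow>
   ('x, 'y) code \<Rightarrow> bool" where
  "is_code N X Y D R n c \<longleftrightarrow>
     (\<forall>m\<in>msg_tuples D R n. \<forall>ys\<in>lists (Y 1). length ys < n \<longrightarrow> src_enc c m ys \<in> X 1) \<and>
     (\<forall>k\<in>{2..N}. \<forall>ys\<in>lists (Y k). length ys < n \<longrightarrow> relay_enc c k ys \<in> X k) \<and>
     (\<forall>k\<in>D. \<forall>ys\<in>lists (Y k). length ys = n \<longrightarrow>
        decoder c k ys \<in> insert None (Some ` msg_set n (R k)))"

text \<open>A history is the list of the past output vectors, oldest first.\<close>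

definition channel_input ::
  "nat \<Rightarrow> ('x, 'y) code \<Rightarrow> (nat \<Rightarrow> nat) \<Rightarrow> (nat \<Rightarrow> 'y) list \<Rightarrow> (nat \<Rightarrow> 'x)" where
  "channel_input N c m h =
     (\<lambda>k\<in>{1..N}. if k = 1 then src_enc c m (map (\<lambda>y. y 1) h)
                 else relay_enc c k (map (\<lambda>y. y k) h))"

primrec output_law ::
  "nat \<Rightarrow> ((nat \<Rightarrow> 'x) \<Rightarrow> (nat \<Rightarrow> 'y) pmf) \<Rightarrow> ('x, 'y) code \<Rightarrow> (nat \<Rightarrow> nat) \<Rightarrow> nat \<Rightarrow>
   (nat \<Rightarrow> 'y) list pmf" where
  "output_law N W c m 0 = return_pmf []"
| "output_law N W c m (Suc i) =
     bind_pmf (output_law N W c m i)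
       (\<lambda>h. map_pmf (\<lambda>y. h @ [y]) (W (channel_input N c m h)))"

text \<open>Independent uniform messages are a uniformly distributed message tuple.\<close>

definition error_prob ::
  "nat \<Rightarrow> ((nat \<Rightarrow> 'x) \<Rightarrow> (nat \<Rightarrow> 'y) pmf) \<Rightarrow> nat set \<Rightarrow> (nat \<Rightarrow> real) \<Rightarrow> nat \<Rightarrow>
   ('x, 'y) code \<Rightarrow> real" where
  "error_prob N W D R n c =
     measure_pmf.prob
       (bind_pmf (pmf_of_set (msg_tuples D R n))
          (\<lambda>m. map_pmf (\<lambda>h. (m, h)) (output_law N W c m n)))
       {(m, h). \<exists>k\<in>D. decoder c k (map (\<lambda>y. y k) h) \<noteq> Some (m k)}"

definition achievable ::
  "nat \<Rightarrow> (nat \<Rightarrow> 'x set) \<Rightarrow> (nat \<Rightarrow> 'y set) \<Rightarrow> ((nat \<Rightarrow> 'x) \<Rightarrow> (nat \<Rightarrow> 'y) pmf) \<Rightarrow> nat set \<Rightarrow>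
   (nat \<Rightarrow> real) \<Rightarrow> bool" where
  "achievable N X Y W D R \<longleftrightarrow>
     (\<forall>k\<in>D. 0 \<le> R k) \<and>
     (\<exists>c :: nat \<Rightarrow> ('x, 'y) code.
        (\<forall>n\<ge>1. is_code N X Y D R n (c n)) \<and>
        (\<lambda>n. error_prob N W D R n (c n)) \<longlonglongrightarrow> 0)"

section \<open>Information quantities\<close>

text \<open>
  Conditional mutual information I(A;B|C) in bits of functions A, B, C of a random variable with
  finitely supported law P. Restricting the space to the support makes A, B and C simple
  functions, and the definition below is then the library's \<open>\<I>(A ; B | C)\<close>; see the
  lemmas that follow.
\<close>

definition supp_measure :: "'w pmf \<Rightarrow> 'w measure" where
  "supp_measure P = restrict_space (measure_pmf P) (set_pmf P)"

definition cond_info ::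
  "'w pmf \<Rightarrow> ('w \<Rightarrow> 'a) \<Rightarrow> ('w \<Rightarrow> 'b) \<Rightarrow> ('w \<Rightarrow> 'c) \<Rightarrow> real" where
  "cond_info P A B C =
     prob_space.conditional_mutual_information (supp_measure P) 2
       (count_space (A ` set_pmf P)) (count_space (B ` set_pmf P)) (count_space (C ` set_pmf P))
       A B C"

lemma space_supp_measure [simp]: "space (supp_measure P) = set_pmf P"
  by (simp add: supp_measure_def space_restrict_space)

lemma sets_supp_measure [simp]: "sets (supp_measure P) = Pow (set_pmf P)"
  by (auto simp: supp_measure_def sets_restrict_space)

lemma measure_supp_measure:
  "E \<subseteq> set_pmf P \<Longrightarrow> measure (supp_measure P) E = measure_pmf.prob P E"
  by (simp add: supp_measure_def measure_restrict_space)

lemma information_space_supp_measure: "information_space (supp_measure P) 2"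
proof -
  have "prob_space (supp_measure P)"
    unfolding supp_measure_def
    by (intro prob_space_restrict_space measure_pmf.emeasure_eq_1_AE) (auto simp: AE_measure_pmf)
  then show ?thesis
    by (intro information_space.intro) (auto simp: information_space_axioms_def)
qed

lemma simple_distributed_supp_measure:
  assumes "finite (set_pmf P)"
  shows "simple_distributed (supp_measure P) A (pmf (map_pmf A P))"
proof -
  interpret information_space "supp_measure P" 2
    by (rule information_space_supp_measure)
  show ?thesis
  proof (rule simple_distributedI)
    show "simple_function (supp_measure P) A"
      using assms by (auto simp: simple_function_def)
    fix a
    have "measure (supp_measure P) (A -` {a} \<inter> space (supp_measure P))
        = measure_pmf.prob P (A -` {a} \<inter> set_pmf P)"
      by (simp add: measure_supp_measure)
    also have "\<dots> = measure_pmf.prob P (A -` {a})"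
      by (rule measure_Int_set_pmf)
    finally show "pmf (map_pmf A P) a
        = measure (supp_measure P) (A -` {a} \<inter> space (supp_measure P))"
      by (simp add: pmf_map)
  qed auto
qed

lemma cond_info_eq:
  assumes "finite (set_pmf P)"
  shows "cond_info P A B C =
    (\<Sum>(a, b, c)\<in>(\<lambda>w. (A w, B w, C w)) ` set_pmf P.
       pmf (map_pmf (\<lambda>w. (A w, B w, C w)) P) (a, b, c) *
       log 2 (pmf (map_pmf (\<lambda>w. (A w, B w, C w)) P) (a, b, c) /
         (pmf (map_pmf (\<lambda>w. (A w, C w)) P) (a, c) *
          (pmf (map_pmf (\<lambda>w. (B w, C w)) P) (b, c) / pmf (map_pmf C P) c))))"
proof -
  interpret information_space "supp_measure P" 2
    by (rule information_space_supp_measure)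
  note sd = simple_distributed_supp_measure[OF assms]
  show ?thesis
    using conditional_mutual_information_eq[OF sd sd sd sd, of A B C]
    by (simp add: cond_info_def)
qed

section \<open>The distributed decode-forward bound\<close>

text \<open>The law of (X^N, U_2^N, Q, Y^N), namely p(x^N, u_2^N, q) p(y^N | x^N).\<close>

definition joint_law ::
  "((nat \<Rightarrow> 'x) \<times> (nat \<Rightarrow> 'u) \<times> 'q) pmf \<Rightarrow> ((nat \<Rightarrow> 'x) \<Rightarrow> (nat \<Rightarrow> 'y) pmf) \<Rightarrow>
   ((nat \<Rightarrow> 'x) \<times> (nat \<Rightarrow> 'u) \<times> 'q \<times> (nat \<Rightarrow> 'y)) pmf" where
  "joint_law P W = bind_pmf P (\<lambda>(x, u, q). map_pmf (\<lambda>y. (x, u, q, y)) (W x))"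

text \<open>
  Below, T is the complement of S in {1..N} and \<open>restrict x T\<close> is the subtuple X(T); the part
  \<open>T \<inter> {1..<k}\<close> of the complement that precedes node k depends on the ordering of the nodes.
\<close>

definition ddf_bound ::
  "nat \<Rightarrow> ((nat \<Rightarrow> 'x) \<times> (nat \<Rightarrow> 'u) \<times> 'q) pmf \<Rightarrow> ((nat \<Rightarrow> 'x) \<Rightarrow> (nat \<Rightarrow> 'y) pmf) \<Rightarrow>
   nat set \<Rightarrow> real" where
  "ddf_bound N P W S =
     (let L = joint_law P W; T = {1..N} - S in
        cond_info L (\<lambda>(x, u, q, y). restrict x S) (\<lambda>(x, u, q, y). restrict u T)
          (\<lambda>(x, u, q, y). (restrict x T, q))
        - (\<Sum>k\<in>T.
             cond_info L (\<lambda>(x, u, q, y). u k)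
               (\<lambda>(x, u, q, y). (restrict u (T \<inter> {1..<k}), restrict x {1..N}))
               (\<lambda>(x, u, q, y). (x k, y k, q))
             + cond_info L (\<lambda>(x, u, q, y). x k) (\<lambda>(x, u, q, y). restrict x (T \<inter> {1..<k}))
                 (\<lambda>(x, u, q, y). q)))"

text \<open>P is a joint pmf of (X^N, U_2^N, Q), where U k and Qs are the alphabets of U_k and Q.\<close>

definition aux_pmf ::
  "nat \<Rightarrow> (nat \<Rightarrow> 'x set) \<Rightarrow> (nat \<Rightarrow> 'u set) \<Rightarrow> 'q set \<Rightarrow>
   ((nat \<Rightarrow> 'x) \<times> (nat \<Rightarrow> 'u) \<times> 'q) pmf \<Rightarrow> bool" where
  "aux_pmf N X U Qs P \<longleftrightarrow>
     (\<forall>k\<in>{2..N}. finite (U k)) \<and> finite Qs \<and>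
     set_pmf P \<subseteq> PiE {1..N} X \<times> PiE {2..N} U \<times> Qs"

end

theory Submission
  imports Defs "HOL-Real_Asymp.Real_Asymp"
begin

text \<open>For \<open>T = S\<^sup>c\<close> the bound of the theorem is at most the sum over k in T of \<open>I(U_k; Y_k | X_k, Q)\<close> minus the
  total correlation of the pairs \<open>(X_k, U_k)\<close>, k in T, given Q. This larger bound is reached by
  distributed decode-forward. In block j, with a fresh codebook, node k sends \<open>x_k(l_{k,j-1})\<close> and decodes
  \<open>l_{k,j}\<close> from the codewords \<open>u_k(. | l_{k,j-1})\<close>. The source knows all messages and chooses the indices
  from the last block to the first: a part of the index \<open>l_{k,j-1}\<close> carries no message, and by mutual covering it
  can be chosen such that the words \<open>(x_k(l_{k,j-1}), u_k(l_{k,j} | l_{k,j-1}))\<close> of all nodes fit jointly.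
  The indices that are needed in the first block are sent before it by repetition coding along a
  spanning sequence of edges of the network. This costs \<open>O(n\<^sup>2)\<close> channel uses for blocks of length n,
  which is negligible against n to the power 3 uses in total.

  As long as all nodes decode correctly, the channel inputs do not depend on the outputs, so each
  block can be analysed under a memoryless law, and the error probabilities of the blocks add up.\<close>

text \<open>Two obstacles shape the proof. Every node of \<open>V\<close> has to decode its index,
  so the analysis needs a rate constraint for each nonempty subset T of \<open>V\<close>, while the
  theorem gives one only for cuts that separate a destination. Relays that would violate theirs are
  therefore made idle: their letters are revealed as part of the time-sharing variable. Moreover,
  the initial indices must get through an arbitrary network. The constraints for all T settle this
  too, since for the set of nodes of \<open>V\<close> that the source cannot reach the right-hand
  side is at most 0. Per letter, an index of node k has \<open>m k\<close> message bits and
  \<open>r k\<close> free bits. Detection needs \<open>m k + r k\<close> below I(U_k; Y_k | X_k, Q);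
  covering needs the sum of \<open>r k\<close> over T above the total correlation. Eliminating
  \<open>r\<close> yields the larger bound of the overview. A codebook is fixed for given targets,
  as functions of the message tuple. The targets are the selections of the next block, so the
  codebooks too are fixed from the last block to the first. Errors are averaged over the messages
  and added by a union bound, so the dependence between blocks is harmless.\<close>

abbreviation (input) "prob \<equiv> measure_pmf.prob"
abbreviation (input) "expect \<equiv> measure_pmf.expectation"

section \<open>Mutual covering\<close>

lemma measure_bind_pmf:
  "prob (bind_pmf p f) S = expect p (\<lambda>x. prob (f x) S)"
proof -
  have "ennreal (prob (bind_pmf p f) S) = (\<integral>\<^sup>+x. ennreal (prob (f x) S) \<partial>p)"
    by (simp flip: measure_pmf.emeasure_eq_measure)
  also have "\<dots> = ennreal (expect p (\<lambda>x. prob (f x) S))"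
    by (intro nn_integral_eq_integral measure_pmf.integrable_const_bound[where B=1]) auto
  finally show ?thesis
    by (subst (asm) ennreal_inj) (auto intro!: integral_nonneg_AE)
qed

lemma pmf_map_pos: "w \<in> set_pmf P \<Longrightarrow> pmf (map_pmf f P) (f w) > 0"
  by (auto intro!: pmf_positive)

lemma expectation_bind_pmf:
  fixes h :: "'a \<Rightarrow> real"
  assumes "finite (set_pmf p)" "\<And>x. x \<in> set_pmf p \<Longrightarrow> finite (set_pmf (f x))"
  shows "expect (bind_pmf p f) h
    = expect p (\<lambda>x. expect (f x) h)"
proof -
  have "expect (bind_pmf p f) h
      = (\<Sum>a\<in>set_pmf p. pmf p a * expect (f a) h)"
    using assms by (subst pmf_expectation_bind[where A = "set_pmf p"]) auto
  also have "\<dots> = expect p (\<lambda>x. expect (f x) h)"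
    using assms by (subst integral_measure_pmf[where A = "set_pmf p"]) auto
  finally show ?thesis .
qed

lemma expectation_le_obtains:
  fixes h :: "'a \<Rightarrow> real"
  assumes "expect p h \<le> e" "integrable p h"
  obtains x where "x \<in> set_pmf p" "h x \<le> e"
proof -
  have "\<exists>x\<in>set_pmf p. h x \<le> e"
  proof (rule ccontr)
    assume "\<not> ?thesis"
    then have *: "AE x in measure_pmf p. h x > e"
      by (auto simp: AE_measure_pmf_iff not_le)
    have "e < expect p h"
      using assms(2) * by (rule measure_pmf.expectation_greater)
    with assms(1) show False
      by simp
  qed
  with that show thesis by blast
qed

lemma finite_set_Pi_pmf:
  assumes "finite A" "\<And>x. x \<in> A \<Longrightarrow> finite (set_pmf (p x))"
  shows "finite (set_pmf (Pi_pmf A d p))"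
  using assms by (simp add: set_Pi_pmf finite_PiE_dflt)

text \<open>Change of measure. \<open>h\<close> is the density of \<open>G\<close> with respect to
  the product of its marginals, cut off outside \<open>A\<close>. Drawing the coordinates outside
  \<open>T\<close> from these marginals cancels their factors in the denominator; what is left is
  the mass under \<open>G\<close> of the words in \<open>A\<close> that agree with \<open>v\<close>
  on \<open>T\<close>, over the marginals on \<open>T\<close>. The case \<open>T = {}\<close> is the
  first moment.\<close>

lemma expectation_Pi_pmf_fix:
  fixes G :: "('k \<Rightarrow> 'v) pmf" and A :: "('k \<Rightarrow> 'v) set"
  assumes V: "finite V" and finG: "finite (set_pmf G)" and ext: "set_pmf G \<subseteq> extensional V"
    and g: "\<And>k. k \<in> V \<Longrightarrow> g k = map_pmf (\<lambda>v. v k) G"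
    and T: "T \<subseteq> V" and v: "v \<in> set_pmf G"
  defines "h \<equiv> \<lambda>v. if v \<in> A then pmf G v / (\<Prod>k\<in>V. pmf (g k) (v k)) else 0"
  shows "expect (Pi_pmf V undefined (\<lambda>k. if k \<in> T then return_pmf (v k) else g k)) h
    = prob G {w \<in> A. restrict w T = restrict v T} / (\<Prod>k\<in>T. pmf (g k) (v k))"
proof -
  let ?P = "Pi_pmf V undefined (\<lambda>k. if k \<in> T then return_pmf (v k) else g k)"
  let ?S = "{w \<in> set_pmf G. restrict w T = restrict v T}"
  have fing: "finite (set_pmf (g k))" if "k \<in> V" for k
    using that finG by (simp add: g)
  have finP: "finite (set_pmf ?P)"
    using V fing by (intro finite_set_Pi_pmf) auto
  have pos: "pmf (g k) (w k) > 0" if "w \<in> set_pmf G" "k \<in> V" for w k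
    using that by (auto simp: g intro!: pmf_positive)
  have TV: "finite T" using T V finite_subset by blast
  have SP: "?S \<subseteq> set_pmf ?P"
  proof
    fix w assume w: "w \<in> ?S"
    then have "w k = v k" if "k \<in> T" for k
      using that by (auto dest: fun_cong[where x = k])
    then show "w \<in> set_pmf ?P"
      using w ext V pos[of w] by (auto simp: set_Pi_pmf PiE_dflt_def set_pmf_iff extensional_def
          subset_eq less_le)
  qed
  have "expect ?P h = (\<Sum>w\<in>set_pmf ?P. pmf ?P w * h w)"
    using finP by (subst integral_measure_pmf[where A = "set_pmf ?P"]) auto
  also have "\<dots> = (\<Sum>w\<in>?S. pmf ?P w * h w)"
  proof (intro sum.mono_neutral_right finP SP ballI)
    fix w assume w: "w \<in> set_pmf ?P - ?S"
    have "w k = v k" if "k \<in> T" for k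
      using that w T V by (auto simp: set_Pi_pmf PiE_dflt_def split: if_splits)
    then have "restrict w T = restrict v T"
      by auto
    with w show "pmf ?P w * h w = 0"
      by (auto simp: h_def set_pmf_iff)
  qed
  also have "\<dots> = (\<Sum>w\<in>?S. (if w \<in> A then pmf G w else 0) / (\<Prod>k\<in>T. pmf (g k) (v k)))"
  proof (intro sum.cong refl)
    fix w assume w: "w \<in> ?S"
    then have wv: "w k = v k" if "k \<in> T" for k
      using that by (auto dest: fun_cong[where x = k])
    have "pmf ?P w = (\<Prod>k\<in>V. pmf (if k \<in> T then return_pmf (v k) else g k) (w k))"
      using w ext V by (intro pmf_Pi') (auto simp: extensional_def)
    also have "\<dots> = (\<Prod>k\<in>V - T. pmf (g k) (w k))"
      using V T TV by (subst prod.subset_diff[OF T V]) (simp add: wv)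
    finally have P: "pmf ?P w = (\<Prod>k\<in>V - T. pmf (g k) (w k))" .
    have D: "(\<Prod>k\<in>V. pmf (g k) (w k)) = (\<Prod>k\<in>V - T. pmf (g k) (w k)) * (\<Prod>k\<in>T. pmf (g k) (v k))"
      using V T by (subst prod.subset_diff[OF T V]) (simp add: wv)
    have "(\<Prod>k\<in>V - T. pmf (g k) (w k)) > 0"
      using w pos by (intro prod_pos) auto
    then show "pmf ?P w * h w = (if w \<in> A then pmf G w else 0) / (\<Prod>k\<in>T. pmf (g k) (v k))"
      unfolding h_def P D by auto
  qed
  also have "\<dots> = (\<Sum>w\<in>?S \<inter> A. pmf G w) / (\<Prod>k\<in>T. pmf (g k) (v k))"
    using finG by (subst sum.inter_restrict) (auto simp: sum_divide_distrib)
  also have "(\<Sum>w\<in>?S \<inter> A. pmf G w) = prob G (?S \<inter> A)"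
    using finG by (intro measure_measure_pmf_finite[symmetric]) auto
  also have "\<dots> = prob G {w \<in> A. restrict w T = restrict v T}"
    by (intro measure_prob_cong_0) (auto simp: set_pmf_iff)
  finally show ?thesis .
qed

text \<open>\<open>Pi_pmf_bind\<close> produces a product law of pairs, whereas two selections form
  a pair of tuples. \<open>restrict\<close> makes the default values of the two products
  irrelevant.\<close>

lemma map_Pi_pmf_unzip:
  assumes "finite V"
  shows "map_pmf (\<lambda>h. (\<lambda>k\<in>V. fst (h k), \<lambda>k\<in>V. snd (h k)))
      (Pi_pmf V (undefined, undefined) (\<lambda>k. bind_pmf (p k) (\<lambda>x. return_pmf (q k x))))
     = map_pmf (\<lambda>h. (\<lambda>k\<in>V. fst (q k (h k)), \<lambda>k\<in>V. snd (q k (h k)))) (Pi_pmf V e p)"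
  using assms by (subst Pi_pmf_bind[where d' = e])
    (auto simp: map_pmf_def bind_assoc_pmf bind_return_pmf restrict_def cong: if_cong
      intro!: bind_pmf_cong)

text \<open>Where \<open>l\<close> and \<open>l'\<close> agree, both selections read the same
  codeword; elsewhere they read two independent ones. So the joint law depends only on the set of
  agreement, by which the second moment is organised.\<close>

lemma Pi_pmf_two_selections:
  assumes V: "finite V" and L: "\<And>k. k \<in> V \<Longrightarrow> finite (L k)"
    and l: "\<And>k. k \<in> V \<Longrightarrow> l k \<in> L k" and l': "\<And>k. k \<in> V \<Longrightarrow> l' k \<in> L k"
  shows "map_pmf (\<lambda>c. (\<lambda>k\<in>V. c k (l k), \<lambda>k\<in>V. c k (l' k))) (Pi_pmf V d (\<lambda>k. Pi_pmf (L k) d' (\<lambda>_. g k)))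
    = bind_pmf (Pi_pmf V undefined g) (\<lambda>v. map_pmf (Pair v)
        (Pi_pmf V undefined (\<lambda>k. if l k = l' k then return_pmf (v k) else g k)))"
proof -
  have one: "map_pmf (\<lambda>f. (f (l k), f (l' k))) (Pi_pmf (L k) d' (\<lambda>_. g k))
      = bind_pmf (g k) (\<lambda>a. map_pmf (Pair a) (if l k = l' k then return_pmf a else g k))"
    if k: "k \<in> V" for k
  proof (cases "l k = l' k")
    case True
    have "map_pmf (\<lambda>f. f (l k)) (Pi_pmf (L k) d' (\<lambda>_. g k)) = g k"
      using k L l by (simp add: Pi_pmf_component)
    then have "map_pmf (\<lambda>a. (a, a)) (map_pmf (\<lambda>f. f (l k)) (Pi_pmf (L k) d' (\<lambda>_. g k)))
        = map_pmf (\<lambda>a. (a, a)) (g k)"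
      by simp
    then show ?thesis
      using True by (simp add: pmf.map_comp o_def) (simp add: map_pmf_def bind_return_pmf)
  next
    case False
    define R where "R = L k - {l k}"
    have R: "L k = insert (l k) R" "l k \<notin> R" "finite R" "l' k \<in> R"
      using k l l' L False by (auto simp: R_def)
    have "map_pmf (\<lambda>f. (f (l k), f (l' k))) (Pi_pmf (L k) d' (\<lambda>_. g k))
      = bind_pmf (g k) (\<lambda>a. map_pmf (Pair a) (map_pmf (\<lambda>f. f (l' k)) (Pi_pmf R d' (\<lambda>_. g k))))"
      unfolding R(1) using R False
      by (subst Pi_pmf_insert') (auto simp: map_pmf_def bind_assoc_pmf bind_return_pmf)
    then show ?thesis
      using R False by (subst (asm) Pi_pmf_component) auto
  qed
  have "map_pmf (\<lambda>c. (\<lambda>k\<in>V. c k (l k), \<lambda>k\<in>V. c k (l' k))) (Pi_pmf V d (\<lambda>k. Pi_pmf (L k) d' (\<lambda>_. g k)))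
     = map_pmf (\<lambda>h. (\<lambda>k\<in>V. fst (h k), \<lambda>k\<in>V. snd (h k)))
      (Pi_pmf V (undefined, undefined) (\<lambda>k. map_pmf (\<lambda>f. (f (l k), f (l' k))) (Pi_pmf (L k) d' (\<lambda>_. g k))))"
    unfolding map_pmf_def[of "\<lambda>f. (f (l k), f (l' k))" for k] by (subst map_Pi_pmf_unzip[OF V, where e = d]) simp
  also have "\<dots> = map_pmf (\<lambda>h. (\<lambda>k\<in>V. fst (h k), \<lambda>k\<in>V. snd (h k)))
      (Pi_pmf V (undefined, undefined)
        (\<lambda>k. bind_pmf (g k) (\<lambda>a. map_pmf (Pair a) (if l k = l' k then return_pmf a else g k))))"
    using one by (simp cong: Pi_pmf_cong)
  also have "\<dots> = bind_pmf (Pi_pmf V undefined g) (\<lambda>v. map_pmf (\<lambda>h. (\<lambda>k\<in>V. fst (h k), \<lambda>k\<in>V. snd (h k)))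
      (Pi_pmf V (undefined, undefined)
        (\<lambda>k. map_pmf (Pair (v k)) (if l k = l' k then return_pmf (v k) else g k))))"
    using V by (subst Pi_pmf_bind[where d' = undefined]) (auto simp: map_bind_pmf)
  also have "\<dots> = bind_pmf (Pi_pmf V undefined g) (\<lambda>v. map_pmf (\<lambda>h. (\<lambda>k\<in>V. v k, \<lambda>k\<in>V. h k))
      (Pi_pmf V undefined (\<lambda>k. if l k = l' k then return_pmf (v k) else g k)))"
    unfolding map_pmf_def[of "Pair x" for x] by (subst map_Pi_pmf_unzip[OF V, where e = undefined]) simp
  also have "\<dots> = bind_pmf (Pi_pmf V undefined g) (\<lambda>v. map_pmf (Pair v)
        (Pi_pmf V undefined (\<lambda>k. if l k = l' k then return_pmf (v k) else g k)))"
  proof (intro bind_pmf_cong refl map_pmf_cong)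
    fix v h assume "v \<in> set_pmf (Pi_pmf V undefined g)"
      "h \<in> set_pmf (Pi_pmf V undefined (\<lambda>k. if l k = l' k then return_pmf (v k) else g k))"
    then have "v \<in> extensional V" "h \<in> extensional V"
      using V by (auto simp: set_Pi_pmf PiE_dflt_def extensional_def)
    then show "(\<lambda>k\<in>V. v k, \<lambda>k\<in>V. h k) = (v, h)"
      by (simp add: extensional_restrict)
  qed
  finally show ?thesis .
qed

text \<open>Second moment method for the number of good selections l, each weighted by the density of the
  joint law with respect to the product of its marginals. With these weights only upper bounds on
  densities are needed, and no lower ones.\<close>

lemma mutual_covering:
  fixes G :: "('k \<Rightarrow> 'v) pmf" and A :: "('k \<Rightarrow> 'v) set" and L Lam :: "'k \<Rightarrow> 'i set"
    and \<theta> :: "'k set \<Rightarrow> real"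
  assumes V: "finite V" and finG: "finite (set_pmf G)" and ext: "set_pmf G \<subseteq> extensional V"
    and g: "\<And>k. k \<in> V \<Longrightarrow> g k = map_pmf (\<lambda>v. v k) G"
    and L: "\<And>k. k \<in> V \<Longrightarrow> finite (L k)"
    and Lam: "\<And>k. k \<in> V \<Longrightarrow> Lam k \<subseteq> L k" "\<And>k. k \<in> V \<Longrightarrow> Lam k \<noteq> {}"
    and pos: "prob G A > 0"
    and \<theta>: "\<And>T. T \<subseteq> V \<Longrightarrow> \<theta> T \<ge> 0"
    and A: "\<And>v T. v \<in> A \<Longrightarrow> v \<in> set_pmf G \<Longrightarrow> T \<subseteq> V \<Longrightarrow> T \<noteq> {} \<Longrightarrow>
      prob G {w. restrict w T = restrict v T} \<le> \<theta> T * (\<Prod>k\<in>T. pmf (g k) (v k))"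
  shows "prob (Pi_pmf V d (\<lambda>k. Pi_pmf (L k) d' (\<lambda>_. g k)))
      {c. \<forall>l\<in>PiE V Lam. (\<lambda>k\<in>V. c k (l k)) \<notin> A}
    \<le> (\<Sum>T\<in>Pow V - {{}}. \<theta> T / ((\<Prod>k\<in>T. real (card (Lam k))) * prob G A))"
proof -
  define CB where "CB = Pi_pmf V d (\<lambda>k. Pi_pmf (L k) d' (\<lambda>_. g k))"
  define Q where "Q = Pi_pmf V undefined g"
  define pA where "pA = prob G A"
  define h where "h = (\<lambda>v. if v \<in> A then pmf G v / (\<Prod>k\<in>V. pmf (g k) (v k)) else 0)"
  define sel where "sel = (\<lambda>c (l :: 'k \<Rightarrow> 'i). \<lambda>k\<in>V. (c k (l k) :: 'v))"
  define QT where "QT = (\<lambda>T v. Pi_pmf V undefined (\<lambda>k. if k \<in> T then return_pmf (v k) else g k))"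
  define M where "M = (\<Prod>k\<in>V. real (card (Lam k)))"
  define Z where "Z = (\<lambda>c. \<Sum>l\<in>PiE V Lam. h (sel c l))"
  have fing: "finite (set_pmf (g k))" if "k \<in> V" for k
    using that finG by (simp add: g)
  have finLam: "finite (Lam k)" if "k \<in> V" for k
    using that Lam L finite_subset by blast
  have finCB: "finite (set_pmf CB)"
    unfolding CB_def using V L fing by (intro finite_set_Pi_pmf) auto
  have finQ: "finite (set_pmf Q)"
    unfolding Q_def using V fing by (intro finite_set_Pi_pmf) auto
  have finQT: "finite (set_pmf (QT T v))" for T v
    unfolding QT_def using V fing by (intro finite_set_Pi_pmf) auto
  have finPiE: "finite (PiE V Lam)"
    using V finLam by (intro finite_PiE) auto
  have cardPiE: "real (card (PiE V Lam)) = M"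
    using V by (simp add: card_PiE M_def)
  have Mpos: "(\<Prod>k\<in>T. real (card (Lam k))) > 0" if "T \<subseteq> V" for T
    using that finLam Lam(2) by (intro prod_pos) (auto simp: card_gt_0_iff)
  have h0: "h v \<ge> 0" for v
    by (auto simp: h_def intro!: divide_nonneg_nonneg prod_nonneg)
  have hA: "v \<in> A \<and> v \<in> set_pmf G" if "h v \<noteq> 0" for v
    using that by (auto simp: h_def set_pmf_iff split: if_splits)
  have two: "map_pmf (\<lambda>c. (sel c l, sel c l')) CB
      = bind_pmf Q (\<lambda>v. map_pmf (Pair v) (QT {k\<in>V. l k = l' k} v))"
    if "l \<in> PiE V Lam" "l' \<in> PiE V Lam" for l l'
  proof -
    have "map_pmf (\<lambda>c. (sel c l, sel c l')) CB
      = bind_pmf Q (\<lambda>v. map_pmf (Pair v)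
        (Pi_pmf V undefined (\<lambda>k. if l k = l' k then return_pmf (v k) else g k)))"
      unfolding sel_def CB_def Q_def using that Lam V L by (intro Pi_pmf_two_selections) auto
    also have "\<dots> = bind_pmf Q (\<lambda>v. map_pmf (Pair v) (QT {k\<in>V. l k = l' k} v))"
      unfolding QT_def by (intro bind_pmf_cong refl arg_cong[where f = "map_pmf _"] Pi_pmf_cong) auto
    finally show ?thesis .
  qed
  obtain v0 where v0: "v0 \<in> set_pmf G"
    using set_pmf_not_empty[of G] by blast
  have EQT: "expect (QT T v) h
      = prob G {w \<in> A. restrict w T = restrict v T} / (\<Prod>k\<in>T. pmf (g k) (v k))"
    if "T \<subseteq> V" "v \<in> set_pmf G" for T v
    unfolding QT_def h_def using V finG ext g that by (rule expectation_Pi_pmf_fix)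
  have EQ: "expect Q h = pA"
    using EQT[of "{}" v0] v0 by (simp add: QT_def Q_def pA_def restrict_def)
  have E1: "expect CB (\<lambda>c. h (sel c l)) = pA" if l: "l \<in> PiE V Lam" for l
  proof -
    have "map_pmf (\<lambda>c. sel c l) CB = map_pmf fst (map_pmf (\<lambda>c. (sel c l, sel c l)) CB)"
      by (simp add: pmf.map_comp o_def)
    also have "\<dots> = Q"
      by (simp add: two[OF l l] map_bind_pmf pmf.map_comp o_def map_pmf_const bind_return_pmf')
    finally have "expect Q h = expect (map_pmf (\<lambda>c. sel c l) CB) h"
      by simp
    then show ?thesis
      by (simp add: EQ)
  qed
  have E2: "expect CB (\<lambda>c. h (sel c l) * h (sel c l'))
      \<le> (if {k\<in>V. l k = l' k} = {} then pA\<^sup>2 else \<theta> {k\<in>V. l k = l' k} * pA)" (is "_ \<le> ?b")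
    if l: "l \<in> PiE V Lam" "l' \<in> PiE V Lam" for l l'
  proof -
    define T where "T = {k\<in>V. l k = l' k}"
    have T: "T \<subseteq> V" by (auto simp: T_def)
    have "expect CB (\<lambda>c. h (sel c l) * h (sel c l'))
      = expect (map_pmf (\<lambda>c. (sel c l, sel c l')) CB) (\<lambda>(v, v'). h v * h v')"
      by simp
    also have "\<dots> = expect Q (\<lambda>v. h v * expect (QT T v) h)"
      unfolding two[OF l] T_def[symmetric] using finQ finQT by (subst expectation_bind_pmf) auto
    also have "\<dots> \<le> expect Q (\<lambda>v. h v * (if T = {} then pA else \<theta> T))"
    proof (intro integral_mono_AE integrable_measure_pmf_finite finQ AE_pmfI)
      fix v
      show "h v * expect (QT T v) h \<le> h v * (if T = {} then pA else \<theta> T)"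
      proof (cases "h v = 0")
        case False
        then have v: "v \<in> A" "v \<in> set_pmf G" using hA by auto
        have p: "(\<Prod>k\<in>T. pmf (g k) (v k)) > 0"
          using v T by (intro prod_pos) (auto simp: g subset_eq intro!: pmf_positive)
        have "expect (QT T v) h \<le> (if T = {} then pA else \<theta> T)"
        proof (cases "T = {}")
          case True
          then show ?thesis using EQT[OF T v(2)] by (simp add: pA_def restrict_def)
        next
          case False
          have "prob G {w \<in> A. restrict w T = restrict v T}
             \<le> prob G {w. restrict w T = restrict v T}"
            by (intro measure_pmf.finite_measure_mono) auto
          also have "\<dots> \<le> \<theta> T * (\<Prod>k\<in>T. pmf (g k) (v k))"
            using A v T False by blast
          finally show ?thesis
            using EQT[OF T v(2)] p False by (simp add: pos_divide_le_eq)
        qed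
        then show ?thesis
          using h0 by (intro mult_left_mono) auto
      qed simp
    qed
    also have "\<dots> = ?b"
      using EQ by (auto simp: T_def power2_eq_square)
    finally show ?thesis .
  qed
  have EZ: "expect CB Z = M * pA"
    unfolding Z_def using finCB E1 finPiE
    by (subst Bochner_Integration.integral_sum) (auto simp: integrable_measure_pmf_finite cardPiE)
  define bd where "bd = (\<lambda>T. if T = {} then pA\<^sup>2 else \<theta> T * pA)"
  have bd0: "bd T \<ge> 0" if "T \<subseteq> V" for T
    using \<theta>[OF that] pos by (auto simp: bd_def pA_def)
  \<comment> \<open>Selections that agree with \<open>l\<close> exactly on \<open>T\<close> are
    overcounted by those that agree at least on \<open>T\<close>.\<close>
  have cnt: "real (card {l'\<in>PiE V Lam. {k\<in>V. l k = l' k} = T}) \<le> M / (\<Prod>k\<in>T. real (card (Lam k)))"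
    if l: "l \<in> PiE V Lam" and T: "T \<subseteq> V" for l T
  proof -
    have "card {l'\<in>PiE V Lam. {k\<in>V. l k = l' k} = T} \<le> card (PiE V (\<lambda>k. if k \<in> T then {l k} else Lam k))"
      using V finLam T by (intro card_mono finite_PiE) (auto simp: PiE_def Pi_def)
    also have "\<dots> = (\<Prod>k\<in>V. if k \<in> T then 1 else card (Lam k))"
      using V by (auto simp: card_PiE intro!: prod.cong)
    also have "\<dots> = (\<Prod>k\<in>V - T. card (Lam k))"
      using V T by (subst prod.subset_diff[OF T V]) simp
    also have "real \<dots> = M / (\<Prod>k\<in>T. real (card (Lam k)))"
      unfolding M_def prod.subset_diff[OF T V] using Mpos[OF T] by simp
    finally show ?thesis by simp
  qed
  have "expect CB (\<lambda>c. (Z c)\<^sup>2)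
      = (\<Sum>l\<in>PiE V Lam. \<Sum>l'\<in>PiE V Lam. expect CB (\<lambda>c. h (sel c l) * h (sel c l')))"
    unfolding Z_def power2_eq_square sum_product using finCB
    by (simp add: Bochner_Integration.integral_sum integrable_measure_pmf_finite)
  also have "\<dots> \<le> (\<Sum>l\<in>PiE V Lam. \<Sum>l'\<in>PiE V Lam. bd {k\<in>V. l k = l' k})"
    using E2 unfolding bd_def by (intro sum_mono) auto
  also have "\<dots> \<le> (\<Sum>l\<in>PiE V Lam. \<Sum>T\<in>Pow V. M / (\<Prod>k\<in>T. real (card (Lam k))) * bd T)"
  proof (intro sum_mono)
    fix l assume l: "l \<in> PiE V Lam"
    have "(\<Sum>l'\<in>PiE V Lam. bd {k\<in>V. l k = l' k})
        = (\<Sum>T\<in>Pow V. \<Sum>l'\<in>{l'\<in>PiE V Lam. {k\<in>V. l k = l' k} = T}. bd {k\<in>V. l k = l' k})"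
      using V finPiE by (intro sum.group[symmetric]) auto
    also have "\<dots> = (\<Sum>T\<in>Pow V. real (card {l'\<in>PiE V Lam. {k\<in>V. l k = l' k} = T}) * bd T)"
      by (intro sum.cong refl) simp
    also have "\<dots> \<le> (\<Sum>T\<in>Pow V. M / (\<Prod>k\<in>T. real (card (Lam k))) * bd T)"
      using cnt[OF l] bd0 by (intro sum_mono mult_right_mono) auto
    finally show "(\<Sum>l'\<in>PiE V Lam. bd {k\<in>V. l k = l' k})
      \<le> (\<Sum>T\<in>Pow V. M / (\<Prod>k\<in>T. real (card (Lam k))) * bd T)" .
  qed
  also have "\<dots> = M\<^sup>2 * (\<Sum>T\<in>Pow V. bd T / (\<Prod>k\<in>T. real (card (Lam k))))"
    by (simp add: cardPiE power2_eq_square sum_distrib_left mult.assoc)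
  \<comment> \<open>The term for \<open>T = {}\<close> yields the squared mean, which cancels in the
    variance below.\<close>
  also have "(\<Sum>T\<in>Pow V. bd T / (\<Prod>k\<in>T. real (card (Lam k))))
      = pA\<^sup>2 + (\<Sum>T\<in>Pow V - {{}}. \<theta> T * pA / (\<Prod>k\<in>T. real (card (Lam k))))"
    using V by (subst sum.remove[of _ "{}"]) (auto simp: bd_def intro!: sum.cong)
  finally have EZ2: "expect CB (\<lambda>c. (Z c)\<^sup>2)
    \<le> (M * pA)\<^sup>2 + M\<^sup>2 * (\<Sum>T\<in>Pow V - {{}}. \<theta> T * pA / (\<Prod>k\<in>T. real (card (Lam k))))"
    by (simp add: algebra_simps power_mult_distrib)
  define F where "F = {c. \<forall>l\<in>PiE V Lam. sel c l \<notin> A}"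
  have F: "Z c = 0" if "c \<in> F" for c
    unfolding Z_def using that hA by (intro sum.neutral) (auto simp: F_def)
  \<comment> \<open>Chebyshev's inequality: \<open>Z\<close> vanishes on \<open>F\<close>, so its
    deviation from the mean there is \<open>M * pA\<close>.\<close>
  have "(M * pA)\<^sup>2 * prob CB F = expect CB (\<lambda>c. (M * pA)\<^sup>2 * indicator F c)"
    by simp
  also have "\<dots> \<le> expect CB (\<lambda>c. (Z c - M * pA)\<^sup>2)"
    using F by (intro integral_mono integrable_measure_pmf_finite finCB)
       (auto simp: indicator_def)
  also have "\<dots> = expect CB (\<lambda>c. (Z c)\<^sup>2) - 2 * (M * pA) * expect CB Z + (M * pA)\<^sup>2"
    using finCB by (simp add: power2_diff integrable_measure_pmf_finite algebra_simps)
  also have "\<dots> \<le> M\<^sup>2 * (\<Sum>T\<in>Pow V - {{}}. \<theta> T * pA / (\<Prod>k\<in>T. real (card (Lam k))))"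
  proof -
    have "2 * (M * pA) * (M * pA) = 2 * (M * pA)\<^sup>2"
      by (simp add: power2_eq_square)
    then show ?thesis
      using EZ2 unfolding EZ by linarith
  qed
  finally have *: "(M * pA)\<^sup>2 * prob CB F
    \<le> M\<^sup>2 * (\<Sum>T\<in>Pow V - {{}}. \<theta> T * pA / (\<Prod>k\<in>T. real (card (Lam k))))" .
  have MpA: "M > 0" "pA > 0"
    using Mpos[of V] pos by (auto simp: M_def pA_def)
  have "M\<^sup>2 * (\<Sum>T\<in>Pow V - {{}}. \<theta> T * pA / (\<Prod>k\<in>T. real (card (Lam k))))
     = (M * pA)\<^sup>2 * (\<Sum>T\<in>Pow V - {{}}. \<theta> T / ((\<Prod>k\<in>T. real (card (Lam k))) * pA))"
    using MpA by (simp add: sum_distrib_left power2_eq_square field_simps)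
  with * MpA have "prob CB F \<le> (\<Sum>T\<in>Pow V - {{}}. \<theta> T / ((\<Prod>k\<in>T. real (card (Lam k))) * pA))"
    by simp
  then show ?thesis
    by (simp add: CB_def F_def sel_def pA_def)
qed

section \<open>A random codebook for one block\<close>

text \<open>Used to read the joint law of a pair \<open>(x_k, u_k)\<close> as a draw of the cloud
  centre followed by a draw of the satellite.\<close>

lemma map_pmf_pair_disintegrate:
  "map_pmf (\<lambda>w. (f w, g w)) P
    = bind_pmf (map_pmf f P) (\<lambda>a. map_pmf (Pair a) (map_pmf g (cond_pmf P {w. f w = a})))"
proof -
  have "P = bind_pmf (map_pmf f P) (\<lambda>a. cond_pmf P {w. f w = a})"
    by (intro bind_cond_pmf_cancel[symmetric]) (auto simp: vimage_def)
  then have "map_pmf (\<lambda>w. (f w, g w)) P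
     = map_pmf (\<lambda>w. (f w, g w)) (bind_pmf (map_pmf f P) (\<lambda>a. cond_pmf P {w. f w = a}))"
    by simp
  also have "\<dots> = bind_pmf (map_pmf f P) (\<lambda>a. map_pmf (\<lambda>w. (f w, g w)) (cond_pmf P {w. f w = a}))"
    by (simp add: map_bind_pmf)
  also have "\<dots> = bind_pmf (map_pmf f P) (\<lambda>a. map_pmf (Pair a) (map_pmf g (cond_pmf P {w. f w = a})))"
  proof (intro bind_pmf_cong refl)
    fix a assume "a \<in> set_pmf (map_pmf f P)"
    then have "set_pmf P \<inter> {w. f w = a} \<noteq> {}" by auto
    note set_cond_pmf[OF this]
    then show "map_pmf (\<lambda>w. (f w, g w)) (cond_pmf P {w. f w = a})
      = map_pmf (Pair a) (map_pmf g (cond_pmf P {w. f w = a}))"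
      by (auto simp: pmf.map_comp o_def intro!: map_pmf_cong)
  qed
  finally show ?thesis .
qed

text \<open>Superposition codebook: each index has a cloud centre drawn from \<open>px k\<close>
  and, given it, one satellite for every index. Centres and satellites share the index set
  \<open>L k\<close>, because the satellite index decoded in one block is the centre index of the
  next.\<close>

definition codebook_law ::
  "'k set \<Rightarrow> ('k \<Rightarrow> 'i set) \<Rightarrow> ('k \<Rightarrow> 'a pmf) \<Rightarrow> ('k \<Rightarrow> 'a \<Rightarrow> 'b pmf) \<Rightarrow> ('k \<Rightarrow> 'i \<Rightarrow> 'a \<times> ('i \<Rightarrow> 'b)) pmf"
where
  "codebook_law V L px pu = Pi_pmf V undefined (\<lambda>k. Pi_pmf (L k) undefined (\<lambda>l.
     bind_pmf (px k) (\<lambda>a. map_pmf (Pair a) (Pi_pmf (L k) undefined (\<lambda>_. pu k a)))))"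

text \<open>\<open>t\<close> holds the targets to be decoded and \<open>l\<close> the indices being
  sent, so this is the tuple of pairs \<open>(x_k(l_k), u_k(t_k | l_k))\<close> that has to fit
  jointly.\<close>

definition selected :: "'k set \<Rightarrow> ('k \<Rightarrow> 'i \<Rightarrow> 'a \<times> ('i \<Rightarrow> 'b)) \<Rightarrow> ('k \<Rightarrow> 'i) \<Rightarrow> ('k \<Rightarrow> 'i) \<Rightarrow> 'k \<Rightarrow> 'a \<times> 'b" where
  "selected V c t l = (\<lambda>k\<in>V. (fst (c k (l k)), snd (c k (l k)) (t k)))"

text \<open>The selected l depends on \<open>u_k\<close> only through the codewords \<open>u_k(t_k | .)\<close>. Hence the codewords \<open>u_k(i | .)\<close>
  with i different from \<open>t_k\<close> are independent of the selection and of the channel output.\<close>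

lemma codebook_error_bound:
  fixes A :: "('k \<Rightarrow> 'a \<times> 'b) set" and L Lam :: "'k \<Rightarrow> 'i set" and px :: "'k \<Rightarrow> 'a pmf"
    and pu :: "'k \<Rightarrow> 'a \<Rightarrow> 'b pmf"
    and W :: "('k \<Rightarrow> 'a) \<Rightarrow> 'e \<Rightarrow> 'y pmf" and es :: "('k \<Rightarrow> 'a \<times> 'b) \<Rightarrow> 'e"
    and test :: "'k \<Rightarrow> 'a \<Rightarrow> 'b \<Rightarrow> 'y \<Rightarrow> bool"
  assumes V: "finite V" and \<eta>0: "0 \<le> \<eta>" and L: "\<And>k. k \<in> V \<Longrightarrow> finite (L k)"
    and Lam: "\<And>k. k \<in> V \<Longrightarrow> Lam k \<subseteq> L k" and t: "\<And>k. k \<in> V \<Longrightarrow> t k \<in> L k"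
    and fin: "\<And>k. k \<in> V \<Longrightarrow> finite (set_pmf (px k))"
      "\<And>k a. k \<in> V \<Longrightarrow> a \<in> set_pmf (px k) \<Longrightarrow> finite (set_pmf (pu k a))"
    and g: "\<And>k. k \<in> V \<Longrightarrow> g k = bind_pmf (px k) (\<lambda>a. map_pmf (Pair a) (pu k a))"
    and miss: "\<And>v. v \<in> A \<Longrightarrow>
      prob (W (\<lambda>k\<in>V. fst (v k)) (es v)) {y. \<exists>k\<in>V. \<not> test k (fst (v k)) (snd (v k)) y} \<le> \<eta>"
    and false_alarm: "\<And>k a y. k \<in> V \<Longrightarrow> a \<in> set_pmf (px k) \<Longrightarrow> prob (pu k a) {b. test k a b y} \<le> \<beta> k"
  defines "cover \<equiv> \<lambda>c l. l \<in> PiE V Lam \<and> selected V c t l \<in> A"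
  defines "err \<equiv> \<lambda>c. if \<exists>l. cover c l then
     prob (W (\<lambda>k\<in>V. fst (c k ((SOME l. cover c l) k))) (es (selected V c t (SOME l. cover c l))))
       {y. \<exists>k\<in>V. \<exists>i\<in>L k. test k (fst (c k ((SOME l. cover c l) k))) (snd (c k ((SOME l. cover c l) k)) i) y \<noteq> (i = t k)}
     else 1"
  shows "expect (codebook_law V L px pu) err
    \<le> prob (Pi_pmf V undefined (\<lambda>k. Pi_pmf (L k) undefined (\<lambda>_. g k)))
          {c. \<forall>l\<in>PiE V Lam. (\<lambda>k\<in>V. c k (l k)) \<notin> A}
      + \<eta> + (\<Sum>k\<in>V. real (card (L k)) * \<beta> k)"
proof -
  define CV where "CV = Pi_pmf V undefined (\<lambda>k. Pi_pmf (L k) undefined (\<lambda>_. g k))"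
  \<comment> \<open>\<open>cv\<close> consists of the cloud centres and, for each of them, the
    satellite with index \<open>t k\<close>; \<open>R cv\<close> draws the other satellites. The
    selection is a function of \<open>cv\<close> alone.\<close>
  define R where "R = (\<lambda>cv. Pi_pmf V undefined (\<lambda>k. Pi_pmf (L k) undefined (\<lambda>l.
     map_pmf (\<lambda>r. (fst (cv k l), r(t k := snd (cv k l))))
       (Pi_pmf (L k - {t k}) undefined (\<lambda>_. pu k (fst (cv k l)))))))"
  have law: "codebook_law V L px pu = bind_pmf CV R"
  proof -
    have "bind_pmf (px k) (\<lambda>a. map_pmf (Pair a) (Pi_pmf (L k) undefined (\<lambda>_. pu k a)))
      = bind_pmf (g k) (\<lambda>ab. map_pmf (\<lambda>r. (fst ab, r(t k := snd ab)))
          (Pi_pmf (L k - {t k}) undefined (\<lambda>_. pu k (fst ab))))" if k: "k \<in> V" for k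
    proof -
      have "Pi_pmf (L k) undefined (\<lambda>_. pu k a)
        = bind_pmf (pu k a) (\<lambda>b. map_pmf (\<lambda>r. r(t k := b)) (Pi_pmf (L k - {t k}) undefined (\<lambda>_. pu k a)))" for a
        using Pi_pmf_insert'[of "L k - {t k}" "t k" undefined "\<lambda>_. pu k a"] L[OF k] t[OF k]
        by (simp add: insert_absorb map_pmf_def)
      then show ?thesis
        using k by (simp add: g bind_assoc_pmf map_bind_pmf pmf.map_comp o_def bind_map_pmf)
    qed
    then have "codebook_law V L px pu = Pi_pmf V undefined (\<lambda>k. Pi_pmf (L k) undefined (\<lambda>l.
       bind_pmf (g k) (\<lambda>ab. map_pmf (\<lambda>r. (fst ab, r(t k := snd ab)))
          (Pi_pmf (L k - {t k}) undefined (\<lambda>_. pu k (fst ab))))))"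
      unfolding codebook_law_def by (intro Pi_pmf_cong refl) simp
    also have "\<dots> = Pi_pmf V undefined (\<lambda>k. bind_pmf (Pi_pmf (L k) undefined (\<lambda>_. g k)) (\<lambda>cv.
        Pi_pmf (L k) undefined (\<lambda>l. map_pmf (\<lambda>r. (fst (cv l), r(t k := snd (cv l))))
          (Pi_pmf (L k - {t k}) undefined (\<lambda>_. pu k (fst (cv l)))))))"
      using L by (intro Pi_pmf_cong refl Pi_pmf_bind) auto
    also have "\<dots> = bind_pmf CV R"
      unfolding CV_def R_def using V by (rule Pi_pmf_bind)
    finally show ?thesis .
  qed
  have fing: "finite (set_pmf (g k))" if "k \<in> V" for k
    using that fin by (auto simp: g)
  have finCV: "finite (set_pmf CV)"
    unfolding CV_def using V L fing by (intro finite_set_Pi_pmf) auto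
  have cvg: "cv k l \<in> set_pmf (g k)" if "cv \<in> set_pmf CV" "k \<in> V" "l \<in> L k" for cv k l
    using that V L by (fastforce simp: CV_def set_Pi_pmf PiE_dflt_def)
  have cvx: "fst (cv k l) \<in> set_pmf (px k)" if "cv \<in> set_pmf CV" "k \<in> V" "l \<in> L k" for cv k l
    using cvg[OF that] that(2) by (auto simp: g)
  have finR: "finite (set_pmf (R cv))" if "cv \<in> set_pmf CV" for cv
    unfolding R_def using V L fin cvx[OF that] by (intro finite_set_Pi_pmf) (auto intro!: finite_set_Pi_pmf)
  have Rsel: "fst (c k l) = fst (cv k l)" "snd (c k l) (t k) = snd (cv k l)"
    if "c \<in> set_pmf (R cv)" "k \<in> V" "l \<in> L k" for c cv k l
  proof -
    have "c k \<in> set_pmf (Pi_pmf (L k) undefined (\<lambda>l.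
     map_pmf (\<lambda>r. (fst (cv k l), r(t k := snd (cv k l))))
       (Pi_pmf (L k - {t k}) undefined (\<lambda>_. pu k (fst (cv k l))))))"
      using that(1,2) V unfolding R_def by (auto simp: set_Pi_pmf PiE_dflt_def)
    then have "c k l \<in> set_pmf (map_pmf (\<lambda>r. (fst (cv k l), r(t k := snd (cv k l))))
       (Pi_pmf (L k - {t k}) undefined (\<lambda>_. pu k (fst (cv k l)))))"
      using that L by (auto simp: set_Pi_pmf PiE_dflt_def)
    then show "fst (c k l) = fst (cv k l)" "snd (c k l) (t k) = snd (cv k l)"
      by auto
  qed
  have Rcomp: "map_pmf (\<lambda>c. snd (c k l) i) (R cv) = pu k (fst (cv k l))"
    if "k \<in> V" "l \<in> L k" "i \<in> L k - {t k}" for cv k l i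
  proof -
    have "map_pmf (\<lambda>c. snd (c k l) i) (R cv)
      = map_pmf (\<lambda>d. snd d i) (map_pmf (\<lambda>c. c l) (map_pmf (\<lambda>c. c k) (R cv)))"
      by (simp add: pmf.map_comp o_def)
    also have "\<dots> = map_pmf (\<lambda>r. r i) (Pi_pmf (L k - {t k}) undefined (\<lambda>_. pu k (fst (cv k l))))"
      using that V L by (simp add: R_def Pi_pmf_component pmf.map_comp o_def)
    also have "\<dots> = pu k (fst (cv k l))"
      using that L by (simp add: Pi_pmf_component)
    finally show ?thesis .
  qed
  have \<beta>0: "0 \<le> \<beta> k" if "k \<in> V" for k
  proof -
    obtain a where "a \<in> set_pmf (px k)" using set_pmf_not_empty[of "px k"] by blast
    from false_alarm[OF that this] show ?thesis
      using measure_nonneg order_trans by blast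
  qed
  define F where "F = {c. \<forall>l\<in>PiE V Lam. (\<lambda>k\<in>V. c k (l k)) \<notin> A}"
  define B where "B = (\<Sum>k\<in>V. real (card (L k)) * \<beta> k)"
  have B0: "0 \<le> B" unfolding B_def using \<beta>0 by (intro sum_nonneg) auto
  have step: "expect (R cv) err \<le> indicator F cv + \<eta> + B"
    if cv: "cv \<in> set_pmf CV" for cv
  proof -
    have coverR: "cover c l \<longleftrightarrow> l \<in> PiE V Lam \<and> (\<lambda>k\<in>V. cv k (l k)) \<in> A"
      and selR: "l \<in> PiE V Lam \<Longrightarrow> selected V c t l = (\<lambda>k\<in>V. cv k (l k))"
      if c: "c \<in> set_pmf (R cv)" for c l
    proof -
      show *: "selected V c t l = (\<lambda>k\<in>V. cv k (l k))" if "l \<in> PiE V Lam"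
        using that Rsel[OF c] Lam unfolding selected_def
        by (intro restrict_ext) (auto simp: prod_eq_iff subset_eq PiE_def Pi_def)
      show "cover c l \<longleftrightarrow> l \<in> PiE V Lam \<and> (\<lambda>k\<in>V. cv k (l k)) \<in> A"
        unfolding cover_def using * by auto
    qed
    show ?thesis
    proof (cases "cv \<in> F")
      case True
      then have "\<not> (\<exists>l. cover c l)" if "c \<in> set_pmf (R cv)" for c
        using coverR[OF that] by (auto simp: F_def)
      then have "expect (R cv) err = expect (R cv) (\<lambda>_. 1)"
        by (intro integral_cong_AE) (auto simp: err_def AE_measure_pmf_iff)
      then show ?thesis using True B0 \<eta>0 by (auto simp: indicator_def F_def)
    next
      case False
      define l where "l = (SOME l. l \<in> PiE V Lam \<and> (\<lambda>k\<in>V. cv k (l k)) \<in> A)"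
      define v where "v = (\<lambda>k\<in>V. cv k (l k))"
      have l: "l \<in> PiE V Lam \<and> (\<lambda>k\<in>V. cv k (l k)) \<in> A"
      proof -
        have "\<exists>l. l \<in> PiE V Lam \<and> (\<lambda>k\<in>V. cv k (l k)) \<in> A"
          using False by (auto simp: F_def)
        then show ?thesis
          unfolding l_def by (rule someI_ex)
      qed
      then have lL: "l k \<in> L k" if "k \<in> V" for k
        using that Lam by (auto simp: subset_eq PiE_def Pi_def)
      have vA: "v \<in> A" using l by (simp add: v_def)
      define Y where "Y = W (\<lambda>k\<in>V. fst (v k)) (es v)"
      define bad where "bad = (\<lambda>k i (c :: 'k \<Rightarrow> 'i \<Rightarrow> 'a \<times> ('i \<Rightarrow> 'b)). {y. test k (fst (v k)) (snd (c k (l k)) i) y})"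
      \<comment> \<open>Either some true satellite fails its test or some false one passes. The
        first event is controlled by \<open>miss\<close>, the second is left for the average over
        \<open>R cv\<close>.\<close>
      have bound: "err c \<le> \<eta> + (\<Sum>k\<in>V. \<Sum>i\<in>L k - {t k}. prob Y (bad k i c))"
        if c: "c \<in> set_pmf (R cv)" for c
      proof -
        have some: "(SOME l. cover c l) = l"
          unfolding l_def coverR[OF c] ..
        have ex: "\<exists>l. cover c l" using l coverR[OF c] by blast
        have sel: "selected V c t l = v" using selR[OF c] l by (auto simp: v_def)
        have f: "fst (c k (l k)) = fst (v k)" "snd (c k (l k)) (t k) = snd (v k)" if "k \<in> V" for k
          using Rsel[OF c that lL[OF that]] that by (auto simp: v_def)
        have "(\<lambda>k\<in>V. fst (c k (l k))) = (\<lambda>k\<in>V. fst (v k))"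
          using f by auto
        then have "err c = prob Y {y. \<exists>k\<in>V. \<exists>i\<in>L k. test k (fst (c k (l k))) (snd (c k (l k)) i) y \<noteq> (i = t k)}"
          using ex unfolding err_def some sel Y_def by simp
        also have "\<dots> \<le> prob Y ({y. \<exists>k\<in>V. \<not> test k (fst (v k)) (snd (v k)) y}
            \<union> (\<Union>k\<in>V. \<Union>i\<in>L k - {t k}. bad k i c))"
          using f by (intro measure_pmf.finite_measure_mono) (auto simp: bad_def)
        also have "\<dots> \<le> prob Y {y. \<exists>k\<in>V. \<not> test k (fst (v k)) (snd (v k)) y}
            + prob Y (\<Union>k\<in>V. \<Union>i\<in>L k - {t k}. bad k i c)"
          by (intro measure_subadditive) auto
        also have "\<dots> \<le> \<eta> + prob Y (\<Union>k\<in>V. \<Union>i\<in>L k - {t k}. bad k i c)"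
          using miss[OF vA] by (simp add: Y_def)
        also have "prob Y (\<Union>k\<in>V. \<Union>i\<in>L k - {t k}. bad k i c)
            \<le> (\<Sum>k\<in>V. prob Y (\<Union>i\<in>L k - {t k}. bad k i c))"
          using V by (intro measure_pmf.finite_measure_subadditive_finite) auto
        also have "\<dots> \<le> (\<Sum>k\<in>V. \<Sum>i\<in>L k - {t k}. prob Y (bad k i c))"
          using L by (intro sum_mono measure_pmf.finite_measure_subadditive_finite) auto
        finally show ?thesis by simp
      qed
      \<comment> \<open>A false satellite is independent of the output. Exchanging the two draws
        reduces the claim to a fixed output \<open>y\<close>, where \<open>false_alarm\<close>
        applies.\<close>
      have alarm: "expect (R cv) (\<lambda>c. prob Y (bad k i c)) \<le> \<beta> k"
        if ki: "k \<in> V" "i \<in> L k - {t k}" for k i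
      proof -
        let ?a = "fst (v k)"
        have a: "?a \<in> set_pmf (px k)" using cvx[OF cv ki(1) lL[OF ki(1)]] ki by (simp add: v_def)
        have "expect (R cv) (\<lambda>c. prob Y (bad k i c))
          = expect (map_pmf (\<lambda>c. snd (c k (l k)) i) (R cv))
              (\<lambda>b. prob Y {y. test k ?a b y})"
          by (simp add: bad_def)
        also have "\<dots> = expect (pu k ?a) (\<lambda>b. prob (map_pmf (Pair b) Y) {(b, y). test k ?a b y})"
          using Rcomp[OF ki(1) lL[OF ki(1)] ki(2)] ki by (simp add: v_def vimage_def)
        also have "\<dots> = prob (bind_pmf (pu k ?a) (\<lambda>b. bind_pmf Y (\<lambda>y. return_pmf (b, y)))) {(b, y). test k ?a b y}"
          by (simp add: measure_bind_pmf map_pmf_def)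
        also have "\<dots> = prob (bind_pmf Y (\<lambda>y. map_pmf (\<lambda>b. (b, y)) (pu k ?a))) {(b, y). test k ?a b y}"
          by (subst bind_commute_pmf) (simp add: map_pmf_def)
        also have "\<dots> = expect Y (\<lambda>y. prob (pu k ?a) {b. test k ?a b y})"
          by (simp add: measure_bind_pmf vimage_def)
        also have "\<dots> \<le> expect Y (\<lambda>y. \<beta> k)"
        proof (rule integral_mono)
          show "integrable Y (\<lambda>y. prob (pu k ?a) {b. test k ?a b y})"
            by (intro measure_pmf.integrable_const_bound[where B = 1]) auto
        qed (use false_alarm[OF ki(1) a] in auto)
        finally show ?thesis by simp
      qed
      have intR: "integrable (R cv) f" for f :: "_ \<Rightarrow> real"
        using finR[OF cv] by (rule integrable_measure_pmf_finite)
      have "expect (R cv) err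
        \<le> expect (R cv) (\<lambda>c. \<eta> + (\<Sum>k\<in>V. \<Sum>i\<in>L k - {t k}. prob Y (bad k i c)))"
        using bound by (intro integral_mono_AE intR) (auto simp: AE_measure_pmf_iff)
      also have "\<dots> = \<eta> + (\<Sum>k\<in>V. \<Sum>i\<in>L k - {t k}. expect (R cv) (\<lambda>c. prob Y (bad k i c)))"
        by (simp add: intR)
      also have "\<dots> \<le> \<eta> + (\<Sum>k\<in>V. \<Sum>i\<in>L k - {t k}. \<beta> k)"
        using alarm by (intro add_left_mono sum_mono) auto
      also have "\<dots> \<le> \<eta> + B"
        unfolding B_def using L \<beta>0 by (auto intro!: sum_mono mult_right_mono card_mono)
      finally show ?thesis using False by (auto simp: F_def)
    qed
  qed
  have "expect (codebook_law V L px pu) err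
     = expect CV (\<lambda>cv. expect (R cv) err)"
    unfolding law using finCV finR by (intro expectation_bind_pmf) auto
  also have "\<dots> \<le> expect CV (\<lambda>cv. indicator F cv + \<eta> + B)"
    using step by (intro integral_mono_AE integrable_measure_pmf_finite finCV) (auto simp: AE_measure_pmf_iff)
  also have "\<dots> = prob CV F + \<eta> + B"
    using finCV by (simp add: integrable_measure_pmf_finite)
  finally show ?thesis
    by (simp add: CV_def F_def B_def)
qed

lemma expectation_swap:
  fixes f :: "'a \<Rightarrow> 'b \<Rightarrow> real" and p :: "'a pmf" and q :: "'b pmf"
  assumes "finite (set_pmf p)" "\<And>a. a \<in> set_pmf p \<Longrightarrow> integrable q (f a)"
  shows "expect p (\<lambda>a. expect q (f a))
    = expect q (\<lambda>b. expect p (\<lambda>a. f a b))"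
proof -
  have *: "expect p h = (\<Sum>a\<in>set_pmf p. pmf p a * h a)" for h :: "'a \<Rightarrow> real"
    using assms(1) by (subst integral_measure_pmf[where A = "set_pmf p"]) auto
  show ?thesis
    unfolding * using assms(2) by (subst Bochner_Integration.integral_sum) auto
qed

text \<open>Random coding with time sharing: a pair \<open>(q, c)\<close> is drawn, the error is
  averaged also over \<open>om\<close>, and one pair no worse than the average is kept for all
  \<open>om\<close>. The tuples to be covered, \<open>A q\<close>, are those that some word
  \<open>w\<close> realises with bounded densities and with conditional miss probability at most
  \<open>\<eta>\<close>. The source has no codebook of its own: it sends the component
  \<open>ef w\<close> of such a \<open>w\<close>, which fits the selected words.\<close>

lemma one_shot_block:
  fixes J :: "'w pmf" and qf :: "'w \<Rightarrow> 'q" and xf :: "'k \<Rightarrow> 'w \<Rightarrow> 'a" and uf :: "'k \<Rightarrow> 'w \<Rightarrow> 'b"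
    and ef :: "'w \<Rightarrow> 'e" and Wc :: "'q \<Rightarrow> ('k \<Rightarrow> 'a) \<Rightarrow> 'e \<Rightarrow> 'y pmf"
    and test :: "'k \<Rightarrow> 'q \<Rightarrow> 'a \<Rightarrow> 'b \<Rightarrow> 'y \<Rightarrow> bool"
    and L :: "'k \<Rightarrow> 'i set" and \<mu> :: "'o pmf" and tgt :: "'o \<Rightarrow> 'k \<Rightarrow> 'i" and Lam :: "'o \<Rightarrow> 'k \<Rightarrow> 'i set"
    and V :: "'k set" and M :: "'k \<Rightarrow> nat" and \<theta> :: "'k set \<Rightarrow> real"
  defines "Jq \<equiv> \<lambda>q. cond_pmf J {w. qf w = q}"
  defines "dens \<equiv> \<lambda>w. \<forall>T\<subseteq>V. T \<noteq> {} \<longrightarrow>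
      prob (Jq (qf w)) {w'. \<forall>k\<in>T. xf k w' = xf k w \<and> uf k w' = uf k w}
      \<le> \<theta> T * (\<Prod>k\<in>T. prob (Jq (qf w)) {w'. xf k w' = xf k w \<and> uf k w' = uf k w})"
  assumes V: "finite V" and J: "finite (set_pmf J)" and L: "\<And>k. k \<in> V \<Longrightarrow> finite (L k)"
    and tgt: "\<And>om k. k \<in> V \<Longrightarrow> tgt om k \<in> L k"
    and Lam: "\<And>om k. k \<in> V \<Longrightarrow> Lam om k \<subseteq> L k" "\<And>om k. k \<in> V \<Longrightarrow> card (Lam om k) = M k"
    and M: "\<And>k. k \<in> V \<Longrightarrow> M k > 0"
    and \<theta>: "\<And>T. T \<subseteq> V \<Longrightarrow> \<theta> T \<ge> 0"
    and cov: "prob J {w. \<not> dens w} \<le> \<epsilon>0"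
    and miss: "prob (bind_pmf J (\<lambda>w. map_pmf (Pair w) (Wc (qf w) (\<lambda>k\<in>V. xf k w) (ef w))))
         {(w, y). \<exists>k\<in>V. \<not> test k (qf w) (xf k w) (uf k w) y} \<le> \<epsilon>1"
    and false_alarm: "\<And>w k y. w \<in> set_pmf J \<Longrightarrow> k \<in> V \<Longrightarrow>
         prob (cond_pmf (Jq (qf w)) {w'. xf k w' = xf k w}) {w'. test k (qf w) (xf k w) (uf k w') y} \<le> \<beta> k"
    and \<eta>: "\<eta> > 0"
  shows "\<exists>q c sel e. q \<in> qf ` set_pmf J \<and> (\<forall>k\<in>V. \<forall>l\<in>L k. fst (c k l) \<in> xf k ` set_pmf J) \<and>
     (\<forall>om. e om \<in> ef ` set_pmf J \<and> sel om \<in> PiE V (Lam om)) \<and>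
     expect \<mu> (\<lambda>om. prob (Wc q (\<lambda>k\<in>V. fst (c k (sel om k))) (e om))
       {y. \<exists>k\<in>V. \<exists>i\<in>L k. test k q (fst (c k (sel om k))) (snd (c k (sel om k)) i) y \<noteq> (i = tgt om k)})
     \<le> 2 * (\<epsilon>0 + \<epsilon>1 / \<eta>) + 2 * (\<Sum>T\<in>Pow V - {{}}. \<theta> T / (\<Prod>k\<in>T. real (M k))) + \<eta>
        + (\<Sum>k\<in>V. real (card (L k)) * \<beta> k)"
proof -
  define vf where "vf = (\<lambda>w. \<lambda>k\<in>V. (xf k w, uf k w))"
  define F where "F = (\<lambda>w. prob (Wc (qf w) (\<lambda>k\<in>V. xf k w) (ef w))
     {y. \<exists>k\<in>V. \<not> test k (qf w) (xf k w) (uf k w) y})"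
  define good where "good = (\<lambda>q v w. w \<in> set_pmf J \<and> qf w = q \<and> v = vf w \<and> dens w \<and> F w \<le> \<eta>)"
  define A where "A = (\<lambda>q. {v. \<exists>w. good q v w})"
  obtain w0 where w0: "w0 \<in> set_pmf J"
    using set_pmf_not_empty[of J] by blast
  \<comment> \<open>A suitable \<open>w\<close> is recovered from the selected tuple by choice;
    outside \<open>A q\<close> any source word serves.\<close>
  define es where "es = (\<lambda>q v. if v \<in> A q then ef (SOME w. good q v w) else ef w0)"
  define px where "px = (\<lambda>q k. map_pmf (xf k) (Jq q))"
  define pu where "pu = (\<lambda>q k a. map_pmf (uf k) (cond_pmf (Jq q) {w. xf k w = a}))"
  define g where "g = (\<lambda>q k. map_pmf (\<lambda>w. (xf k w, uf k w)) (Jq q))"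
  have good: "good q v (SOME w. good q v w)" if "v \<in> A q" for q v
    using that unfolding A_def mem_Collect_eq by (rule someI_ex)
  have es: "es q v \<in> ef ` set_pmf J" for q v
    using good[of v q] w0 by (auto simp: es_def good_def)
  have setJq: "set_pmf (Jq (qf w)) = {w'\<in>set_pmf J. qf w' = qf w}" if "w \<in> set_pmf J" for w
    unfolding Jq_def using that by (subst set_cond_pmf) auto
  define cover where "cover = (\<lambda>q om c l. l \<in> PiE V (Lam om) \<and> selected V c (tgt om) l \<in> A q)"
  \<comment> \<open>If no selection covers, an arbitrary admissible one is sent; \<open>err\<close>
    counts this case as error 1.\<close>
  define S where "S = (\<lambda>q om c. if \<exists>l. cover q om c l then SOME l. cover q om c l else SOME l. l \<in> PiE V (Lam om))"
  define err where "err = (\<lambda>q om c. if \<exists>l. cover q om c l then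
     prob (Wc q (\<lambda>k\<in>V. fst (c k ((SOME l. cover q om c l) k))) (es q (selected V c (tgt om) (SOME l. cover q om c l))))
       {y. \<exists>k\<in>V. \<exists>i\<in>L k. test k q (fst (c k ((SOME l. cover q om c l) k))) (snd (c k ((SOME l. cover q om c l) k)) i) y \<noteq> (i = tgt om k)}
     else 1)"
  define err' where "err' = (\<lambda>q om c. prob (Wc q (\<lambda>k\<in>V. fst (c k (S q om c k))) (es q (selected V c (tgt om) (S q om c))))
       {y. \<exists>k\<in>V. \<exists>i\<in>L k. test k q (fst (c k (S q om c k))) (snd (c k (S q om c k)) i) y \<noteq> (i = tgt om k)})"
  have err': "err' q om c \<le> err q om c" for q om c
    unfolding err'_def err_def S_def by auto
  have err01: "0 \<le> err q om c" "err q om c \<le> 1" for q om c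
    by (auto simp: err_def)
  have LamNE: "Lam om k \<noteq> {}" if "k \<in> V" for om k
    using M[OF that] Lam(2)[OF that, of om] by auto
  have S: "S q om c \<in> PiE V (Lam om)" for q om c
  proof (cases "\<exists>l. cover q om c l")
    case True
    then have "cover q om c (SOME l. cover q om c l)" by (rule someI_ex)
    then show ?thesis using True by (auto simp: S_def cover_def)
  next
    case False
    have "\<exists>l. l \<in> PiE V (Lam om)" using LamNE by (simp add: ex_in_conv PiE_eq_empty_iff)
    then have "(SOME l. l \<in> PiE V (Lam om)) \<in> PiE V (Lam om)" by (rule someI_ex)
    then show ?thesis unfolding S_def if_not_P[OF False] .
  qed
  define CB where "CB = (\<lambda>q. codebook_law V L (px q) (pu q))"
  define \<Lambda> where "\<Lambda> = bind_pmf (map_pmf qf J) (\<lambda>q. map_pmf (Pair q) (CB q))"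
  define pA where "pA = (\<lambda>q. prob (map_pmf vf (Jq q)) (A q))"
  define C where "C = (\<Sum>T\<in>Pow V - {{}}. \<theta> T / (\<Prod>k\<in>T. real (M k)))"
  define B where "B = (\<Sum>k\<in>V. real (card (L k)) * \<beta> k)"
  have C0: "C \<ge> 0" unfolding C_def using \<theta> by (intro sum_nonneg divide_nonneg_nonneg prod_nonneg) auto
  have finJq: "finite (set_pmf (Jq q))" if "q \<in> qf ` set_pmf J" for q
    using that setJq J by auto
  have finpx: "finite (set_pmf (px q k))" if "q \<in> qf ` set_pmf J" for q k
    using finJq[OF that] by (simp add: px_def)
  have finpu: "finite (set_pmf (pu q k a))" if "q \<in> qf ` set_pmf J" "a \<in> set_pmf (px q k)" for q k a
  proof -
    have "set_pmf (Jq q) \<inter> {w. xf k w = a} \<noteq> {}" using that(2) by (auto simp: px_def)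
    then show ?thesis using finJq[OF that(1)] by (simp add: pu_def set_cond_pmf)
  qed
  have finCB: "finite (set_pmf (CB q))" if "q \<in> qf ` set_pmf J" for q
    unfolding CB_def codebook_law_def using V L finpx[OF that] finpu[OF that]
    by (intro finite_set_Pi_pmf) (auto intro!: finite_set_Pi_pmf)
  have finL: "finite (set_pmf \<Lambda>)"
    unfolding \<Lambda>_def using J finCB by auto
  have block: "expect (CB q) (err q om) \<le> 2 * (1 - pA q) + 2 * C + \<eta> + B"
    if q: "q \<in> qf ` set_pmf J" for q om
  proof -
    obtain wq where wq: "wq \<in> set_pmf J" "qf wq = q" using q by auto
    have "expect (CB q) (err q om)
      \<le> prob (Pi_pmf V undefined (\<lambda>k. Pi_pmf (L k) undefined (\<lambda>_. g q k)))
          {c. \<forall>l\<in>PiE V (Lam om). (\<lambda>k\<in>V. c k (l k)) \<notin> A q}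
      + \<eta> + B"
      unfolding CB_def err_def cover_def B_def
    proof (rule codebook_error_bound)
      show "prob (Wc q (\<lambda>k\<in>V. fst (v k)) (es q v)) {y. \<exists>k\<in>V. \<not> test k q (fst (v k)) (snd (v k)) y} \<le> \<eta>"
        if v: "v \<in> A q" for v
      proof -
        define w where "w = (SOME w. good q v w)"
        have w: "good q v w" using good[OF v] by (simp add: w_def)
        have "(\<lambda>k\<in>V. fst (v k)) = (\<lambda>k\<in>V. xf k w)"
          using w by (auto simp: good_def vf_def)
        moreover have "es q v = ef w" using v by (simp add: es_def w_def)
        moreover have "{y. \<exists>k\<in>V. \<not> test k q (fst (v k)) (snd (v k)) y} = {y. \<exists>k\<in>V. \<not> test k q (xf k w) (uf k w) y}"
          using w by (auto simp: good_def vf_def)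
        ultimately show ?thesis using w unfolding good_def F_def by metis
      qed
      show "prob (pu q k a) {b. test k q a b y} \<le> \<beta> k" if kV: "k \<in> V" and ax: "a \<in> set_pmf (px q k)" for k a y
      proof -
        obtain w where "w \<in> set_pmf J" "qf w = q" "a = xf k w"
          using ax setJq[OF wq(1)] wq(2) by (auto simp: px_def)
        then show ?thesis using false_alarm[of w k y] kV by (simp add: pu_def vimage_def)
      qed
      show "g q k = bind_pmf (px q k) (\<lambda>a. map_pmf (Pair a) (pu q k a))" for k
        unfolding g_def px_def pu_def by (rule map_pmf_pair_disintegrate)
    qed (use V L Lam tgt \<eta> finpx[OF q] finpu[OF q] in auto)
    also have "prob (Pi_pmf V undefined (\<lambda>k. Pi_pmf (L k) undefined (\<lambda>_. g q k)))
          {c. \<forall>l\<in>PiE V (Lam om). (\<lambda>k\<in>V. c k (l k)) \<notin> A q} \<le> 2 * (1 - pA q) + 2 * C" (is "?P \<le> _")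
    \<comment> \<open>Below 1/2 the claimed bound is at least 1 and hence trivial; otherwise the
      division by \<open>pA q\<close> costs at most the factor 2.\<close>
    proof (cases "pA q \<ge> 1/2")
      case False
      have "?P \<le> 1" by simp
      also have "1 \<le> 2 * (1 - pA q)" using False by simp
      also have "\<dots> \<le> 2 * (1 - pA q) + 2 * C" using C0 by simp
      finally show ?thesis .
    next
      case True
      have "?P \<le> (\<Sum>T\<in>Pow V - {{}}. \<theta> T / ((\<Prod>k\<in>T. real (card (Lam om k))) * pA q))"
        unfolding pA_def
      proof (rule mutual_covering)
        show "prob (map_pmf vf (Jq q)) (A q) > 0" using True by (simp add: pA_def)
        fix v T assume v: "v \<in> A q" and T: "T \<subseteq> V" "T \<noteq> {}"
        obtain w where w: "w \<in> set_pmf J" "qf w = q" "v = vf w" "dens w"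
          using v by (auto simp: A_def good_def)
        have "restrict (vf w') T = restrict (vf w) T \<longleftrightarrow> (\<forall>k\<in>T. xf k w' = xf k w \<and> uf k w' = uf k w)" for w'
          using T by (auto simp: vf_def fun_eq_iff restrict_def subset_eq)
        then have "prob (map_pmf vf (Jq q)) {w. restrict w T = restrict v T}
          = prob (Jq q) {w'. \<forall>k\<in>T. xf k w' = xf k w \<and> uf k w' = uf k w}"
          by (simp add: w(3) vimage_def)
        also have "\<dots> \<le> \<theta> T * (\<Prod>k\<in>T. prob (Jq q) {w'. xf k w' = xf k w \<and> uf k w' = uf k w})"
          using w T by (simp add: dens_def)
        also have "(\<Prod>k\<in>T. prob (Jq q) {w'. xf k w' = xf k w \<and> uf k w' = uf k w}) = (\<Prod>k\<in>T. pmf (g q k) (v k))"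
          using T w by (intro prod.cong refl) (auto simp: g_def vf_def pmf_map vimage_def subset_eq)
        finally show "prob (map_pmf vf (Jq q)) {w. restrict w T = restrict v T}
          \<le> \<theta> T * (\<Prod>k\<in>T. pmf (g q k) (v k))" .
      qed (use V L Lam LamNE \<theta> finJq[OF q] in \<open>auto simp: vf_def g_def pmf.map_comp o_def intro!: map_pmf_cong\<close>)
      also have "\<dots> \<le> (\<Sum>T\<in>Pow V - {{}}. 2 * (\<theta> T / (\<Prod>k\<in>T. real (M k))))"
      proof (intro sum_mono)
        fix T assume T: "T \<in> Pow V - {{}}"
        have eq: "(\<Prod>k\<in>T. real (card (Lam om k))) = (\<Prod>k\<in>T. real (M k))"
          using T Lam by (intro prod.cong) auto
        have p: "(\<Prod>k\<in>T. real (M k)) > 0" using T M by (intro prod_pos) (metis DiffD1 PowD of_nat_0_less_iff subsetD)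
        have "\<theta> T / (\<Prod>k\<in>T. real (M k)) / pA q \<le> \<theta> T / (\<Prod>k\<in>T. real (M k)) / (1/2)"
          using True p T \<theta>[of T] by (intro divide_left_mono) auto
        then show "\<theta> T / ((\<Prod>k\<in>T. real (card (Lam om k))) * pA q) \<le> 2 * (\<theta> T / (\<Prod>k\<in>T. real (M k)))"
          unfolding eq by (simp add: mult.commute[of 2])
      qed
      also have "\<dots> = 2 * C" by (simp add: C_def sum_distrib_left)
      also have "2 * C \<le> 2 * (1 - pA q) + 2 * C"
        using measure_pmf.prob_le_1[of "map_pmf vf (Jq q)" "A q"] by (simp add: pA_def)
      finally show ?thesis .
    qed
    finally show ?thesis by simp
  qed
  \<comment> \<open>By Markov's inequality \<open>F\<close> exceeds \<open>\<eta>\<close> with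
    probability at most \<open>\<epsilon>1 / \<eta>\<close>; the density condition fails with
    probability at most \<open>\<epsilon>0\<close>.\<close>
  have EpA: "expect (map_pmf qf J) pA \<ge> 1 - (\<epsilon>0 + \<epsilon>1 / \<eta>)"
  proof -
    have "expect (map_pmf qf J) pA
      = prob (bind_pmf (map_pmf qf J) (\<lambda>q. map_pmf (Pair q) (map_pmf vf (Jq q)))) {(q, v). v \<in> A q}"
      by (simp add: measure_bind_pmf pA_def vimage_def)
    also have "\<dots> = prob J {w. vf w \<in> A (qf w)}"
      unfolding Jq_def map_pmf_pair_disintegrate[symmetric] by (simp add: vimage_def)
    also have "\<dots> = 1 - prob J {w. vf w \<notin> A (qf w)}"
      using measure_pmf.prob_compl[of "{w. vf w \<notin> A (qf w)}" J] by (simp add: Compl_eq_Diff_UNIV[symmetric] Collect_neg_eq[symmetric])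
    finally have "expect (map_pmf qf J) pA = 1 - prob J {w. vf w \<notin> A (qf w)}" .
    moreover have "prob J {w. vf w \<notin> A (qf w)} \<le> \<epsilon>0 + \<epsilon>1 / \<eta>"
    proof -
      have "prob J {w. vf w \<notin> A (qf w)} = prob J ({w. vf w \<notin> A (qf w)} \<inter> set_pmf J)"
        by (simp add: measure_Int_set_pmf)
      also have "\<dots> \<le> prob J ({w. \<not> dens w} \<union> {w. F w > \<eta>})"
        by (intro measure_pmf.finite_measure_mono) (auto simp: A_def good_def not_le)
      also have "\<dots> \<le> prob J {w. \<not> dens w} + prob J {w. F w > \<eta>}"
        by (intro measure_subadditive) auto
      also have "prob J {w. F w > \<eta>} \<le> \<epsilon>1 / \<eta>"
      proof -
        have "\<eta> * prob J {w. F w > \<eta>} = expect J (\<lambda>w. \<eta> * indicator {w. F w > \<eta>} w)"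
          by simp
        also have "\<dots> \<le> expect J F"
          using J by (intro integral_mono integrable_measure_pmf_finite) (auto simp: indicator_def F_def)
        also have "\<dots> \<le> \<epsilon>1"
          using miss by (simp add: measure_bind_pmf F_def[abs_def] vimage_def)
        finally show ?thesis using \<eta> by (simp add: field_simps)
      qed
      finally show ?thesis using cov by linarith
    qed
    ultimately show ?thesis by simp
  qed
  have "expect \<Lambda> (\<lambda>(q, c). expect \<mu> (\<lambda>om. err q om c))
     = expect \<mu> (\<lambda>om. expect \<Lambda> (\<lambda>(q, c). err q om c))"
    unfolding case_prod_beta using finL err01
    by (intro expectation_swap) (auto intro!: measure_pmf.integrable_const_bound[where B = 1])
  also have "\<dots> \<le> expect \<mu> (\<lambda>om. 2 * (\<epsilon>0 + \<epsilon>1 / \<eta>) + 2 * C + \<eta> + B)"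
  proof (intro integral_mono)
    fix om
    have "expect \<Lambda> (\<lambda>(q, c). err q om c)
       = expect (map_pmf qf J) (\<lambda>q. expect (CB q) (err q om))"
      unfolding \<Lambda>_def using J finCB by (subst expectation_bind_pmf) auto
    also have "\<dots> \<le> expect (map_pmf qf J) (\<lambda>q. 2 * (1 - pA q) + 2 * C + \<eta> + B)"
      using J block by (intro integral_mono_AE integrable_measure_pmf_finite) (auto simp: AE_measure_pmf_iff)
    also have "\<dots> = 2 * (1 - expect (map_pmf qf J) pA) + 2 * C + \<eta> + B"
      using J by (simp add: integrable_measure_pmf_finite del: integral_map_pmf)
    also have "\<dots> \<le> 2 * (\<epsilon>0 + \<epsilon>1 / \<eta>) + 2 * C + \<eta> + B"
      using EpA by simp
    finally show "expect \<Lambda> (\<lambda>(q, c). err q om c) \<le> 2 * (\<epsilon>0 + \<epsilon>1 / \<eta>) + 2 * C + \<eta> + B" .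
  next
    have "\<bar>expect \<Lambda> (\<lambda>(q, c). err q om c)\<bar> \<le> 1" for om
    proof -
      have "expect \<Lambda> (\<lambda>(q, c). err q om c) \<ge> 0"
        using err01 by (intro integral_nonneg_AE) auto
      moreover have "expect \<Lambda> (\<lambda>(q, c). err q om c) \<le> expect \<Lambda> (\<lambda>_. 1)"
        using err01 finL by (intro integral_mono integrable_measure_pmf_finite) auto
      ultimately show ?thesis by simp
    qed
    then show "integrable \<mu> (\<lambda>om. expect \<Lambda> (\<lambda>(q, c). err q om c))"
      by (intro measure_pmf.integrable_const_bound[where B = 1]) auto
  qed simp
  finally have "expect \<Lambda> (\<lambda>(q, c). expect \<mu> (\<lambda>om. err q om c))
     \<le> 2 * (\<epsilon>0 + \<epsilon>1 / \<eta>) + 2 * C + \<eta> + B"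
    by simp
  then obtain qc where qc: "qc \<in> set_pmf \<Lambda>" "(case qc of (q, c) \<Rightarrow> expect \<mu> (\<lambda>om. err q om c))
     \<le> 2 * (\<epsilon>0 + \<epsilon>1 / \<eta>) + 2 * C + \<eta> + B"
    using integrable_measure_pmf_finite[OF finL] by (rule expectation_le_obtains)
  obtain q c where qc': "qc = (q, c)" by (cases qc)
  have q: "q \<in> qf ` set_pmf J" and c: "c \<in> set_pmf (CB q)"
    using qc(1) by (auto simp: qc' \<Lambda>_def)
  have cx: "fst (c k l) \<in> xf k ` set_pmf J" if k: "k \<in> V" "l \<in> L k" for k l
  proof -
    have "c k l \<in> set_pmf (bind_pmf (px q k) (\<lambda>a. map_pmf (Pair a) (Pi_pmf (L k) undefined (\<lambda>_. pu q k a))))"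
      using c k V L by (fastforce simp: CB_def codebook_law_def set_Pi_pmf PiE_dflt_def)
    then have "fst (c k l) \<in> set_pmf (px q k)" by auto
    then show ?thesis using q setJq by (auto simp: px_def)
  qed
  have "expect \<mu> (\<lambda>om. err' q om c) \<le> expect \<mu> (\<lambda>om. err q om c)"
    using err' err01 by (intro integral_mono measure_pmf.integrable_const_bound[where B = 1]) (auto simp: err'_def)
  also have "\<dots> \<le> 2 * (\<epsilon>0 + \<epsilon>1 / \<eta>) + 2 * C + \<eta> + B"
    using qc(2) by (simp add: qc')
  finally have fin: "expect \<mu> (\<lambda>om. err' q om c) \<le> 2 * (\<epsilon>0 + \<epsilon>1 / \<eta>) + 2 * C + \<eta> + B" .
  show ?thesis
  proof (intro exI conjI)
    show "expect \<mu> (\<lambda>om. prob (Wc q (\<lambda>k\<in>V. fst (c k (S q om c k))) (es q (selected V c (tgt om) (S q om c))))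
       {y. \<exists>k\<in>V. \<exists>i\<in>L k. test k q (fst (c k (S q om c k))) (snd (c k (S q om c k)) i) y \<noteq> (i = tgt om k)})
     \<le> 2 * (\<epsilon>0 + \<epsilon>1 / \<eta>) + 2 * (\<Sum>T\<in>Pow V - {{}}. \<theta> T / (\<Prod>k\<in>T. real (M k))) + \<eta>
        + (\<Sum>k\<in>V. real (card (L k)) * \<beta> k)"
      using fin unfolding err'_def C_def B_def .
  qed (use q cx es S in auto)
qed

section \<open>Blocks of i.i.d. letters\<close>

text \<open>Exponential decay rather than mere convergence to 0, because the errors of a number of
  stages polynomial in the block length are added. It is an upper bound only: f may be
  negative.\<close>

definition expsmall :: "(nat \<Rightarrow> real) \<Rightarrow> bool" where
  "expsmall f \<longleftrightarrow> (\<exists>C c. c > 0 \<and> (\<forall>n. f n \<le> C * exp (- c * real n)))"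

lemma expsmallI: "c > 0 \<Longrightarrow> (\<And>n. f n \<le> C * exp (- c * real n)) \<Longrightarrow> expsmall f"
  by (auto simp: expsmall_def)

lemma expsmall_add:
  assumes "expsmall f" "expsmall g"
  shows "expsmall (\<lambda>n. f n + g n)"
proof -
  obtain C c C' c' where c: "c > 0" "\<And>n. f n \<le> C * exp (- c * real n)"
      "c' > 0" "\<And>n. g n \<le> C' * exp (- c' * real n)"
    using assms unfolding expsmall_def by metis
  show ?thesis
  proof (rule expsmallI)
    show "min c c' > 0" using c by simp
    fix n
    have "f n \<le> \<bar>C\<bar> * exp (- min c c' * real n)"
      by (rule order_trans[OF c(2)], rule mult_mono) (auto simp: mult_right_mono)
    moreover have "g n \<le> \<bar>C'\<bar> * exp (- min c c' * real n)"
      by (rule order_trans[OF c(4)], rule mult_mono) (auto simp: mult_right_mono)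
    ultimately show "f n + g n \<le> (\<bar>C\<bar> + \<bar>C'\<bar>) * exp (- min c c' * real n)"
      by (simp add: algebra_simps)
  qed
qed

lemma expsmall_cmult:
  assumes "expsmall f" "a \<ge> 0"
  shows "expsmall (\<lambda>n. a * f n)"
proof -
  obtain C c where c: "c > 0" "\<And>n. f n \<le> C * exp (- c * real n)"
    using assms unfolding expsmall_def by metis
  show ?thesis
    by (rule expsmallI[of c _ "a * C"]) (use c assms in \<open>auto simp: mult.assoc intro: mult_left_mono\<close>)
qed

lemma expsmall_0: "expsmall (\<lambda>n. 0)"
  by (rule expsmallI[of 1 _ 0]) auto

lemma expsmall_sum:
  assumes "finite A" "\<And>a. a \<in> A \<Longrightarrow> expsmall (f a)"
  shows "expsmall (\<lambda>n. \<Sum>a\<in>A. f a n)"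
  using assms by (induction A rule: finite_induct) (auto simp: expsmall_0 intro: expsmall_add)

lemma expsmall_exp: "c > 0 \<Longrightarrow> expsmall (\<lambda>n. exp (- c * real n))"
  by (rule expsmallI[of c _ 1]) auto

lemma expsmall_powr:
  assumes "c > 0"
  shows "expsmall (\<lambda>n. 2 powr (- c * real n))"
  by (rule expsmallI[of "c * ln 2" _ 1]) (use assms in \<open>auto simp: powr_def mult_ac\<close>)

section \<open>Words with i.i.d. letters and their concentration\<close>

abbreviation iid_word :: "nat \<Rightarrow> 'a pmf \<Rightarrow> (nat \<Rightarrow> 'a) pmf" where
  "iid_word n p \<equiv> Pi_pmf {..<n} undefined (\<lambda>_. p)"

lemma prob_Pi_pmf_ball:
  fixes A :: "nat set"
  assumes "finite A"
  shows "prob (Pi_pmf A d p) {w. \<forall>t\<in>A. w t \<in> B t} = (\<Prod>t\<in>A. prob (p t) (B t))"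
proof -
  have "{w. \<forall>t\<in>A. w t \<in> B t} = Pi A B" by auto
  then show ?thesis using measure_Pi_pmf_Pi[OF assms] by simp
qed

lemma indep_vars_Pi_pmf_compose:
  assumes "finite I"
  shows "prob_space.indep_vars (measure_pmf (Pi_pmf I d p)) (\<lambda>_. borel) (\<lambda>i w. (g i (w i) :: real)) I"
  using prob_space.indep_vars_compose2[OF measure_pmf.prob_space_axioms indep_vars_Pi_pmf[OF assms],
    of g "\<lambda>_. borel" d p] by simp

lemma Hoeffding_iid_word:
  fixes g :: "'a \<Rightarrow> real"
  assumes fin: "finite (set_pmf P)" and \<delta>: "\<delta> > 0"
  shows "\<exists>c>0. \<forall>n. prob (iid_word n P)
     {w. (\<Sum>t<n. g (w t)) \<ge> real n * (expect P g + \<delta>)} \<le> exp (- c * real n)"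
proof -
  \<comment> \<open>Adding 1 keeps \<open>b\<close> positive even if \<open>g\<close> vanishes on
    the support.\<close>
  define b where "b = Max ((\<lambda>x. \<bar>g x\<bar>) ` set_pmf P) + 1"
  have gb: "\<bar>g x\<bar> \<le> b" if "x \<in> set_pmf P" for x
    using that fin by (auto simp: b_def intro!: add_increasing2 Max_ge)
  have b: "b > 0"
  proof -
    obtain x where "x \<in> set_pmf P" using set_pmf_not_empty[of P] by blast
    then have "\<bar>g x\<bar> \<le> Max ((\<lambda>x. \<bar>g x\<bar>) ` set_pmf P)" using fin by (intro Max_ge) auto
    then show ?thesis unfolding b_def using abs_ge_zero[of "g x"] by linarith
  qed
  define c where "c = 2 * \<delta>\<^sup>2 / (2 * b)\<^sup>2"
  have c: "c > 0" using b \<delta> by (auto simp: c_def)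
  show ?thesis
  proof (intro exI[of _ c] conjI c allI)
    fix n :: nat
    show "prob (iid_word n P)
     {w. (\<Sum>t<n. g (w t)) \<ge> real n * (expect P g + \<delta>)} \<le> exp (- c * real n)"
    proof (cases "n = 0")
      case False
      interpret H: Hoeffding_ineq "measure_pmf (iid_word n P)" "{..<n}" "\<lambda>t w. g (w t)" "\<lambda>_. - b" "\<lambda>_. b"
          "\<Sum>t<n. expect (iid_word n P) (\<lambda>w. g (w t))"
      proof unfold_locales
        show "prob_space.indep_vars (measure_pmf (iid_word n P)) (\<lambda>_. borel) (\<lambda>t w. g (w t)) {..<n}"
          by (rule indep_vars_Pi_pmf_compose) simp
        fix t assume t: "t \<in> {..<n}"
        show "AE w in measure_pmf (iid_word n P). g (w t) \<in> {- b..b}"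
        proof (rule AE_pmfI)
          fix w assume "w \<in> set_pmf (iid_word n P)"
          then have "w t \<in> set_pmf P" using t by (auto simp: set_Pi_pmf PiE_dflt_def)
          then show "g (w t) \<in> {- b..b}" using gb[of "w t"] by (auto simp: abs_le_iff)
        qed
      qed auto
      have E: "(\<Sum>t<n. expect (iid_word n P) (\<lambda>w. g (w t))) = real n * expect P g"
      proof -
        have "expect (iid_word n P) (\<lambda>w. g (w t)) = expect P g" if "t < n" for t
        proof -
          have "expect (map_pmf (\<lambda>w. w t) (iid_word n P)) g = expect P g"
            using that by (subst Pi_pmf_component) auto
          then show ?thesis by simp
        qed
        then show ?thesis by simp
      qed
      have "prob (iid_word n P) {w. (\<Sum>t<n. g (w t)) \<ge> real n * (expect P g + \<delta>)}
          \<le> exp (- 2 * (real n * \<delta>)\<^sup>2 / (\<Sum>t<n. (b - (- b))\<^sup>2))"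
        using H.Hoeffding_ineq_ge[of "real n * \<delta>"] False b \<delta> unfolding E
        by (simp add: algebra_simps)
      also have "- 2 * (real n * \<delta>)\<^sup>2 / (\<Sum>t<n. (b - (- b))\<^sup>2) = - c * real n"
        using False b by (simp add: c_def field_simps power2_eq_square)
      finally show ?thesis .
    qed (auto intro: order_trans[OF measure_pmf.prob_le_1])
  qed
qed

lemma measure_cond_pmf:
  assumes "set_pmf p \<inter> s \<noteq> {}"
  shows "prob (cond_pmf p s) S = prob p (s \<inter> S) / prob p s"
  using measure_measure_pmf_not_zero[OF assms] emeasure_measure_pmf_not_zero[OF assms]
  unfolding cond_pmf.rep_eq[OF assms]
  by (subst measure_uniform_measure) auto

text \<open>Turns an input word followed by its memoryless channel output into one word of
  independent pairs, to which Hoeffding's inequality can be applied.\<close>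

lemma Pi_pmf_bind_pair:
  assumes "finite A"
  shows "Pi_pmf A undefined (\<lambda>t. bind_pmf (p t) (\<lambda>l. map_pmf (Pair l) (K l)))
    = bind_pmf (Pi_pmf A undefined p) (\<lambda>w. map_pmf (\<lambda>y. \<lambda>t. if t \<in> A then (w t, y t) else undefined)
        (Pi_pmf A undefined (\<lambda>t. K (w t))))"
proof -
  have *: "Pi_pmf A undefined (\<lambda>t. bind_pmf (K (w t)) (\<lambda>y. return_pmf (w t, y)))
     = map_pmf (\<lambda>y. \<lambda>t. if t \<in> A then (w t, y t) else undefined) (Pi_pmf A undefined (\<lambda>t. K (w t)))" for w
    unfolding map_pmf_def using assms
    by (subst Pi_pmf_bind[where d' = undefined]) auto
  show ?thesis
    using assms unfolding map_pmf_def[of "Pair x" for x]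
    by (subst Pi_pmf_bind[where d' = undefined]) (auto simp: *)
qed

text \<open>V is the set of nodes that decode. The input of any other relay is a function of the time-sharing
  variable, so that it can follow the protocol without any knowledge.\<close>

locale relay_letters =
  fixes N :: nat and X :: "nat \<Rightarrow> 'x set" and W :: "(nat \<Rightarrow> 'x) \<Rightarrow> (nat \<Rightarrow> 'y) pmf" and V :: "nat set"
    and P :: "'l pmf" and qs :: "'l \<Rightarrow> 'q" and xs :: "nat \<Rightarrow> 'l \<Rightarrow> 'x" and us :: "nat \<Rightarrow> 'l \<Rightarrow> 'u"
    and \<xi> :: "nat \<Rightarrow> 'q \<Rightarrow> 'x"
  assumes N: "1 \<le> N" and V: "V \<subseteq> {2..N}" and finP: "finite (set_pmf P)"
    and finW: "\<And>x. x \<in> PiE {1..N} X \<Longrightarrow> finite (set_pmf (W x))"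
    and xs: "\<And>k l. k \<in> {1..N} \<Longrightarrow> l \<in> set_pmf P \<Longrightarrow> xs k l \<in> X k"
    and \<xi>: "\<And>k l. k \<in> {2..N} - V \<Longrightarrow> l \<in> set_pmf P \<Longrightarrow> xs k l = \<xi> k (qs l)"
begin

definition inp :: "'l \<Rightarrow> nat \<Rightarrow> 'x" where "inp l = (\<lambda>k\<in>{1..N}. xs k l)"

definition LL :: "('l \<times> (nat \<Rightarrow> 'y)) pmf" where
  "LL = bind_pmf P (\<lambda>l. map_pmf (Pair l) (W (inp l)))"

definition pQ where "pQ = pmf (map_pmf qs P)"
definition pV where "pV k = pmf (map_pmf (\<lambda>l. (qs l, xs k l, us k l)) P)"
definition pT where "pT T = pmf (map_pmf (\<lambda>l. (qs l, \<lambda>k\<in>T. (xs k l, us k l))) P)"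
definition pX where "pX k = pmf (map_pmf (\<lambda>l. (qs l, xs k l)) P)"
definition pXY where "pXY k = pmf (map_pmf (\<lambda>(l, y). (qs l, xs k l, y k)) LL)"
definition pVY where "pVY k = pmf (map_pmf (\<lambda>(l, y). (qs l, xs k l, us k l, y k)) LL)"

text \<open>Conditional information density: the log of the joint density of the pairs (X_k, U_k), k
  in T, given Q, relative to the product of their conditional densities.\<close>

definition dT :: "nat set \<Rightarrow> 'l \<Rightarrow> real" where
  "dT T l = log 2 ((pT T (qs l, \<lambda>k\<in>T. (xs k l, us k l)) / pQ (qs l))
     / (\<Prod>k\<in>T. pV k (qs l, xs k l, us k l) / pQ (qs l)))"

text \<open>The likelihood ratio p(u | x, y, q) / p(u | x, q), whose logarithm is the information
  density of I(U_k; Y_k | X_k, Q). Division by zero makes it 0 off the support.\<close>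

definition \<rho> :: "nat \<Rightarrow> 'q \<Rightarrow> 'x \<Rightarrow> 'u \<Rightarrow> 'y \<Rightarrow> real" where
  "\<rho> k q a b y = pVY k (q, a, b, y) * pX k (q, a) / (pV k (q, a, b) * pXY k (q, a, y))"

text \<open>Total correlation of the pairs (X_k, U_k), k in T, conditional on Q.\<close>

definition tcorr :: "nat set \<Rightarrow> real" where "tcorr T = expect P (dT T)"

text \<open>The mutual information I(U_k; Y_k | X_k, Q) in bits.\<close>

definition minfo :: "nat \<Rightarrow> real" where
  "minfo k = expect LL (\<lambda>(l, y). log 2 (\<rho> k (qs l) (xs k l) (us k l) (y k)))"

lemma finV: "finite V"
  using V finite_subset by blast

lemma inp: "l \<in> set_pmf P \<Longrightarrow> inp l \<in> PiE {1..N} X"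
  by (auto simp: inp_def xs)

lemma finLL: "finite (set_pmf LL)"
  using finP finW inp by (auto simp: LL_def)

lemma map_fst_LL: "map_pmf fst LL = P"
  by (simp add: LL_def map_bind_pmf pmf.map_comp o_def map_pmf_const bind_return_pmf')

lemma letter_dens:
  assumes "l \<in> set_pmf P"
  shows "pT T (qs l, \<lambda>k\<in>T. (xs k l, us k l)) / pQ (qs l)
    = 2 powr dT T l * (\<Prod>k\<in>T. pV k (qs l, xs k l, us k l) / pQ (qs l))"
proof -
  have p: "pT T (qs l, \<lambda>k\<in>T. (xs k l, us k l)) > 0" "pQ (qs l) > 0" "pV k (qs l, xs k l, us k l) > 0" for k
    using pmf_map_pos[OF assms, of "\<lambda>l. (qs l, \<lambda>k\<in>T. (xs k l, us k l))"]
      pmf_map_pos[OF assms, of qs] pmf_map_pos[OF assms, of "\<lambda>l. (qs l, xs k l, us k l)"]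
    by (auto simp: pT_def pQ_def pV_def)
  define r where "r = (\<Prod>k\<in>T. pV k (qs l, xs k l, us k l) / pQ (qs l))"
  have "r > 0"
    unfolding r_def using p by (intro prod_pos) auto
  then show ?thesis
    unfolding dT_def r_def[symmetric] using p by (subst powr_log_cancel) auto
qed

definition qw where "qw n w = (\<lambda>t\<in>{..<n}. qs (w t))"
definition xw where "xw n k w = (\<lambda>t\<in>{..<n}. xs k (w t))"
definition uw where "uw n k w = (\<lambda>t\<in>{..<n}. us k (w t))"

lemma word_eq_iff: "(\<lambda>t\<in>{..<n::nat}. f (w t)) = (\<lambda>t\<in>{..<n}. f (w' t)) \<longleftrightarrow> (\<forall>t<n. f (w t) = f (w' t))"
  by (auto simp: fun_eq_iff restrict_def)

lemma prob_word_eq: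
  "prob (iid_word n R) {w'. \<forall>t<n. f (w' t) = f (w t)} = (\<Prod>t<n. pmf (map_pmf f R) (f (w t)))"
  using prob_Pi_pmf_ball[of "{..<n}" undefined "\<lambda>_. R" "\<lambda>t. {l. f l = f (w t)}"]
  by (simp add: pmf_map vimage_def lessThan_def)

lemma word_in_support: "w \<in> set_pmf (iid_word n R) \<Longrightarrow> t < n \<Longrightarrow> w t \<in> set_pmf R"
  by (auto simp: set_Pi_pmf PiE_dflt_def)

text \<open>Conditioned on the time-sharing word, all densities are products over the letters, so
  the density of a tuple of words relative to its marginals is exactly 2 to the sum of the letter
  densities. This identity takes the place of joint typicality in the covering.\<close>

lemma dens_iid_word:
  assumes w: "w \<in> set_pmf (iid_word n P)" and T: "finite T"
  defines "Jq \<equiv> cond_pmf (iid_word n P) {w'. qw n w' = qw n w}"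
  shows "prob Jq {w'. \<forall>k\<in>T. xw n k w' = xw n k w \<and> uw n k w' = uw n k w}
     = 2 powr (\<Sum>t<n. dT T (w t)) * (\<Prod>k\<in>T. prob Jq {w'. xw n k w' = xw n k w \<and> uw n k w' = uw n k w})"
proof -
  have ne: "set_pmf (iid_word n P) \<inter> {w'. qw n w' = qw n w} \<noteq> {}" using w by auto
  have q: "prob (iid_word n P) {w'. qw n w' = qw n w} = (\<Prod>t<n. pQ (qs (w t)))"
    unfolding qw_def word_eq_iff pQ_def by (rule prob_word_eq)
  have T1: "prob Jq {w'. \<forall>k\<in>T. xw n k w' = xw n k w \<and> uw n k w' = uw n k w}
     = (\<Prod>t<n. pT T (qs (w t), \<lambda>k\<in>T. (xs k (w t), us k (w t))) / pQ (qs (w t)))"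
  proof -
    have "{w'. qw n w' = qw n w} \<inter> {w'. \<forall>k\<in>T. xw n k w' = xw n k w \<and> uw n k w' = uw n k w}
      = {w'. \<forall>t<n. (\<lambda>l. (qs l, \<lambda>k\<in>T. (xs k l, us k l))) (w' t) = (\<lambda>l. (qs l, \<lambda>k\<in>T. (xs k l, us k l))) (w t)}"
      unfolding qw_def xw_def uw_def word_eq_iff by (auto simp: fun_eq_iff restrict_def split: if_splits)
    then show ?thesis
      unfolding Jq_def measure_cond_pmf[OF ne] q
      using prob_word_eq[of n P "\<lambda>l. (qs l, \<lambda>k\<in>T. (xs k l, us k l))" w] by (simp add: pT_def prod_dividef)
  qed
  have V1: "prob Jq {w'. xw n k w' = xw n k w \<and> uw n k w' = uw n k w}
     = (\<Prod>t<n. pV k (qs (w t), xs k (w t), us k (w t)) / pQ (qs (w t)))" for k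
  proof -
    have "{w'. qw n w' = qw n w} \<inter> {w'. xw n k w' = xw n k w \<and> uw n k w' = uw n k w}
      = {w'. \<forall>t<n. (\<lambda>l. (qs l, xs k l, us k l)) (w' t) = (\<lambda>l. (qs l, xs k l, us k l)) (w t)}"
      unfolding qw_def xw_def uw_def word_eq_iff by (auto simp: fun_eq_iff restrict_def split: if_splits)
    then show ?thesis
      unfolding Jq_def measure_cond_pmf[OF ne] q
      using prob_word_eq[of n P "\<lambda>l. (qs l, xs k l, us k l)" w] by (simp add: pV_def prod_dividef)
  qed
  have "(\<Prod>t<n. pT T (qs (w t), \<lambda>k\<in>T. (xs k (w t), us k (w t))) / pQ (qs (w t)))
    = (\<Prod>t<n. 2 powr dT T (w t) * (\<Prod>k\<in>T. pV k (qs (w t), xs k (w t), us k (w t)) / pQ (qs (w t))))"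
    using word_in_support[OF w] by (intro prod.cong refl letter_dens) auto
  also have "\<dots> = 2 powr (\<Sum>t<n. dT T (w t))
      * (\<Prod>k\<in>T. \<Prod>t<n. pV k (qs (w t), xs k (w t), us k (w t)) / pQ (qs (w t)))"
    by (subst prod.distrib, subst prod.swap) (simp add: powr_sum)
  finally show ?thesis
    unfolding T1 V1 .
qed

section \<open>The likelihood ratio test and its false alarms\<close>

definition test :: "nat \<Rightarrow> real \<Rightarrow> nat \<Rightarrow> (nat \<Rightarrow> 'q) \<Rightarrow> (nat \<Rightarrow> 'x) \<Rightarrow> (nat \<Rightarrow> 'u) \<Rightarrow> (nat \<Rightarrow> 'y) \<Rightarrow> bool" where
  "test n \<tau> k q a b y \<longleftrightarrow> (\<Prod>t<n. \<rho> k (q t) (a t) (b t) (y t)) > 2 powr \<tau>"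

lemma \<rho>_nonneg: "\<rho> k q a b y \<ge> 0"
  by (auto simp: \<rho>_def pVY_def pX_def pV_def pXY_def)

text \<open>For fixed y, averaging the ratio over u given (q, x) cancels \<open>pV\<close>, and the
  remaining sum of p(q, x, u, y) over u is at most p(q, x, y). Outputs y with p(q, x, y) = 0 have
  ratio 0, hence the inequality.\<close>

lemma letter_false_alarm:
  "expect P (\<lambda>l. indicator {l. qs l = q \<and> xs k l = a} l * \<rho> k q a (us k l) y) \<le> pX k (q, a)"
proof -
  let ?M = "map_pmf (\<lambda>l. (qs l, xs k l, us k l)) P"
  define B where "B = us k ` set_pmf P"
  have B: "finite B" using finP by (simp add: B_def)
  have "expect P (\<lambda>l. indicator {l. qs l = q \<and> xs k l = a} l * \<rho> k q a (us k l) y)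
    = expect ?M (\<lambda>(q', a', b). if q' = q \<and> a' = a then \<rho> k q a b y else 0)"
    by (auto intro!: integral_cong_AE simp: indicator_def)
  also have "\<dots> = (\<Sum>v\<in>(\<lambda>b. (q, a, b)) ` B. pmf ?M v * (case v of (q', a', b) \<Rightarrow> if q' = q \<and> a' = a then \<rho> k q a b y else 0))"
    by (subst integral_measure_pmf[where A = "(\<lambda>b. (q, a, b)) ` B"])
       (auto simp: B_def finP split: if_splits)
  also have "\<dots> = (\<Sum>b\<in>B. pV k (q, a, b) * \<rho> k q a b y)"
    by (subst sum.reindex) (auto simp: inj_on_def pV_def)
  also have "\<dots> \<le> (\<Sum>b\<in>B. pVY k (q, a, b, y) * (pX k (q, a) / pXY k (q, a, y)))"
    by (intro sum_mono) (auto simp: \<rho>_def pVY_def pX_def pV_def pXY_def)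
  also have "\<dots> = (\<Sum>b\<in>B. pVY k (q, a, b, y)) * (pX k (q, a) / pXY k (q, a, y))"
    by (rule sum_distrib_right[symmetric])
  also have "\<dots> \<le> pXY k (q, a, y) * (pX k (q, a) / pXY k (q, a, y))"
  proof (rule mult_right_mono)
    have "(\<Sum>b\<in>B. pVY k (q, a, b, y))
       = prob (map_pmf (\<lambda>(l, y). (qs l, xs k l, us k l, y k)) LL) ((\<lambda>b. (q, a, b, y)) ` B)"
      using B by (subst measure_measure_pmf_finite) (auto simp: sum.reindex inj_on_def pVY_def)
    also have "\<dots> \<le> prob (map_pmf (\<lambda>(l, y). (qs l, xs k l, y k)) LL) {(q, a, y)}"
      by (auto intro!: measure_pmf.finite_measure_mono)
    finally show "(\<Sum>b\<in>B. pVY k (q, a, b, y)) \<le> pXY k (q, a, y)"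
      by (simp add: pXY_def measure_pmf_single del: measure_map_pmf)
    show "0 \<le> pX k (q, a) / pXY k (q, a, y)" by (simp add: pX_def pXY_def)
  qed
  also have "\<dots> \<le> pX k (q, a)"
    by (auto simp: pX_def pXY_def)
  finally show ?thesis .
qed

text \<open>Markov's inequality for the product of the letter ratios: given the words q and x, its
  mean is at most 1 for every output word y. The double conditioning is the form in which
  \<open>one_shot_block\<close> draws a satellite.\<close>

lemma word_false_alarm:
  assumes w: "w \<in> set_pmf (iid_word n P)"
  shows "prob (cond_pmf (cond_pmf (iid_word n P) {w'. qw n w' = qw n w}) {w'. xw n k w' = xw n k w})
     {w'. test n \<tau> k (qw n w) (xw n k w) (uw n k w') y} \<le> 2 powr (- \<tau>)"
proof -
  let ?J = "iid_word n P"
  let ?E = "{w'. \<forall>t<n. (\<lambda>l. (qs l, xs k l)) (w' t) = (\<lambda>l. (qs l, xs k l)) (w t)}"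
  let ?S = "{w'. test n \<tau> k (qw n w) (xw n k w) (uw n k w') y}"
  define R where "R = (\<Prod>t<n. pX k (qs (w t), xs k (w t)))"
  have R: "R > 0"
    using word_in_support[OF w] pmf_map_pos[of _ P "\<lambda>l. (qs l, xs k l)"]
    unfolding R_def pX_def by (intro prod_pos) auto
  have ne: "set_pmf ?J \<inter> {w'. qw n w' = qw n w} \<noteq> {}" using w by auto
  have ne': "set_pmf (cond_pmf ?J {w'. qw n w' = qw n w}) \<inter> {w'. xw n k w' = xw n k w} \<noteq> {}"
    using w by (auto simp: set_cond_pmf[OF ne])
  have E: "{w'. qw n w' = qw n w} \<inter> {w'. xw n k w' = xw n k w} = ?E"
    unfolding qw_def xw_def word_eq_iff by auto
  have pE: "prob ?J ?E = R"
    using prob_word_eq[of n P "\<lambda>l. (qs l, xs k l)" w] by (simp add: R_def pX_def)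
  have pq: "prob ?J {w'. qw n w' = qw n w} > 0"
    using w by (intro measure_pmf_posI) auto
  have "prob (cond_pmf (cond_pmf ?J {w'. qw n w' = qw n w}) {w'. xw n k w' = xw n k w}) ?S
     = prob ?J (?E \<inter> ?S) / R"
    unfolding measure_cond_pmf[OF ne'] measure_cond_pmf[OF ne] Int_assoc[symmetric] E pE
    using pq by simp
  also have "\<dots> \<le> 2 powr (- \<tau>)"
  proof -
    \<comment> \<open>The indicator absorbs the conditioning event, so that the integrand is a
      product over the letters and its expectation factors.\<close>
    define h where "h = (\<lambda>t l. indicator {l. qs l = qs (w t) \<and> xs k l = xs k (w t)} l * \<rho> k (qs (w t)) (xs k (w t)) (us k l) (y t))"
    have h0: "h t l \<ge> 0" for t l using \<rho>_nonneg by (auto simp: h_def)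
    have finJ: "finite (set_pmf ?J)" using finP by (intro finite_set_Pi_pmf) auto
    have "2 powr \<tau> * prob ?J (?E \<inter> ?S) = expect ?J (\<lambda>w'. 2 powr \<tau> * indicator (?E \<inter> ?S) w')"
      by simp
    also have "\<dots> \<le> expect ?J (\<lambda>w'. \<Prod>t<n. h t (w' t))"
    proof (intro integral_mono integrable_measure_pmf_finite finJ)
      fix w'
      show "2 powr \<tau> * indicator (?E \<inter> ?S) w' \<le> (\<Prod>t<n. h t (w' t))"
      proof (cases "w' \<in> ?E \<inter> ?S")
        case True
        have "(\<Prod>t<n. h t (w' t)) = (\<Prod>t<n. \<rho> k (qw n w t) (xw n k w t) (uw n k w' t) (y t))"
          using True by (intro prod.cong) (auto simp: h_def qw_def xw_def uw_def)
        then show ?thesis using True by (simp add: test_def)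
      next
        case False
        then show ?thesis using h0 by (auto intro!: prod_nonneg)
      qed
    qed
    also have "\<dots> = (\<Prod>t<n. expect P (h t))"
      using finP h0 by (intro expectation_prod_Pi_pmf) (auto intro: integrable_measure_pmf_finite)
    also have "\<dots> \<le> R"
      unfolding R_def h_def using letter_false_alarm \<rho>_nonneg
      by (intro prod_mono conjI integral_nonneg_AE) auto
    finally have "2 powr \<tau> * prob ?J (?E \<inter> ?S) \<le> R" .
    then show ?thesis using R by (simp add: powr_minus field_simps)
  qed
  finally show ?thesis .
qed

end

section \<open>Exponential tails and codes for one block\<close>

context relay_letters begin

definition code_in :: "nat \<Rightarrow> (nat \<Rightarrow> 'q) \<Rightarrow> (nat \<Rightarrow> nat \<Rightarrow> 'x) \<Rightarrow> (nat \<Rightarrow> 'x) \<Rightarrow> (nat \<Rightarrow> nat \<Rightarrow> 'y) pmf" where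
  "code_in n q x e = Pi_pmf {..<n} undefined
     (\<lambda>t. W (\<lambda>k\<in>{1..N}. if k = 1 then e t else if k \<in> V then x k t else \<xi> k (q t)))"

text \<open>By the locale assumption on \<open>\<xi>\<close>, the inputs rebuilt from the separate
  components agree with \<open>inp\<close> also at relays outside \<open>V\<close>.\<close>

lemma code_in_iid_word:
  assumes "w \<in> set_pmf (iid_word n P)"
  shows "code_in n (qw n w) (\<lambda>k\<in>V. xw n k w) (\<lambda>t\<in>{..<n}. xs 1 (w t)) = Pi_pmf {..<n} undefined (\<lambda>t. W (inp (w t)))"
  unfolding code_in_def
proof (intro Pi_pmf_cong refl arg_cong[where f = W])
  fix t assume t: "t \<in> {..<n}"
  then have "w t \<in> set_pmf P" using word_in_support[OF assms] by simp
  then show "(\<lambda>k\<in>{1..N}. if k = 1 then (\<lambda>t\<in>{..<n}. xs 1 (w t)) t else if k \<in> V then (\<lambda>k\<in>V. xw n k w) k t else \<xi> k (qw n w t))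
    = inp (w t)"
    using t \<xi> by (auto simp: inp_def xw_def qw_def fun_eq_iff restrict_def)
qed

definition dense where
  "dense n \<theta> w \<longleftrightarrow> (\<forall>T\<subseteq>V. T \<noteq> {} \<longrightarrow>
      prob (cond_pmf (iid_word n P) {w'. qw n w' = qw n w}) {w'. \<forall>k\<in>T. xw n k w' = xw n k w \<and> uw n k w' = uw n k w}
      \<le> \<theta> T * (\<Prod>k\<in>T. prob (cond_pmf (iid_word n P) {w'. qw n w' = qw n w})
          {w'. xw n k w' = xw n k w \<and> uw n k w' = uw n k w}))"

definition word_law where
  "word_law n = bind_pmf (iid_word n P)
     (\<lambda>w. map_pmf (Pair w) (code_in n (qw n w) (\<lambda>k\<in>V. xw n k w) (\<lambda>t\<in>{..<n}. xs 1 (w t))))"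

definition missed where
  "missed n \<tau> = {(w, y). \<exists>k\<in>V. \<not> test n (\<tau> k) k (qw n w) (xw n k w) (uw n k w) (\<lambda>t. y t k)}"

text \<open>By \<open>dens_iid_word\<close>, a violation for T means that the sum of
  \<open>dT T\<close> is above its mean by at least \<open>n * \<delta> T\<close>. Hoeffding's
  inequality bounds this, and there are finitely many T.\<close>

lemma cover_tail:
  assumes \<delta>: "\<And>T. T \<in> Pow V - {{}} \<Longrightarrow> \<delta> T > 0"
  shows "\<exists>f. expsmall f \<and> (\<forall>n. prob (iid_word n P)
    {w. \<not> dense n (\<lambda>T. 2 powr (real n * (tcorr T + \<delta> T))) w} \<le> f n)"
proof -
  have "\<forall>T\<in>Pow V - {{}}. \<exists>c>0. \<forall>n. prob (iid_word n P)
     {w. (\<Sum>t<n. dT T (w t)) \<ge> real n * (tcorr T + \<delta> T)} \<le> exp (- c * real n)"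
    unfolding tcorr_def using Hoeffding_iid_word[OF finP \<delta>] by blast
  then obtain c where c: "\<And>T. T \<in> Pow V - {{}} \<Longrightarrow> c T > 0"
    "\<And>T n. T \<in> Pow V - {{}} \<Longrightarrow> prob (iid_word n P)
     {w. (\<Sum>t<n. dT T (w t)) \<ge> real n * (tcorr T + \<delta> T)} \<le> exp (- c T * real n)"
    by metis
  show ?thesis
  proof (intro exI conjI allI)
    show "expsmall (\<lambda>n. \<Sum>T\<in>Pow V - {{}}. exp (- c T * real n))"
      using finV c(1) by (intro expsmall_sum expsmall_exp) auto
    fix n
    let ?J = "iid_word n P"
    let ?B = "\<lambda>T. {w. (\<Sum>t<n. dT T (w t)) \<ge> real n * (tcorr T + \<delta> T)}"
    let ?dens = "dense n (\<lambda>T. 2 powr (real n * (tcorr T + \<delta> T)))"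
    have sub: "{w. \<not> ?dens w} \<inter> set_pmf ?J \<subseteq> (\<Union>T\<in>Pow V - {{}}. ?B T)"
    proof
      fix w assume w: "w \<in> {w. \<not> ?dens w} \<inter> set_pmf ?J"
      show "w \<in> (\<Union>T\<in>Pow V - {{}}. ?B T)"
      proof (rule ccontr)
        assume n: "w \<notin> (\<Union>T\<in>Pow V - {{}}. ?B T)"
        have "?dens w"
          unfolding dense_def
        proof (intro allI impI)
          fix T assume T: "T \<subseteq> V" "T \<noteq> {}"
          then have "w \<notin> ?B T" using n by blast
          then have "(\<Sum>t<n. dT T (w t)) \<le> real n * (tcorr T + \<delta> T)" by simp
          then have "2 powr (\<Sum>t<n. dT T (w t)) \<le> 2 powr (real n * (tcorr T + \<delta> T))" by simp
          moreover have "finite T" using T finV finite_subset by blast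
          ultimately show "prob (cond_pmf (iid_word n P) {w'. qw n w' = qw n w}) {w'. \<forall>k\<in>T. xw n k w' = xw n k w \<and> uw n k w' = uw n k w}
      \<le> 2 powr (real n * (tcorr T + \<delta> T)) * (\<Prod>k\<in>T. prob (cond_pmf (iid_word n P) {w'. qw n w' = qw n w})
          {w'. xw n k w' = xw n k w \<and> uw n k w' = uw n k w})"
            using w by (subst dens_iid_word) (auto intro!: mult_right_mono prod_nonneg)
        qed
        with w show False by blast
      qed
    qed
    have "prob ?J {w. \<not> ?dens w} = prob ?J ({w. \<not> ?dens w} \<inter> set_pmf ?J)"
      by (simp add: measure_Int_set_pmf)
    also have "\<dots> \<le> prob ?J (\<Union>T\<in>Pow V - {{}}. ?B T)"
      using sub by (intro measure_pmf.finite_measure_mono) auto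
    also have "\<dots> \<le> (\<Sum>T\<in>Pow V - {{}}. prob ?J (?B T))"
      using finV by (intro measure_pmf.finite_measure_subadditive_finite) auto
    also have "\<dots> \<le> (\<Sum>T\<in>Pow V - {{}}. exp (- c T * real n))"
      using c(2) by (intro sum_mono) auto
    finally show "prob ?J {w. \<not> ?dens w} \<le> (\<Sum>T\<in>Pow V - {{}}. exp (- c T * real n))" .
  qed
qed

lemma \<rho>_pos:
  assumes "(l, y) \<in> set_pmf LL"
  shows "\<rho> k (qs l) (xs k l) (us k l) (y k) > 0"
proof -
  have l: "l \<in> set_pmf P" using assms map_fst_LL by (metis fst_conv image_eqI pmf.set_map)
  show ?thesis
    using pmf_map_pos[OF assms, of "\<lambda>(l, y). (qs l, xs k l, us k l, y k)"]
      pmf_map_pos[OF assms, of "\<lambda>(l, y). (qs l, xs k l, y k)"]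
      pmf_map_pos[OF l, of "\<lambda>l. (qs l, xs k l, us k l)"]
      pmf_map_pos[OF l, of "\<lambda>l. (qs l, xs k l)"]
    by (simp add: \<rho>_def pVY_def pX_def pV_def pXY_def)
qed

text \<open>The word with its output is an i.i.d. word over \<open>LL\<close>, and minus the log of
  the tested product is a sum over letters with mean \<open>- minfo k\<close> each, so a failed test
  is a deviation by at least \<open>n * \<delta> k\<close>.\<close>

lemma miss_tail:
  assumes \<delta>: "\<And>k. k \<in> V \<Longrightarrow> \<delta> k > 0"
  shows "\<exists>f. expsmall f \<and> (\<forall>n. prob (word_law n) (missed n (\<lambda>k. real n * (minfo k - \<delta> k))) \<le> f n)"
proof -
  define g where "g = (\<lambda>k (l, y). - log 2 (\<rho> k (qs l) (xs k l) (us k l) (y k)))"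
  have Eg: "expect LL (g k) = - minfo k" for k
    by (simp add: g_def minfo_def case_prod_beta')
  have "\<forall>k\<in>V. \<exists>c>0. \<forall>n. prob (iid_word n LL)
     {z. (\<Sum>t<n. g k (z t)) \<ge> real n * (- minfo k + \<delta> k)} \<le> exp (- c * real n)"
    unfolding Eg[symmetric] using Hoeffding_iid_word[OF finLL \<delta>] by blast
  then obtain c where c: "\<And>k. k \<in> V \<Longrightarrow> c k > 0"
    "\<And>k n. k \<in> V \<Longrightarrow> prob (iid_word n LL)
     {z. (\<Sum>t<n. g k (z t)) \<ge> real n * (- minfo k + \<delta> k)} \<le> exp (- c k * real n)"
    by metis
  show ?thesis
  proof (intro exI conjI allI)
    show "expsmall (\<lambda>n. \<Sum>k\<in>V. exp (- c k * real n))"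
      using finV c(1) by (intro expsmall_sum expsmall_exp) auto
    fix n :: nat
    let ?Y = "\<lambda>w. Pi_pmf {..<n} undefined (\<lambda>t. W (inp (w t)))"
    let ?z = "\<lambda>w y t. if t \<in> {..<n} then (w t, y t) else undefined"
    let ?B = "\<lambda>k. {z. (\<Sum>t<n. g k (z t)) \<ge> real n * (- minfo k + \<delta> k)}"
    let ?M = "{z. \<exists>k\<in>V. (\<Prod>t<n. case z t of (l, y) \<Rightarrow> \<rho> k (qs l) (xs k l) (us k l) (y k)) \<le> 2 powr (real n * (minfo k - \<delta> k))}"
    let ?missed = "missed n (\<lambda>k. real n * (minfo k - \<delta> k))"
    have "prob (word_law n) ?missed
     = prob (bind_pmf (iid_word n P) (\<lambda>w. map_pmf (Pair w) (?Y w))) ?missed"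
      unfolding word_law_def
      by (intro arg_cong[where f = "\<lambda>p. prob p _"] bind_pmf_cong refl) (simp only: code_in_iid_word)
    also have "\<dots> = prob (bind_pmf (iid_word n P) (\<lambda>w. map_pmf (?z w) (?Y w))) ?M"
      unfolding measure_bind_pmf missed_def
      by (intro Bochner_Integration.integral_cong refl)
         (simp add: vimage_def test_def not_less qw_def xw_def uw_def)
    also have "bind_pmf (iid_word n P) (\<lambda>w. map_pmf (?z w) (?Y w)) = iid_word n LL"
      unfolding LL_def by (rule Pi_pmf_bind_pair[symmetric]) simp
    also have "prob (iid_word n LL) ?M = prob (iid_word n LL) (?M \<inter> set_pmf (iid_word n LL))"
      by (simp add: measure_Int_set_pmf)
    also have "\<dots> \<le> prob (iid_word n LL) (\<Union>k\<in>V. ?B k)"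
    proof (intro measure_pmf.finite_measure_mono subsetI)
      fix z assume z: "z \<in> ?M \<inter> set_pmf (iid_word n LL)"
      then obtain k where k: "k \<in> V" "(\<Prod>t<n. case z t of (l, y) \<Rightarrow> \<rho> k (qs l) (xs k l) (us k l) (y k)) \<le> 2 powr (real n * (minfo k - \<delta> k))"
        by auto
      have "(\<Prod>t<n. case z t of (l, y) \<Rightarrow> \<rho> k (qs l) (xs k l) (us k l) (y k)) = (\<Prod>t<n. 2 powr (- g k (z t)))"
      proof (intro prod.cong refl)
        fix t assume "t \<in> {..<n}"
        then have "z t \<in> set_pmf LL" using z word_in_support by blast
        then show "(case z t of (l, y) \<Rightarrow> \<rho> k (qs l) (xs k l) (us k l) (y k)) = 2 powr (- g k (z t))"
          using \<rho>_pos by (cases "z t") (simp add: g_def)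
      qed
      also have "\<dots> = 2 powr (- (\<Sum>t<n. g k (z t)))"
        by (simp add: powr_sum flip: sum_negf)
      finally have "- (\<Sum>t<n. g k (z t)) \<le> real n * (minfo k - \<delta> k)" using k(2) by simp
      then show "z \<in> (\<Union>k\<in>V. ?B k)" using k(1) by (auto simp: algebra_simps intro!: bexI[of _ k])
    qed simp
    also have "\<dots> \<le> (\<Sum>k\<in>V. prob (iid_word n LL) (?B k))"
      using finV by (intro measure_pmf.finite_measure_subadditive_finite) auto
    also have "\<dots> \<le> (\<Sum>k\<in>V. exp (- c k * real n))"
      using c(2) by (intro sum_mono) auto
    finally show "prob (word_law n) ?missed \<le> (\<Sum>k\<in>V. exp (- c k * real n))" .
  qed
qed

text \<open>An index consists of a message part and of a part that is free for the covering.\<close>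

definition idx :: "(nat \<Rightarrow> nat) \<Rightarrow> (nat \<Rightarrow> nat) \<Rightarrow> nat \<Rightarrow> (nat \<times> nat) set" where
  "idx a b k = {..<2 ^ a k} \<times> {..<2 ^ b k}"

text \<open>\<open>om\<close> stands for the message tuple. \<open>sel\<close> and \<open>e\<close>
  may depend on all of it, whereas \<open>word\<close> and \<open>dec\<close> of node k use only the
  index of node k: this is how knowledge is distributed in the network. The target is a parameter
  because it comes from the following block.\<close>

definition block_scheme ::
  "nat \<Rightarrow> (nat \<Rightarrow> nat) \<Rightarrow> 'o pmf \<Rightarrow> ('o \<Rightarrow> nat \<Rightarrow> nat \<times> nat) \<Rightarrow> ('o \<Rightarrow> nat \<Rightarrow> nat) \<Rightarrow> real \<Rightarrow> bool" where
  "block_scheme n b \<mu> tgt msg \<epsilon> \<longleftrightarrow> (\<exists>(word :: nat \<Rightarrow> nat \<times> nat \<Rightarrow> nat \<Rightarrow> 'x)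
        (dec :: nat \<Rightarrow> nat \<times> nat \<Rightarrow> (nat \<Rightarrow> 'y) \<Rightarrow> nat \<times> nat) (sel :: 'o \<Rightarrow> nat \<Rightarrow> nat \<times> nat) (e :: 'o \<Rightarrow> nat \<Rightarrow> 'x).
     (\<forall>k\<in>{2..N}. \<forall>l. \<forall>t<n. word k l t \<in> X k) \<and> (\<forall>om. \<forall>t<n. e om t \<in> X 1) \<and>
     (\<forall>om. sel om \<in> PiE V (\<lambda>k. {msg om k} \<times> {..<2 ^ b k})) \<and>
     expect \<mu> (\<lambda>om. prob (Pi_pmf {..<n} undefined
         (\<lambda>t. W (\<lambda>k\<in>{1..N}. if k = 1 then e om t else word k (sel om k) t)))
       {y. \<exists>k\<in>V. dec k (sel om k) (\<lambda>t. y t k) \<noteq> tgt om k})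
     \<le> \<epsilon>)"

lemma block_scheme_exists:
  fixes \<mu> :: "'o pmf" and tgt :: "'o \<Rightarrow> nat \<Rightarrow> nat \<times> nat" and msg :: "'o \<Rightarrow> nat \<Rightarrow> nat"
    and a b :: "nat \<Rightarrow> nat"
  assumes cov: "prob (iid_word n P)
    {w. \<not> dense n \<theta> w} \<le> \<epsilon>0"
    and miss: "prob (word_law n) (missed n \<tau>) \<le> \<epsilon>1"
    and \<theta>: "\<And>T. T \<subseteq> V \<Longrightarrow> \<theta> T \<ge> 0" and \<eta>: "\<eta> > 0"
    and tgt: "\<And>om k. k \<in> V \<Longrightarrow> tgt om k \<in> idx a b k" and msg: "\<And>om k. k \<in> V \<Longrightarrow> msg om k < 2 ^ a k"
  shows "block_scheme n b \<mu> tgt msg (2 * (\<epsilon>0 + \<epsilon>1 / \<eta>) + 2 * (\<Sum>T\<in>Pow V - {{}}. \<theta> T / (\<Prod>k\<in>T. real (2 ^ b k))) + \<eta>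
        + (\<Sum>k\<in>V. real (card (idx a b k)) * 2 powr (- \<tau> k)))"
proof -
  let ?J = "iid_word n P"
  let ?ef = "\<lambda>w. \<lambda>t\<in>{..<n}. xs 1 (w t)"
  let ?test = "\<lambda>k q a b y. test n (\<tau> k) k q a b (\<lambda>t. y t k)"
  have finJ: "finite (set_pmf ?J)" using finP by (intro finite_set_Pi_pmf) auto
  let ?Q = "\<lambda>q c sel e. q \<in> qw n ` set_pmf ?J \<and> (\<forall>k\<in>V. \<forall>l\<in>idx a b k. fst (c k l) \<in> xw n k ` set_pmf ?J) \<and>
     (\<forall>om. e om \<in> ?ef ` set_pmf ?J \<and> sel om \<in> PiE V (\<lambda>k. {msg om k} \<times> {..<2 ^ b k})) \<and>
     expect \<mu> (\<lambda>om. prob (code_in n q (\<lambda>k\<in>V. fst (c k (sel om k))) (e om))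
       {y. \<exists>k\<in>V. \<exists>i\<in>idx a b k. ?test k q (fst (c k (sel om k))) (snd (c k (sel om k)) i) y \<noteq> (i = tgt om k)})
     \<le> 2 * (\<epsilon>0 + \<epsilon>1 / \<eta>) + 2 * (\<Sum>T\<in>Pow V - {{}}. \<theta> T / (\<Prod>k\<in>T. real (2 ^ b k))) + \<eta>
        + (\<Sum>k\<in>V. real (card (idx a b k)) * 2 powr (- \<tau> k))"
  have "\<exists>q c sel e. ?Q q c sel e"
    by (rule one_shot_block[where qf = "qw n" and xf = "xw n" and uf = "uw n" and test = ?test
        and Wc = "code_in n" and ef = ?ef])
      (use finV finJ tgt msg \<theta> \<eta> cov[unfolded dense_def] miss[unfolded missed_def word_law_def] word_false_alarm in \<open>auto simp: idx_def\<close>)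
  then obtain q c sel e where ex: "?Q q c sel e"
    by (elim exE) (rule that)
  note q = ex[THEN conjunct1] and E = ex[THEN conjunct2, THEN conjunct2, THEN conjunct2]
  have c: "fst (c k l) \<in> xw n k ` set_pmf ?J" if "k \<in> V" "l \<in> idx a b k" for k l
    using ex[THEN conjunct2, THEN conjunct1] that by (elim ballE) auto
  have e: "e om \<in> ?ef ` set_pmf ?J" and sel: "sel om \<in> PiE V (\<lambda>k. {msg om k} \<times> {..<2 ^ b k})" for om
    using ex[THEN conjunct2, THEN conjunct2, THEN conjunct1, THEN spec, of om] by auto
  obtain l0 where l0: "l0 \<in> set_pmf P" using set_pmf_not_empty[of P] by blast
  \<comment> \<open>The values for indices outside \<open>idx a b k\<close> only have to lie in the
    alphabet; a relay outside \<open>V\<close> ignores its index and follows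
    \<open>q\<close>.\<close>
  define word where "word = (\<lambda>k l t. if k \<in> V then if l \<in> idx a b k then fst (c k l) t else xs k l0 else \<xi> k (q t))"
  \<comment> \<open>Outside the error event \<open>tgt om k\<close> is the only index that passes
    the test, so the choice is forced.\<close>
  define dec where "dec = (\<lambda>k l y. SOME i. i \<in> idx a b k \<and> test n (\<tau> k) k q (fst (c k l)) (snd (c k l) i) y)"
  have selidx: "sel om k \<in> idx a b k" if "k \<in> V" for om k
    using PiE_mem[OF sel that, of om] msg[OF that, of om] by (auto simp: idx_def)
  show ?thesis
    unfolding block_scheme_def
  proof (intro exI conjI ballI allI impI)
    fix k l t assume k: "k \<in> {2..N}" and t: "t < n"
    show "word k l t \<in> X k"
    proof (cases "k \<in> V")
      case True
      show ?thesis
      proof (cases "l \<in> idx a b k")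
        case l: True
        obtain w where w: "w \<in> set_pmf ?J" "fst (c k l) = xw n k w" using c[OF True l] by auto
        then show ?thesis using True l t k word_in_support[OF w(1) t] xs[of k "w t"] by (simp add: word_def xw_def)
      qed (use True k xs l0 in \<open>auto simp: word_def\<close>)
    next
      case False
      obtain w where w: "w \<in> set_pmf ?J" "q = qw n w" using q by auto
      then have "xs k (w t) = \<xi> k (q t)"
        using False t k word_in_support[OF w(1) t] \<xi> by (simp add: qw_def)
      then show ?thesis
        using False t k word_in_support[OF w(1) t] xs[of k "w t"] by (simp add: word_def)
    qed
  next
    fix om t assume t: "t < n"
    obtain w where w: "w \<in> set_pmf ?J" "e om = ?ef w" using e[of om] by auto
    show "e om t \<in> X 1" using w t word_in_support[OF w(1) t] xs N by auto
  next
    fix om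
    show "sel om \<in> PiE V (\<lambda>k. {msg om k} \<times> {..<2 ^ b k})" by (rule sel)
  next
    have "expect \<mu> (\<lambda>om. prob (Pi_pmf {..<n} undefined
         (\<lambda>t. W (\<lambda>k\<in>{1..N}. if k = 1 then e om t else word k (sel om k) t)))
       {y. \<exists>k\<in>V. dec k (sel om k) (\<lambda>t. y t k) \<noteq> tgt om k})
     \<le> expect \<mu> (\<lambda>om. prob (code_in n q (\<lambda>k\<in>V. fst (c k (sel om k))) (e om))
       {y. \<exists>k\<in>V. \<exists>i\<in>idx a b k. ?test k q (fst (c k (sel om k))) (snd (c k (sel om k)) i) y \<noteq> (i = tgt om k)})"
    proof (intro integral_mono measure_pmf.integrable_const_bound[where B = 1])
      fix om
      have W: "Pi_pmf {..<n} undefined (\<lambda>t. W (\<lambda>k\<in>{1..N}. if k = 1 then e om t else word k (sel om k) t))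
         = code_in n q (\<lambda>k\<in>V. fst (c k (sel om k))) (e om)"
        unfolding code_in_def
        by (intro Pi_pmf_cong refl arg_cong[where f = W]) (auto simp: word_def selidx fun_eq_iff restrict_def)
      show "prob (Pi_pmf {..<n} undefined
         (\<lambda>t. W (\<lambda>k\<in>{1..N}. if k = 1 then e om t else word k (sel om k) t)))
       {y. \<exists>k\<in>V. dec k (sel om k) (\<lambda>t. y t k) \<noteq> tgt om k}
       \<le> prob (code_in n q (\<lambda>k\<in>V. fst (c k (sel om k))) (e om))
       {y. \<exists>k\<in>V. \<exists>i\<in>idx a b k. ?test k q (fst (c k (sel om k))) (snd (c k (sel om k)) i) y \<noteq> (i = tgt om k)}"
        unfolding W
      proof (intro measure_pmf.finite_measure_mono subsetI CollectI)
        fix y assume "y \<in> {y. \<exists>k\<in>V. dec k (sel om k) (\<lambda>t. y t k) \<noteq> tgt om k}"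
        then obtain k where k: "k \<in> V" "dec k (sel om k) (\<lambda>t. y t k) \<noteq> tgt om k" by auto
        show "\<exists>k\<in>V. \<exists>i\<in>idx a b k. ?test k q (fst (c k (sel om k))) (snd (c k (sel om k)) i) y \<noteq> (i = tgt om k)"
        proof (rule ccontr)
          assume "\<not> ?thesis"
          then have "\<And>i. i \<in> idx a b k \<Longrightarrow> ?test k q (fst (c k (sel om k))) (snd (c k (sel om k)) i) y \<longleftrightarrow> i = tgt om k"
            using k(1) by blast
          then have "(\<lambda>i. i \<in> idx a b k \<and> ?test k q (fst (c k (sel om k))) (snd (c k (sel om k)) i) y) = (\<lambda>i. i = tgt om k)"
            using tgt[OF k(1), of om] by blast
          then have "dec k (sel om k) (\<lambda>t. y t k) = tgt om k"
            unfolding dec_def by simp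
          with k(2) show False by blast
        qed
      qed simp
    qed auto
    from this E show "expect \<mu> (\<lambda>om. prob (Pi_pmf {..<n} undefined
         (\<lambda>t. W (\<lambda>k\<in>{1..N}. if k = 1 then e om t else word k (sel om k) t)))
       {y. \<exists>k\<in>V. dec k (sel om k) (\<lambda>t. y t k) \<noteq> tgt om k}) \<le> 2 * (\<epsilon>0 + \<epsilon>1 / \<eta>) + 2 * (\<Sum>T\<in>Pow V - {{}}. \<theta> T / (\<Prod>k\<in>T. real (2 ^ b k))) + \<eta>
        + (\<Sum>k\<in>V. real (card (idx a b k)) * 2 powr (- \<tau> k))"
      by (rule order_trans)
  qed
qed

text \<open>The free bits exceed the total correlation on every T, which makes the covering failures
  rare; all bits of an index together stay below \<open>minfo k\<close>, which makes false alarms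
  rare. \<open>b\<close> rounds up for the sake of the first, \<open>a\<close> rounds down for the
  sake of the second.\<close>

lemma block_scheme_expsmall:
  fixes m r :: "nat \<Rightarrow> real"
  assumes pack: "\<And>k. k \<in> V \<Longrightarrow> m k + r k < minfo k"
    and cov: "\<And>T. T \<subseteq> V \<Longrightarrow> T \<noteq> {} \<Longrightarrow> tcorr T < (\<Sum>k\<in>T. r k)"
    and nn: "\<And>k. k \<in> V \<Longrightarrow> m k \<ge> 0" "\<And>k. k \<in> V \<Longrightarrow> r k \<ge> 0"
  defines "a \<equiv> \<lambda>n k. nat \<lfloor>real n * m k\<rfloor>" and "b \<equiv> \<lambda>n k. nat \<lceil>real n * r k\<rceil>"
  shows "\<exists>err. expsmall err \<and> (\<forall>n (\<mu> :: 'o pmf) tgt msg.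
    (\<forall>om. \<forall>k\<in>V. tgt om k \<in> idx (a n) (b n) k \<and> msg om k < 2 ^ a n k) \<longrightarrow>
    block_scheme n (b n) \<mu> tgt msg (err n))"
proof -
  \<comment> \<open>Each slack is halved: one half is the deviation in the tail bounds, the other
    remains as decay exponent.\<close>
  define \<delta>T where "\<delta>T = (\<lambda>T. ((\<Sum>k\<in>T. r k) - tcorr T) / 2)"
  define \<delta>k where "\<delta>k = (\<lambda>k. (minfo k - m k - r k) / 2)"
  have \<delta>T: "\<delta>T T > 0" if "T \<in> Pow V - {{}}" for T using cov that by (auto simp: \<delta>T_def)
  have \<delta>k: "\<delta>k k > 0" if "k \<in> V" for k using pack[OF that] by (auto simp: \<delta>k_def)
  from cover_tail[OF \<delta>T] obtain f0 where f0: "expsmall f0 \<and> (\<forall>n. prob (iid_word n P)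
    {w. \<not> dense n (\<lambda>T. 2 powr (real n * (tcorr T + \<delta>T T))) w} \<le> f0 n)" ..
  from miss_tail[OF \<delta>k] obtain f1 where f1: "expsmall f1 \<and> (\<forall>n. prob (word_law n) (missed n (\<lambda>k. real n * (minfo k - \<delta>k k))) \<le> f1 n)" ..
  note f0 = conjunct1[OF f0] conjunct2[OF f0, rule_format]
  note f1 = conjunct1[OF f1] conjunct2[OF f1, rule_format]
  obtain C c where c: "c > 0" "\<And>n. f1 n \<le> C * exp (- c * real n)"
    using f1(1) unfolding expsmall_def by blast
  \<comment> \<open>The square root of the decay of \<open>f1\<close>, so that \<open>\<eta>\<close>
    and \<open>f1 / \<eta>\<close> are both exponentially small.\<close>
  define \<eta> where "\<eta> = (\<lambda>n. exp (- (c / 2) * real n))"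
  have Ce: "f1 n / \<eta> n \<le> C * \<eta> n" for n
  proof -
    have "exp (- c * real n) = \<eta> n * \<eta> n" by (simp add: \<eta>_def flip: exp_add)
    then have "f1 n \<le> (C * \<eta> n) * \<eta> n" using c(2)[of n] by (simp add: mult.assoc)
    then show ?thesis by (simp add: \<eta>_def pos_divide_le_eq)
  qed
  define err where "err = (\<lambda>n. 2 * (f0 n + \<bar>C\<bar> * \<eta> n) + 2 * (\<Sum>T\<in>Pow V - {{}}. 2 powr (- \<delta>T T * real n)) + \<eta> n
     + (\<Sum>k\<in>V. 2 * 2 powr (- \<delta>k k * real n)))"
  have "expsmall err"
    unfolding err_def \<eta>_def using finV c(1) f0(1) \<delta>T \<delta>k
    by (intro expsmall_add expsmall_cmult expsmall_sum expsmall_exp expsmall_powr) auto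
  moreover have le: "2 * (f0 n + f1 n / \<eta> n) + 2 * (\<Sum>T\<in>Pow V - {{}}. 2 powr (real n * (tcorr T + \<delta>T T)) / (\<Prod>k\<in>T. real (2 ^ b n k))) + \<eta> n
        + (\<Sum>k\<in>V. real (card (idx (a n) (b n) k)) * 2 powr (- (real n * (minfo k - \<delta>k k)))) \<le> err n" for n
    unfolding err_def
  proof (intro add_mono order_refl mult_left_mono sum_mono)
    show "f1 n / \<eta> n \<le> \<bar>C\<bar> * \<eta> n"
      by (rule order_trans[OF Ce]) (auto simp: \<eta>_def)
    fix T assume T: "T \<in> Pow V - {{}}"
    have "real n * (\<Sum>k\<in>T. r k) \<le> (\<Sum>k\<in>T. real (b n k))"
      unfolding sum_distrib_left b_def by (intro sum_mono) linarith
    then have "2 powr (real n * (\<Sum>k\<in>T. r k)) \<le> 2 powr (\<Sum>k\<in>T. real (b n k))" by simp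
    also have "\<dots> = (\<Prod>k\<in>T. real (2 ^ b n k))"
      by (simp add: powr_sum powr_realpow)
    finally have "2 powr (real n * (tcorr T + \<delta>T T)) / (\<Prod>k\<in>T. real (2 ^ b n k))
      \<le> 2 powr (real n * (tcorr T + \<delta>T T)) / 2 powr (real n * (\<Sum>k\<in>T. r k))"
      by (intro divide_left_mono) (auto intro!: mult_pos_pos prod_pos)
    also have "\<dots> = 2 powr (- \<delta>T T * real n)"
    proof -
      have "real n * (tcorr T + \<delta>T T) - real n * (\<Sum>k\<in>T. r k) = - \<delta>T T * real n"
        by (simp add: \<delta>T_def field_simps)
      then show ?thesis
        by (simp flip: powr_diff)
    qed
    finally show "2 powr (real n * (tcorr T + \<delta>T T)) / (\<Prod>k\<in>T. real (2 ^ b n k)) \<le> 2 powr (- \<delta>T T * real n)" .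
  next
    fix k assume k: "k \<in> V"
    have "0 \<le> real n * m k" "0 \<le> real n * r k" using nn[OF k] by auto
    then have "real (a n k) \<le> real n * m k" and "real (b n k) = of_int \<lceil>real n * r k\<rceil>"
      by (auto simp: a_def b_def of_nat_floor)
    \<comment> \<open>Rounding up costs at most one bit, the factor 2 in the last sum of
      \<open>err\<close>.\<close>
    moreover have "of_int \<lceil>real n * r k\<rceil> \<le> real n * r k + 1"
      by linarith
    ultimately have le: "2 powr (real (a n k) + real (b n k)) \<le> 2 powr (real n * (m k + r k) + 1)" by (simp add: algebra_simps)
    have "real (card (idx (a n) (b n) k)) = 2 powr (real (a n k) + real (b n k))"
      by (simp add: idx_def card_cartesian_product powr_add powr_realpow)
    then have "real (card (idx (a n) (b n) k)) * 2 powr (- (real n * (minfo k - \<delta>k k)))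
      \<le> 2 powr (real n * (m k + r k) + 1) * 2 powr (- (real n * (minfo k - \<delta>k k)))"
      using le by (intro mult_right_mono) auto
    also have "\<dots> = 2 powr (1 + - \<delta>k k * real n)"
    proof -
      have "real n * (m k + r k) + 1 + - (real n * (minfo k - \<delta>k k)) = 1 + - \<delta>k k * real n"
        by (simp add: \<delta>k_def field_simps)
      then show ?thesis
        by (simp only: powr_add[symmetric])
    qed
    also have "\<dots> = 2 * 2 powr (- \<delta>k k * real n)" unfolding powr_add by simp
    finally show "real (card (idx (a n) (b n) k)) * 2 powr (- (real n * (minfo k - \<delta>k k))) \<le> 2 * 2 powr (- \<delta>k k * real n)" .
  qed auto
  moreover have "block_scheme n (b n) \<mu> tgt msg (err n)"
    if "\<forall>om. \<forall>k\<in>V. tgt om k \<in> idx (a n) (b n) k \<and> msg om k < 2 ^ a n k"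
    for n and \<mu> :: "'o pmf" and tgt :: "'o \<Rightarrow> nat \<Rightarrow> nat \<times> nat" and msg :: "'o \<Rightarrow> nat \<Rightarrow> nat"
  proof -
    have "\<eta> n > 0" by (simp add: \<eta>_def)
    from block_scheme_exists[where tgt = tgt and a = "a n" and b = "b n" and msg = msg and \<mu> = \<mu>, OF f0(2) f1(2) _ this] that
    have "block_scheme n (b n) \<mu> tgt msg
      (2 * (f0 n + f1 n / \<eta> n) + 2 * (\<Sum>T\<in>Pow V - {{}}. 2 powr (real n * (tcorr T + \<delta>T T)) / (\<Prod>k\<in>T. real (2 ^ b n k))) + \<eta> n
        + (\<Sum>k\<in>V. real (card (idx (a n) (b n) k)) * 2 powr (- (real n * (minfo k - \<delta>k k)))))"
      by simp
    then show ?thesis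
      unfolding block_scheme_def
      by (elim exE conjE) (intro exI conjI, assumption+, erule order_trans, rule le)
  qed
  ultimately show ?thesis
    by (intro exI[of _ err] conjI allI impI)
qed

end

section \<open>Codes composed of stages\<close>

text \<open>Chain rule for encoders with feedback: the input at time t is a function of the prefix
  \<open>take t h\<close>, so it is determined once the whole history h is given.\<close>

lemma pmf_output_law:
  "pmf (output_law N W c m n) h =
    (if length h = n then \<Prod>t<n. pmf (W (channel_input N c m (take t h))) (h ! t) else 0)"
proof (induction n arbitrary: h)
  case 0
  then show ?case by (auto simp: indicator_def)
next
  case (Suc n)
  show ?case
  proof (cases h rule: rev_cases)
    case Nil
    have "pmf (map_pmf (\<lambda>y. h' @ [y]) (W (channel_input N c m h'))) [] = 0" for h'
      by (intro pmf_eq_0_set_pmf[THEN iffD2]) auto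
    then show ?thesis using Nil by (simp add: pmf_bind)
  next
    case (snoc h0 y0)
    have *: "pmf (map_pmf (\<lambda>y. h' @ [y]) (W (channel_input N c m h'))) (h0 @ [y0])
       = indicator {h0} h' * pmf (W (channel_input N c m h0)) y0" for h'
    proof (cases "h' = h0")
      case True
      have "pmf (map_pmf (\<lambda>y. h0 @ [y]) (W (channel_input N c m h0))) (h0 @ [y0])
          = pmf (W (channel_input N c m h0)) y0"
        by (rule pmf_map_inj') (auto simp: inj_on_def)
      then show ?thesis using True by simp
    next
      case False
      then show ?thesis by (auto intro!: pmf_eq_0_set_pmf[THEN iffD2])
    qed
    have "pmf (output_law N W c m (Suc n)) h = pmf (output_law N W c m n) h0 * pmf (W (channel_input N c m h0)) y0"
      unfolding snoc by (simp add: pmf_bind *) (simp add: measure_pmf_single)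
    also have "\<dots> = (if length h = Suc n then \<Prod>t<Suc n. pmf (W (channel_input N c m (take t h))) (h ! t) else 0)"
      by (auto simp: Suc.IH snoc nth_append intro!: prod.cong)
    finally show ?thesis .
  qed
qed

lemma prob_cong_pmf:
  assumes "\<And>x. x \<in> S \<Longrightarrow> pmf p x = pmf q x"
  shows "prob p S = prob q S"
  unfolding measure_pmf_conv_infsetsum using assms by (intro infsetsum_cong) auto

lemma pmf_map_list_Pi_pmf:
  "pmf (map_pmf (\<lambda>f. map f [0..<n]) (Pi_pmf {..<n} d K)) h
    = (if length h = n then \<Prod>t<n. pmf (K t) (h ! t) else 0)"
proof (cases "length h = n")
  case True
  have "(map f [0..<n] = h) = (\<forall>t\<in>{..<n}. f t \<in> {h ! t})" for f
  proof
    assume "map f [0..<n] = h"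
    then show "\<forall>t\<in>{..<n}. f t \<in> {h ! t}" by force
  next
    assume f: "\<forall>t\<in>{..<n}. f t \<in> {h ! t}"
    show "map f [0..<n] = h"
      by (rule nth_equalityI) (use f True in auto)
  qed
  then have "(\<lambda>f. map f [0..<n]) -` {h} = {f. \<forall>t\<in>{..<n}. f t \<in> {h ! t}}"
    by blast
  then have "pmf (map_pmf (\<lambda>f. map f [0..<n]) (Pi_pmf {..<n} d K)) h
      = (\<Prod>t<n. prob (K t) {h ! t})"
    unfolding pmf_map using prob_Pi_pmf_ball[of "{..<n}" d K "\<lambda>t. {h ! t}"] by simp
  then show ?thesis
    using True by (simp add: measure_pmf_single)
next
  case False
  have "h \<notin> set_pmf (map_pmf (\<lambda>f. map f [0..<n]) (Pi_pmf {..<n} d K))"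
    using False by (intro notI) auto
  then show ?thesis
    using False by (simp add: pmf_eq_0_set_pmf)
qed

text \<open>As long as the encoders act as intended, the actual law and the memoryless law under the
  intended inputs give the same probabilities.\<close>

lemma prob_output_law_eq_genie:
  assumes "\<And>h t. h \<in> G \<Longrightarrow> length h = n \<Longrightarrow> t < n \<Longrightarrow> channel_input N c m (take t h) = x t"
  shows "prob (output_law N W c m n) (- (G \<inter> {h. length h = n}))
    = prob (Pi_pmf {..<n} undefined (\<lambda>t. W (x t))) {f. map f [0..<n] \<notin> G}"
proof -
  let ?Q = "map_pmf (\<lambda>f. map f [0..<n]) (Pi_pmf {..<n} undefined (\<lambda>t. W (x t)))"
  let ?G = "G \<inter> {h. length h = n}"
  have "prob (output_law N W c m n) ?G = prob ?Q ?G"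
    using assms by (intro prob_cong_pmf) (simp add: pmf_output_law pmf_map_list_Pi_pmf)
  \<comment> \<open>The two laws agree pointwise only on \<open>?G\<close>; having total mass 1,
    they also give its complement the same probability.\<close>
  then have "prob (output_law N W c m n) (- ?G) = prob ?Q (- ?G)"
    using measure_pmf.prob_compl[of ?G "output_law N W c m n"] measure_pmf.prob_compl[of ?G ?Q]
    unfolding Compl_eq_Diff_UNIV space_measure_pmf sets_measure_pmf by simp
  also have "\<dots> = prob (Pi_pmf {..<n} undefined (\<lambda>t. W (x t))) ((\<lambda>f. map f [0..<n]) -` (- ?G))"
    by (rule measure_map_pmf)
  also have "(\<lambda>f. map f [0..<n]) -` (- ?G) = {f. map f [0..<n] \<notin> G}"
    by auto
  finally show ?thesis .
qed

text \<open>Cuts one stage out of the product law, so that the stages can be analysed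
  separately.\<close>

lemma map_Pi_pmf_segment:
  assumes "a + n \<le> (\<nu>::nat)"
  shows "map_pmf (\<lambda>f t. if t < n then f (a + t) else undefined) (Pi_pmf {..<\<nu>} d K)
    = Pi_pmf {..<n} undefined (\<lambda>t. K (a + t))"
proof (rule pmf_eqI)
  fix g
  show "pmf (map_pmf (\<lambda>f t. if t < n then f (a + t) else undefined) (Pi_pmf {..<\<nu>} d K)) g
    = pmf (Pi_pmf {..<n} undefined (\<lambda>t. K (a + t))) g"
  proof (cases "\<forall>t. t \<notin> {..<n} \<longrightarrow> g t = undefined")
    case True
    define B where "B = (\<lambda>s. if s \<in> {a..<a + n} then {g (s - a)} else UNIV)"
    have sub: "{a..<a + n} \<subseteq> {..<\<nu>}" using assms by auto
    have "(\<lambda>f t. if t < n then f (a + t) else undefined) -` {g} = {f. \<forall>s\<in>{..<\<nu>}. f s \<in> B s}"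
    proof (intro set_eqI iffI)
      fix f assume "f \<in> (\<lambda>f t. if t < n then f (a + t) else undefined) -` {g}"
      then have "(\<lambda>t. if t < n then f (a + t) else undefined) = g" by simp
      then have "g t = f (a + t)" if "t < n" for t using that by (auto dest: fun_cong[where x = t])
      then show "f \<in> {f. \<forall>s\<in>{..<\<nu>}. f s \<in> B s}" by (auto simp: B_def)
    next
      fix f assume f: "f \<in> {f. \<forall>s\<in>{..<\<nu>}. f s \<in> B s}"
      have "f (a + t) = g t" if "t < n" for t
      proof -
        have "f (a + t) \<in> B (a + t)" using f that assms by simp
        then show ?thesis using that by (simp add: B_def)
      qed
      then show "f \<in> (\<lambda>f t. if t < n then f (a + t) else undefined) -` {g}"
        using True by auto
    qed
    then have "pmf (map_pmf (\<lambda>f t. if t < n then f (a + t) else undefined) (Pi_pmf {..<\<nu>} d K)) g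
      = (\<Prod>s<\<nu>. prob (K s) (B s))"
      by (simp add: pmf_map prob_Pi_pmf_ball)
    also have "\<dots> = (\<Prod>s\<in>{a..<a + n}. prob (K s) (B s))"
      using sub by (intro prod.mono_neutral_right) (auto simp: B_def)
    also have "\<dots> = (\<Prod>t<n. pmf (K (a + t)) (g t))"
      by (rule prod.reindex_bij_witness[of _ "\<lambda>t. a + t" "\<lambda>s. s - a"]) (auto simp: B_def measure_pmf_single)
    finally show ?thesis using True by (simp add: pmf_Pi)
  next
    case False
    then show ?thesis
      by (subst pmf_Pi) (auto intro!: pmf_eq_0_set_pmf[THEN iffD2] split: if_splits)
  qed
qed

lemma finite_msg_tuples: "finite D \<Longrightarrow> finite (msg_tuples D R n)"
  by (auto simp: msg_tuples_def msg_set_def intro!: finite_PiE)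

lemma msg_tuples_nonempty: "msg_tuples D R n \<noteq> {}"
  by (auto simp: msg_tuples_def msg_set_def PiE_eq_empty_iff)

text \<open>Past the end of the stage the value is the default of \<open>Pi_pmf\<close>, a vector of outputs, as seen by node k.\<close>

definition segment :: "nat \<Rightarrow> nat \<Rightarrow> 'y list \<Rightarrow> nat \<Rightarrow> nat \<Rightarrow> 'y" where
  "segment n k ys \<sigma> = (\<lambda>t. if t < n then ys ! (\<sigma> * n + t) else (undefined :: nat \<Rightarrow> 'y) k)"

text \<open>A relay encoder is a function of its past outputs, so the state is recomputed from them
  at every use.\<close>

primrec node_state ::
  "nat \<Rightarrow> (nat \<Rightarrow> nat \<Rightarrow> 'i list \<Rightarrow> (nat \<Rightarrow> 'y) \<Rightarrow> 'i) \<Rightarrow> nat \<Rightarrow> 'y list \<Rightarrow> nat \<Rightarrow> 'i list" where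
  "node_state n Dd k ys 0 = []"
| "node_state n Dd k ys (Suc \<sigma>) = node_state n Dd k ys \<sigma> @ [Dd \<sigma> k (node_state n Dd k ys \<sigma>) (segment n k ys \<sigma>)]"

text \<open>Time is cut into K stages of length n. After stage \<open>\<sigma>\<close> node k appends a decoded symbol to its
  state, the intended symbol being \<open>d \<sigma> k m\<close>; it uses only its state as an encoder in a stage.\<close>

lemma staged_code:
  fixes N :: nat and X :: "nat \<Rightarrow> 'x set" and Y :: "nat \<Rightarrow> 'y set" and \<nu> n K :: nat
    and W :: "(nat \<Rightarrow> 'x) \<Rightarrow> (nat \<Rightarrow> 'y) pmf"
    and E :: "nat \<Rightarrow> nat \<Rightarrow> 'i list \<Rightarrow> nat \<Rightarrow> 'x" and S :: "nat \<Rightarrow> (nat \<Rightarrow> nat) \<Rightarrow> nat \<Rightarrow> 'x"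
    and Dd :: "nat \<Rightarrow> nat \<Rightarrow> 'i list \<Rightarrow> (nat \<Rightarrow> 'y) \<Rightarrow> 'i" and d :: "nat \<Rightarrow> nat \<Rightarrow> (nat \<Rightarrow> nat) \<Rightarrow> 'i"
    and fin :: "nat \<Rightarrow> 'i list \<Rightarrow> nat"
  assumes n: "n \<ge> 1" and K: "K * n \<le> \<nu>" and D: "D \<subseteq> {2..N}" and N: "N \<ge> 1"
    and x0: "\<And>k. k \<in> {1..N} \<Longrightarrow> x0 k \<in> X k"
    and E: "\<And>\<sigma> k \<kappa> t. \<sigma> < K \<Longrightarrow> k \<in> {2..N} \<Longrightarrow> t < n \<Longrightarrow> E \<sigma> k \<kappa> t \<in> X k"
    and S: "\<And>\<sigma> m t. \<sigma> < K \<Longrightarrow> t < n \<Longrightarrow> m \<in> msg_tuples D R \<nu> \<Longrightarrow> S \<sigma> m t \<in> X 1"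
    and fin: "\<And>k m. k \<in> D \<Longrightarrow> m \<in> msg_tuples D R \<nu> \<Longrightarrow> fin k (map (\<lambda>\<sigma>. d \<sigma> k m) [0..<K]) = m k"
  defines "\<kappa> \<equiv> \<lambda>\<sigma> k m. map (\<lambda>\<sigma>'. d \<sigma>' k m) [0..<\<sigma>]"
  defines "inp \<equiv> \<lambda>\<sigma> m t. \<lambda>k\<in>{1..N}. if k = 1 then S \<sigma> m t else E \<sigma> k (\<kappa> \<sigma> k m) t"
  shows "\<exists>c. is_code N X Y D R \<nu> c \<and> error_prob N W D R \<nu> c
    \<le> (\<Sum>\<sigma><K. expect (pmf_of_set (msg_tuples D R \<nu>)) (\<lambda>m.
        prob (Pi_pmf {..<n} undefined (\<lambda>t. W (inp \<sigma> m t)))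
          {y. \<exists>k\<in>{2..N}. Dd \<sigma> k (\<kappa> \<sigma> k m) (\<lambda>t. y t k) \<noteq> d \<sigma> k m}))"
proof -
  let ?st = "node_state n Dd"
  \<comment> \<open>After the last stage the inputs are padded with \<open>x0\<close>. The
    membership check in the decoder ensures \<open>is_code\<close>; a correct message passes
    it.\<close>
  define c :: "('x, 'y) code" where "c = \<lparr>
     src_enc = (\<lambda>m ys. let t = length ys in if t < K * n then S (t div n) m (t mod n) else x0 1),
     relay_enc = (\<lambda>k ys. let t = length ys in
        if t < K * n then E (t div n) k (?st k ys (t div n)) (t mod n) else x0 k),
     decoder = (\<lambda>k ys. let v = fin k (?st k ys K) in if v \<in> msg_set \<nu> (R k) then Some v else None)\<rparr>"
  have divn: "t div n < K" "t mod n < n" if "t < K * n" for t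
    using that n by (auto simp: div_less_iff_less_mult)
  have "is_code N X Y D R \<nu> c"
    unfolding is_code_def
  proof (intro conjI ballI impI)
    show "src_enc c m ys \<in> X 1" if "m \<in> msg_tuples D R \<nu>" for m ys
      using that x0[of 1] N S divn[of "length ys"] by (simp add: c_def Let_def)
    show "relay_enc c k ys \<in> X k" if "k \<in> {2..N}" for k ys
      using that x0[of k] E divn[of "length ys"] by (simp add: c_def Let_def)
    show "decoder c k ys \<in> insert None (Some ` msg_set \<nu> (R k))" for k ys
      by (simp add: c_def Let_def)
  qed
  moreover have "error_prob N W D R \<nu> c
    \<le> (\<Sum>\<sigma><K. expect (pmf_of_set (msg_tuples D R \<nu>)) (\<lambda>m.
        prob (Pi_pmf {..<n} undefined (\<lambda>t. W (inp \<sigma> m t)))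
          {y. \<exists>k\<in>{2..N}. Dd \<sigma> k (\<kappa> \<sigma> k m) (\<lambda>t. y t k) \<noteq> d \<sigma> k m}))"
  proof -
    let ?M = "pmf_of_set (msg_tuples D R \<nu>)"
    have finD: "finite D" using D finite_subset by blast
    have setM: "set_pmf ?M = msg_tuples D R \<nu>"
      using finD by (simp add: set_pmf_of_set finite_msg_tuples msg_tuples_nonempty)
    have finM: "finite (set_pmf ?M)" using setM finD finite_msg_tuples by simp
    define x where "x = (\<lambda>m t. if t < K * n then inp (t div n) m (t mod n) else (\<lambda>k\<in>{1..N}. x0 k))"
    \<comment> \<open>Success is formulated with the intended states, so that each condition
      involves the outputs of a single stage.\<close>
    define G where "G = (\<lambda>m. {h. \<forall>\<sigma><K. \<forall>k\<in>{2..N}.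
       Dd \<sigma> k (\<kappa> \<sigma> k m) (segment n k (map (\<lambda>y. y k) h) \<sigma>) = d \<sigma> k m})"
    \<comment> \<open>A stage that ends by time t lies within \<open>take t h\<close>, so on
      \<open>G m\<close> the states computed from a prefix are the intended ones.\<close>
    have state: "?st k (map (\<lambda>y. y k) (take t h)) \<sigma> = \<kappa> \<sigma> k m"
      if "h \<in> G m" "length h = \<nu>" "k \<in> {2..N}" "\<sigma> \<le> K" "\<sigma> * n \<le> t" for h m k \<sigma> t
      using that(4,5)
    proof (induction \<sigma>)
      case 0
      then show ?case by (simp add: \<kappa>_def)
    next
      case (Suc \<sigma>)
      have "Suc \<sigma> * n \<le> K * n" using Suc.prems by (intro mult_right_mono) auto
      then have "Suc \<sigma> * n \<le> \<nu>" using K by linarith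
      then have "segment n k (map (\<lambda>y. y k) (take t h)) \<sigma> = segment n k (map (\<lambda>y. y k) h) \<sigma>"
        using Suc.prems that(2) by (auto simp: segment_def)
      moreover have "?st k (map (\<lambda>y. y k) (take t h)) \<sigma> = \<kappa> \<sigma> k m"
        using Suc by simp
      moreover have "Dd \<sigma> k (\<kappa> \<sigma> k m) (segment n k (map (\<lambda>y. y k) h) \<sigma>) = d \<sigma> k m"
        using that(1,3) Suc.prems(1) unfolding G_def by auto
      ultimately show ?case by (simp add: \<kappa>_def)
    qed
    have chan: "channel_input N c m (take t h) = x m t"
      if "h \<in> G m" "length h = \<nu>" "t < \<nu>" for m h t
    proof -
      have l: "length (take t h) = t" using that by simp
      have "?st k (map (\<lambda>y. y k) (take t h)) (t div n) = \<kappa> (t div n) k m" if "k \<in> {2..N}" "t < K * n" for k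
        using that \<open>h \<in> G m\<close> \<open>length h = \<nu>\<close> divn[of t] by (intro state) auto
      then show ?thesis
        unfolding channel_input_def x_def inp_def if_distribR
        by (intro ext) (simp add: restrict_def c_def Let_def l \<open>t < \<nu>\<close> that(2))
    qed
    have err1: "prob (output_law N W c m \<nu>) {h. \<exists>k\<in>D. decoder c k (map (\<lambda>y. y k) h) \<noteq> Some (m k)}
       \<le> (\<Sum>\<sigma><K. prob (Pi_pmf {..<n} undefined (\<lambda>t. W (inp \<sigma> m t)))
          {y. \<exists>k\<in>{2..N}. Dd \<sigma> k (\<kappa> \<sigma> k m) (\<lambda>t. y t k) \<noteq> d \<sigma> k m})"
      if m: "m \<in> msg_tuples D R \<nu>" for m
    proof -
      let ?Pi = "Pi_pmf {..<\<nu>} undefined (\<lambda>t. W (x m t))"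
      have "prob (output_law N W c m \<nu>) {h. \<exists>k\<in>D. decoder c k (map (\<lambda>y. y k) h) \<noteq> Some (m k)}
        \<le> prob (output_law N W c m \<nu>) (- (G m \<inter> {h. length h = \<nu>}))"
      proof (intro measure_pmf.finite_measure_mono subsetI)
        fix h assume h: "h \<in> {h. \<exists>k\<in>D. decoder c k (map (\<lambda>y. y k) h) \<noteq> Some (m k)}"
        show "h \<in> - (G m \<inter> {h. length h = \<nu>})"
        proof
          assume "h \<in> G m \<inter> {h. length h = \<nu>}"
          then have g: "h \<in> G m" "length h = \<nu>" by auto
          obtain k where k: "k \<in> D" "decoder c k (map (\<lambda>y. y k) h) \<noteq> Some (m k)" using h by auto
          have "?st k (map (\<lambda>y. y k) (take \<nu> h)) K = \<kappa> K k m"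
            using g k D K by (intro state) auto
          then have "?st k (map (\<lambda>y. y k) h) K = \<kappa> K k m" using g by simp
          moreover have "m k \<in> msg_set \<nu> (R k)" using m k by (auto simp: msg_tuples_def)
          ultimately have "decoder c k (map (\<lambda>y. y k) h) = Some (m k)"
            using fin[OF k(1) m] by (simp add: c_def \<kappa>_def)
          with k show False by simp
        qed
      qed simp
      \<comment> \<open>Here the feedback disappears: the actual law is exchanged for the memoryless
        one under the intended inputs.\<close>
      also have "\<dots> = prob ?Pi {f. map f [0..<\<nu>] \<notin> G m}"
        using chan by (intro prob_output_law_eq_genie) auto
      also have "\<dots> \<le> prob ?Pi (\<Union>\<sigma><K. {f. \<exists>k\<in>{2..N}.
           Dd \<sigma> k (\<kappa> \<sigma> k m) (segment n k (map (\<lambda>y. y k) (map f [0..<\<nu>])) \<sigma>) \<noteq> d \<sigma> k m})"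
        by (intro measure_pmf.finite_measure_mono) (auto simp: G_def)
      also have "\<dots> \<le> (\<Sum>\<sigma><K. prob ?Pi {f. \<exists>k\<in>{2..N}.
           Dd \<sigma> k (\<kappa> \<sigma> k m) (segment n k (map (\<lambda>y. y k) (map f [0..<\<nu>])) \<sigma>) \<noteq> d \<sigma> k m})"
        by (intro measure_pmf.finite_measure_subadditive_finite) auto
      also have "\<dots> = (\<Sum>\<sigma><K. prob (Pi_pmf {..<n} undefined (\<lambda>t. W (inp \<sigma> m t)))
          {y. \<exists>k\<in>{2..N}. Dd \<sigma> k (\<kappa> \<sigma> k m) (\<lambda>t. y t k) \<noteq> d \<sigma> k m})"
      proof (intro sum.cong refl)
        fix \<sigma> assume \<sigma>: "\<sigma> \<in> {..<K}"
        have "(\<sigma> + 1) * n \<le> K * n" using \<sigma> by (intro mult_right_mono) auto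
        then have le: "\<sigma> * n + n \<le> \<nu>" and lt: "\<And>t. t < n \<Longrightarrow> \<sigma> * n + t < K * n" using K by auto
        have seg: "segment n k (map (\<lambda>y. y k) (map f [0..<\<nu>])) \<sigma> = (\<lambda>t. (if t < n then f (\<sigma> * n + t) else undefined) k)" for f k
          using le by (auto simp: segment_def)
        have "Pi_pmf {..<n} undefined (\<lambda>t. W (inp \<sigma> m t)) = Pi_pmf {..<n} undefined (\<lambda>t. W (x m (\<sigma> * n + t)))"
          using lt by (intro Pi_pmf_cong refl) (auto simp: x_def)
        also have "\<dots> = map_pmf (\<lambda>f t. if t < n then f (\<sigma> * n + t) else undefined) ?Pi"
          using map_Pi_pmf_segment[OF le, of undefined "\<lambda>t. W (x m t)"] by simp
        finally show "prob ?Pi {f. \<exists>k\<in>{2..N}.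
           Dd \<sigma> k (\<kappa> \<sigma> k m) (segment n k (map (\<lambda>y. y k) (map f [0..<\<nu>])) \<sigma>) \<noteq> d \<sigma> k m}
          = prob (Pi_pmf {..<n} undefined (\<lambda>t. W (inp \<sigma> m t)))
          {y. \<exists>k\<in>{2..N}. Dd \<sigma> k (\<kappa> \<sigma> k m) (\<lambda>t. y t k) \<noteq> d \<sigma> k m}"
          unfolding seg by (simp add: vimage_def)
      qed
      finally show ?thesis .
    qed
    have "error_prob N W D R \<nu> c = expect ?M (\<lambda>m.
       prob (output_law N W c m \<nu>) {h. \<exists>k\<in>D. decoder c k (map (\<lambda>y. y k) h) \<noteq> Some (m k)})"
      by (simp add: error_prob_def measure_bind_pmf vimage_def)
    also have "\<dots> \<le> expect ?M (\<lambda>m.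
       \<Sum>\<sigma><K. prob (Pi_pmf {..<n} undefined (\<lambda>t. W (inp \<sigma> m t)))
          {y. \<exists>k\<in>{2..N}. Dd \<sigma> k (\<kappa> \<sigma> k m) (\<lambda>t. y t k) \<noteq> d \<sigma> k m})"
      using err1 setM by (intro integral_mono_AE integrable_measure_pmf_finite finM) (auto simp: AE_measure_pmf_iff)
    also have "\<dots> = (\<Sum>\<sigma><K. expect ?M (\<lambda>m.
       prob (Pi_pmf {..<n} undefined (\<lambda>t. W (inp \<sigma> m t)))
          {y. \<exists>k\<in>{2..N}. Dd \<sigma> k (\<kappa> \<sigma> k m) (\<lambda>t. y t k) \<noteq> d \<sigma> k m}))"
      by (intro Bochner_Integration.integral_sum integrable_measure_pmf_finite finM)
    finally show ?thesis .
  qed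
  ultimately show ?thesis by blast
qed

section \<open>Flooding\<close>

text \<open>The weakest sense in which v can signal to w: with the other inputs held at suitable
  constants, the input of v affects the output law at w.\<close>

definition edge :: "nat \<Rightarrow> (nat \<Rightarrow> 'x set) \<Rightarrow> ((nat \<Rightarrow> 'x) \<Rightarrow> (nat \<Rightarrow> 'y) pmf) \<Rightarrow> nat \<Rightarrow> nat \<Rightarrow> bool" where
  "edge N X W v w \<longleftrightarrow> v \<in> {1..N} \<and> w \<in> {2..N} \<and> (\<exists>x\<in>PiE {1..N} X. \<exists>a\<in>X v.
     map_pmf (\<lambda>y. y w) (W x) \<noteq> map_pmf (\<lambda>y. y w) (W (x(v := a))))"

text \<open>Edges in the order of their use. A receiver may occur several times, so sequences for
  different nodes can simply be concatenated.\<close>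

inductive flooding :: "nat \<Rightarrow> (nat \<Rightarrow> 'x set) \<Rightarrow> ((nat \<Rightarrow> 'x) \<Rightarrow> (nat \<Rightarrow> 'y) pmf) \<Rightarrow> (nat \<times> nat) list \<Rightarrow> bool"
  for N X W where
  flooding_Nil: "flooding N X W []"
| flooding_snoc: "flooding N X W es \<Longrightarrow> edge N X W v w \<Longrightarrow> v = 1 \<or> v \<in> snd ` set es \<Longrightarrow>
    flooding N X W (es @ [(v, w)])"

lemma flooding_append:
  assumes "flooding N X W es'" "flooding N X W es"
  shows "flooding N X W (es @ es')"
  using assms(1)
proof induction
  case flooding_Nil
  then show ?case using assms(2) by simp
next
  case (flooding_snoc es' v w)
  have "flooding N X W ((es @ es') @ [(v, w)])"
    by (rule flooding.flooding_snoc) (use flooding_snoc in auto)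
  then show ?case by simp
qed

lemma flooding_nth:
  assumes "flooding N X W es" "e < length es"
  shows "edge N X W (fst (es ! e)) (snd (es ! e))"
    and "fst (es ! e) = 1 \<or> (\<exists>e'<e. snd (es ! e') = fst (es ! e))"
proof -
  have "edge N X W (fst (es ! e)) (snd (es ! e)) \<and> (fst (es ! e) = 1 \<or> (\<exists>e'<e. snd (es ! e') = fst (es ! e)))"
    using assms
  proof induction
    case (flooding_snoc es v w)
    show ?case
    proof (cases "e = length es")
      case True
      have "v = 1 \<or> (\<exists>e'<length es. snd (es ! e') = v)"
      proof (cases "v = 1")
        case False
        then obtain p where "p \<in> set es" "snd p = v" using flooding_snoc.hyps by auto
        then show ?thesis by (metis in_set_conv_nth)
      qed simp
      then have "v = 1 \<or> (\<exists>e'<length es. snd ((es @ [(v, w)]) ! e') = v)"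
        by (metis nth_append)
      then show ?thesis
        using True flooding_snoc.hyps by simp
    next
      case False
      then have "e < length es" using flooding_snoc.prems by simp
      then have IH: "edge N X W (fst (es ! e)) (snd (es ! e)) \<and> (fst (es ! e) = 1 \<or> (\<exists>e'<e. snd (es ! e') = fst (es ! e)))"
        and n: "\<And>e'. e' \<le> e \<Longrightarrow> (es @ [(v, w)]) ! e' = es ! e'"
        using flooding_snoc.IH by (simp_all add: nth_append)
      then show ?thesis
        by (metis less_imp_le order_refl)
    qed
  qed simp
  then show "edge N X W (fst (es ! e)) (snd (es ! e))"
    and "fst (es ! e) = 1 \<or> (\<exists>e'<e. snd (es ! e') = fst (es ! e))" by auto
qed

definition reachable :: "nat \<Rightarrow> (nat \<Rightarrow> 'x set) \<Rightarrow> ((nat \<Rightarrow> 'x) \<Rightarrow> (nat \<Rightarrow> 'y) pmf) \<Rightarrow> nat \<Rightarrow> bool" where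
  "reachable N X W k \<longleftrightarrow> k = 1 \<or> (\<exists>es. flooding N X W es \<and> k \<in> snd ` set es)"

lemma reachable_edge:
  assumes "reachable N X W v" "edge N X W v w"
  shows "reachable N X W w"
proof -
  have "\<exists>es. flooding N X W es \<and> (v = 1 \<or> v \<in> snd ` set es)"
    using assms(1) flooding_Nil by (auto simp: reachable_def)
  then obtain es where "flooding N X W es" "v = 1 \<or> v \<in> snd ` set es" by blast
  then have "flooding N X W (es @ [(v, w)])"
    using assms(2) by (intro flooding_snoc)
  then show ?thesis
    unfolding reachable_def by (intro disjI2 exI[of _ "es @ [(v, w)]"]) auto
qed

lemma flooding_covers:
  assumes "finite A" "\<And>k. k \<in> A \<Longrightarrow> reachable N X W k"
  obtains es where "flooding N X W es" "A - {1} \<subseteq> snd ` set es"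
proof -
  have "\<exists>es. flooding N X W es \<and> A - {1} \<subseteq> snd ` set es"
    using assms
  proof (induction A rule: finite_induct)
    case empty
    show ?case by (intro exI[of _ "[]"]) (simp add: flooding_Nil)
  next
    case (insert k A)
    then obtain es where es: "flooding N X W es" "A - {1} \<subseteq> snd ` set es" by auto
    show ?case
    proof (cases "k = 1")
      case True
      then show ?thesis using es by auto
    next
      case False
      then obtain es' where "flooding N X W es'" "k \<in> snd ` set es'"
        using insert.prems[of k] by (auto simp: reachable_def)
      then show ?thesis
        using es flooding_append[of N X W es' es] by (intro exI[of _ "es @ es'"]) auto
    qed
  qed
  then show thesis using that by blast
qed

text \<open>The number of occurrences of \<open>a\<close> has different means under the two laws,
  and a threshold half way between them separates the laws with exponentially small errors.
  \<open>g\<close> extracts what the receiver sees of an output vector.\<close>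

lemma indicator_test:
  assumes fin: "finite (set_pmf p0)" "finite (set_pmf p1)"
    and less: "pmf (map_pmf g p0) a < pmf (map_pmf g p1) a"
  shows "\<exists>f. expsmall f \<and> (\<forall>n. \<exists>test :: (nat \<Rightarrow> 'b) \<Rightarrow> bool.
     prob (iid_word n p0) {y. test (\<lambda>t. g (y t))} \<le> f n \<and>
     prob (iid_word n p1) {y. \<not> test (\<lambda>t. g (y t))} \<le> f n)"
proof -
  define q0 where "q0 = pmf (map_pmf g p0) a"
  define q1 where "q1 = pmf (map_pmf g p1) a"
  define \<delta> where "\<delta> = (q1 - q0) / 2"
  have \<delta>: "\<delta> > 0" using less by (simp add: \<delta>_def q0_def q1_def)
  have E: "expect p (\<lambda>y. indicator {y. g y = a} y :: real) = pmf (map_pmf g p) a" for p :: "'a pmf"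
    by (simp add: pmf_map vimage_def)
  have "expect p0 (\<lambda>y. indicator {y. g y = a} y :: real) = q0"
    unfolding E q0_def ..
  from Hoeffding_iid_word[OF fin(1) \<delta>, where g = "indicator {y. g y = a}", unfolded this]
  obtain c0 where c0: "c0 > 0 \<and> (\<forall>n. prob (iid_word n p0)
     {w. (\<Sum>t<n. indicator {y. g y = a} (w t)) \<ge> real n * (q0 + \<delta>)} \<le> exp (- c0 * real n))" ..
  have "expect p1 (\<lambda>y. - indicator {y. g y = a} y :: real) = - q1"
    unfolding integral_minus E q1_def ..
  from Hoeffding_iid_word[OF fin(2) \<delta>, where g = "\<lambda>y. - indicator {y. g y = a} y", unfolded this]
  obtain c1 where c1: "c1 > 0 \<and> (\<forall>n. prob (iid_word n p1)
     {w. (\<Sum>t<n. - indicator {y. g y = a} (w t)) \<ge> real n * (- q1 + \<delta>)} \<le> exp (- c1 * real n))" ..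
  note c0 = conjunct1[OF c0] conjunct2[OF c0, rule_format]
  note c1 = conjunct1[OF c1] conjunct2[OF c1, rule_format]
  define test where "test = (\<lambda>n (z :: nat \<Rightarrow> 'b). (\<Sum>t<n. of_bool (z t = a)) \<ge> real n * (q0 + \<delta>))"
  have ind: "indicator {y. g y = a} = (\<lambda>y. of_bool (g y = a) :: real)"
    by (auto simp: fun_eq_iff)
  have mid: "q0 + \<delta> = q1 - \<delta>" by (simp add: \<delta>_def field_simps)
  show ?thesis
  proof (intro exI conjI allI)
    show "expsmall (\<lambda>n. exp (- c0 * real n) + exp (- c1 * real n))"
      using c0 c1 by (intro expsmall_add expsmall_exp)
    fix n
    have "prob (iid_word n p0) {y. test n (\<lambda>t. g (y t))} \<le> exp (- c0 * real n)"
      using c0(2)[of n] by (simp add: ind test_def)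
    then show "prob (iid_word n p0) {y. test n (\<lambda>t. g (y t))} \<le> exp (- c0 * real n) + exp (- c1 * real n)"
      using exp_gt_zero[of "- c1 * real n"] by linarith
    have "prob (iid_word n p1) {y. \<not> test n (\<lambda>t. g (y t))} \<le>
       prob (iid_word n p1) {w. (\<Sum>t<n. - indicator {y. g y = a} (w t)) \<ge> real n * (- q1 + \<delta>)}"
    proof (intro measure_pmf.finite_measure_mono subsetI CollectI)
      fix y assume "y \<in> {y. \<not> test n (\<lambda>t. g (y t))}"
      then have "(\<Sum>t<n. of_bool (g (y t) = a)) \<le> real n * (q1 - \<delta>)"
        by (simp add: test_def mid)
      then have "real n * (- q1 + \<delta>) \<le> - (\<Sum>t<n. of_bool (g (y t) = a))"
        by (simp add: algebra_simps)
      then show "real n * (- q1 + \<delta>) \<le> (\<Sum>t<n. - indicator {y. g y = a} (y t))"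
        unfolding ind sum_negf .
    qed simp
    then show "prob (iid_word n p1) {y. \<not> test n (\<lambda>t. g (y t))} \<le> exp (- c0 * real n) + exp (- c1 * real n)"
      using c1(2)[of n] exp_gt_zero[of "- c0 * real n"] by linarith
  qed
qed

text \<open>Transmission of one bit by repetition. As \<open>xb True\<close> and
  \<open>xb False\<close> differ at v only, all other nodes can play their part without knowing the
  bit.\<close>

definition bit_channel where
  "bit_channel N X W v w xb f \<longleftrightarrow> (\<forall>\<beta>. xb \<beta> \<in> PiE {1..N} X) \<and> (\<forall>k. k \<noteq> v \<longrightarrow> xb True k = xb False k) \<and>
     (\<forall>n. \<exists>test. \<forall>\<beta>. prob (iid_word n (W (xb \<beta>))) {y. test (\<lambda>t. y t w) \<noteq> \<beta>} \<le> f n)"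

text \<open>Some output symbol has different probabilities under the two inputs. The test counts
  this symbol, so the input that makes it more likely has to stand for \<open>True\<close>; hence
  the two cases.\<close>

lemma edge_bit_channel:
  assumes e: "edge N X W v w" and fin: "\<And>x. x \<in> PiE {1..N} X \<Longrightarrow> finite (set_pmf (W x))"
  shows "\<exists>xb f. expsmall f \<and> bit_channel N X W v w xb f"
proof -
  obtain x a where x: "x \<in> PiE {1..N} X" "a \<in> X v" "v \<in> {1..N}"
    and ne: "map_pmf (\<lambda>y. y w) (W x) \<noteq> map_pmf (\<lambda>y. y w) (W (x(v := a)))"
    using e by (auto simp: edge_def)
  have x': "x(v := a) \<in> PiE {1..N} X" using x by (auto simp: PiE_def extensional_def)
  obtain b where b: "pmf (map_pmf (\<lambda>y. y w) (W x)) b \<noteq> pmf (map_pmf (\<lambda>y. y w) (W (x(v := a)))) b"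
  proof (rule ccontr)
    assume "\<not> thesis"
    then have "map_pmf (\<lambda>y. y w) (W x) = map_pmf (\<lambda>y. y w) (W (x(v := a)))"
      using that by (intro pmf_eqI) blast
    with ne show False ..
  qed
  show ?thesis
  proof (cases "pmf (map_pmf (\<lambda>y. y w) (W x)) b < pmf (map_pmf (\<lambda>y. y w) (W (x(v := a)))) b")
    case True
    from indicator_test[OF fin[OF x(1)] fin[OF x'] True] obtain f where f: "expsmall f \<and> (\<forall>n. \<exists>test.
       prob (iid_word n (W x)) {y. test (\<lambda>t. y t w)} \<le> f n \<and>
       prob (iid_word n (W (x(v := a)))) {y. \<not> test (\<lambda>t. y t w)} \<le> f n)" ..
    note f = conjunct1[OF f] conjunct2[OF f, rule_format]
    have "bit_channel N X W v w (\<lambda>\<beta>. if \<beta> then x(v := a) else x) f"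
      unfolding bit_channel_def
    proof (intro conjI allI)
      fix n
      from f(2)[of n] obtain test where t: "prob (iid_word n (W x)) {y. test (\<lambda>t. y t w)} \<le> f n \<and>
       prob (iid_word n (W (x(v := a)))) {y. \<not> test (\<lambda>t. y t w)} \<le> f n" ..
      show "\<exists>test. \<forall>\<beta>. prob (iid_word n (W (if \<beta> then x(v := a) else x))) {y. test (\<lambda>t. y t w) \<noteq> \<beta>} \<le> f n"
      proof (intro exI[of _ test] allI)
        fix \<beta>
        show "prob (iid_word n (W (if \<beta> then x(v := a) else x))) {y. test (\<lambda>t. y t w) \<noteq> \<beta>} \<le> f n"
          by (cases \<beta>) (use t in simp_all)
      qed
    qed (use x x' in auto)
    then show ?thesis using f by blast
  next
    case False
    then have less: "pmf (map_pmf (\<lambda>y. y w) (W (x(v := a)))) b < pmf (map_pmf (\<lambda>y. y w) (W x)) b"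
      using b by simp
    from indicator_test[OF fin[OF x'] fin[OF x(1)] less] obtain f where f: "expsmall f \<and> (\<forall>n. \<exists>test.
       prob (iid_word n (W (x(v := a)))) {y. test (\<lambda>t. y t w)} \<le> f n \<and>
       prob (iid_word n (W x)) {y. \<not> test (\<lambda>t. y t w)} \<le> f n)" ..
    note f = conjunct1[OF f] conjunct2[OF f, rule_format]
    have "bit_channel N X W v w (\<lambda>\<beta>. if \<beta> then x else x(v := a)) f"
      unfolding bit_channel_def
    proof (intro conjI allI)
      fix n
      from f(2)[of n] obtain test where t: "prob (iid_word n (W (x(v := a)))) {y. test (\<lambda>t. y t w)} \<le> f n \<and>
       prob (iid_word n (W x)) {y. \<not> test (\<lambda>t. y t w)} \<le> f n" ..
      show "\<exists>test. \<forall>\<beta>. prob (iid_word n (W (if \<beta> then x else x(v := a)))) {y. test (\<lambda>t. y t w) \<noteq> \<beta>} \<le> f n"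
      proof (intro exI[of _ test] allI)
        fix \<beta>
        show "prob (iid_word n (W (if \<beta> then x else x(v := a)))) {y. test (\<lambda>t. y t w) \<noteq> \<beta>} \<le> f n"
          by (cases \<beta>) (use t in simp_all)
      qed
    qed (use x x' in auto)
    then show ?thesis using f by blast
  qed
qed

lemma bit_channel_mono:
  assumes "bit_channel N X W v w xb f" "\<And>n. f n \<le> g n"
  shows "bit_channel N X W v w xb g"
  unfolding bit_channel_def
proof (intro conjI)
  show "\<forall>n. \<exists>test. \<forall>\<beta>. prob (iid_word n (W (xb \<beta>))) {y. test (\<lambda>t. y t w) \<noteq> \<beta>} \<le> g n"
  proof
    fix n
    from assms(1) obtain test where "\<forall>\<beta>. prob (iid_word n (W (xb \<beta>))) {y. test (\<lambda>t. y t w) \<noteq> \<beta>} \<le> f n"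
      unfolding bit_channel_def by (elim conjE allE[of _ n] exE)
    then show "\<exists>test. \<forall>\<beta>. prob (iid_word n (W (xb \<beta>))) {y. test (\<lambda>t. y t w) \<noteq> \<beta>} \<le> g n"
      using assms(2)[of n] by (intro exI[of _ test] allI) (erule allE, erule order_trans)
  qed
qed (use assms(1) in \<open>auto simp: bit_channel_def\<close>)

lemma bit_channel_nonneg:
  assumes "bit_channel N X W v w xb f"
  shows "f n \<ge> 0"
proof -
  from assms obtain test where "\<forall>\<beta>. prob (iid_word n (W (xb \<beta>))) {y. test (\<lambda>t. y t w) \<noteq> \<beta>} \<le> f n"
    unfolding bit_channel_def by (elim conjE allE[of _ n] exE)
  then have "prob (iid_word n (W (xb True))) {y. test (\<lambda>t. y t w) \<noteq> True} \<le> f n" ..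
  with measure_nonneg show ?thesis by (rule order_trans)
qed

text \<open>The bounds of the single edges are nonnegative, so their sum serves as a common
  one.\<close>

lemma flooding_bit_channels:
  assumes es: "flooding N X W es" and fin: "\<And>x. x \<in> PiE {1..N} X \<Longrightarrow> finite (set_pmf (W x))"
  shows "\<exists>xb f. expsmall f \<and> (\<forall>e<length es. bit_channel N X W (fst (es ! e)) (snd (es ! e)) (xb e) f)"
proof -
  have "\<forall>e. \<exists>z. e < length es \<longrightarrow> expsmall (snd z) \<and> bit_channel N X W (fst (es ! e)) (snd (es ! e)) (fst z) (snd z)"
  proof
    fix e
    show "\<exists>z. e < length es \<longrightarrow> expsmall (snd z) \<and> bit_channel N X W (fst (es ! e)) (snd (es ! e)) (fst z) (snd z)"
    proof (cases "e < length es")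
      case True
      then have "edge N X W (fst (es ! e)) (snd (es ! e))" using flooding_nth(1)[OF es] by simp
      from edge_bit_channel[OF this fin] obtain xb f where
        "expsmall f \<and> bit_channel N X W (fst (es ! e)) (snd (es ! e)) xb f" by blast
      then show ?thesis by (intro exI[of _ "(xb, f)"]) simp
    qed simp
  qed
  from choice[OF this] obtain z where z0: "\<forall>e. e < length es \<longrightarrow> expsmall (snd (z e))
     \<and> bit_channel N X W (fst (es ! e)) (snd (es ! e)) (fst (z e)) (snd (z e))" ..
  define f where "f = (\<lambda>n. \<Sum>e<length es. snd (z e) n)"
  have z: "expsmall (snd (z e))" "bit_channel N X W (fst (es ! e)) (snd (es ! e)) (fst (z e)) (snd (z e))"
    if "e < length es" for e
    using z0 that by auto
  have "snd (z e) n \<le> f n" if "e < length es" for e n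
    unfolding f_def using that bit_channel_nonneg[OF z(2)] by (intro member_le_sum) auto
  then have "bit_channel N X W (fst (es ! e)) (snd (es ! e)) (fst (z e)) f" if "e < length es" for e
    using z(2)[OF that] that by (intro bit_channel_mono[OF z(2)]) auto
  moreover have "expsmall f" unfolding f_def using z(1) by (intro expsmall_sum) auto
  ultimately show ?thesis by (intro exI[of _ "\<lambda>e. fst (z e)"] exI[of _ f]) auto
qed

section \<open>The block Markov protocol\<close>

context relay_letters begin

text \<open>\<open>block_scheme\<close> with its witnesses as parameters and without the condition
  on \<open>sel\<close>, so that the witnesses of all blocks can be chained.\<close>

definition block_stage ::
  "nat \<Rightarrow> 'o pmf \<Rightarrow> ('o \<Rightarrow> nat \<Rightarrow> nat \<times> nat) \<Rightarrow> ('o \<Rightarrow> nat \<Rightarrow> nat \<times> nat) \<Rightarrow>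
   (nat \<Rightarrow> nat \<times> nat \<Rightarrow> nat \<Rightarrow> 'x) \<Rightarrow> (nat \<Rightarrow> nat \<times> nat \<Rightarrow> (nat \<Rightarrow> 'y) \<Rightarrow> nat \<times> nat) \<Rightarrow>
   ('o \<Rightarrow> nat \<Rightarrow> 'x) \<Rightarrow> real \<Rightarrow> bool" where
  "block_stage n \<mu> sel tgt word dec e \<epsilon> \<longleftrightarrow>
     (\<forall>k\<in>{2..N}. \<forall>l. \<forall>t<n. word k l t \<in> X k) \<and> (\<forall>om. \<forall>t<n. e om t \<in> X 1) \<and>
     expect \<mu> (\<lambda>om. prob (Pi_pmf {..<n} undefined
         (\<lambda>t. W (\<lambda>k\<in>{1..N}. if k = 1 then e om t else word k (sel om k) t)))
       {y. \<exists>k\<in>V. dec k (sel om k) (\<lambda>t. y t k) \<noteq> tgt om k}) \<le> \<epsilon>"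

text \<open>The induction runs from the last block to the first: the index selected in one block is the
  target of the block before it.\<close>

lemma block_chain:
  fixes \<mu> :: "'o pmf" and msg :: "nat \<Rightarrow> 'o \<Rightarrow> nat \<Rightarrow> nat"
  assumes scheme: "\<And>tgt msg. (\<forall>om. \<forall>k\<in>V. tgt om k \<in> idx a b k \<and> msg om k < 2 ^ a k) \<Longrightarrow> block_scheme n b \<mu> tgt msg \<epsilon>"
    and msg: "\<And>j om k. k \<in> V \<Longrightarrow> msg j om k < 2 ^ a k"
  shows "\<exists>ix word dec e. (\<forall>j. j \<le> B \<longrightarrow> (\<forall>om. ix j om \<in> PiE V (\<lambda>k. {msg j om k} \<times> {..<(2::nat) ^ b k}))) \<and>
     (\<forall>j<B. block_stage n \<mu> (ix j) (ix (Suc j)) (word j) (dec j) (e j) \<epsilon>)"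
  using msg
proof (induction B arbitrary: msg)
  case 0
  show ?case
    \<comment> \<open>The index after the last block takes part in no covering, so its free part is
      set to 0.\<close>
    by (intro exI[of _ "\<lambda>j om. \<lambda>k\<in>V. (msg 0 om k, 0)"]) auto
next
  case (Suc B)
  \<comment> \<open>The induction hypothesis, applied to the shifted messages, supplies all blocks
    but the first; the new block is then built with the initial index of that chain as its
    target.\<close>
  let ?Q = "\<lambda>ix word dec e. (\<forall>j. j \<le> B \<longrightarrow> (\<forall>om. ix j om \<in> PiE V (\<lambda>k. {msg (Suc j) om k} \<times> {..<(2::nat) ^ b k}))) \<and>
     (\<forall>j<B. block_stage n \<mu> (ix j) (ix (Suc j)) (word j) (dec j) (e j) \<epsilon>)"
  have "\<exists>ix word dec e. ?Q ix word dec e"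
    by (rule Suc.IH) (rule Suc.prems)
  then obtain ix word dec e where chain: "?Q ix word dec e"
    by (elim exE) (rule that)
  have ix: "ix j om \<in> PiE V (\<lambda>k. {msg (Suc j) om k} \<times> {..<(2::nat) ^ b k})" if "j \<le> B" for j om
    using conjunct1[OF chain] that by (elim allE impE) auto
  have st: "block_stage n \<mu> (ix j) (ix (Suc j)) (word j) (dec j) (e j) \<epsilon>" if "j < B" for j
    using conjunct2[OF chain] that by (elim allE impE) auto
  have "\<forall>om. \<forall>k\<in>V. ix 0 om k \<in> idx a b k \<and> msg 0 om k < 2 ^ a k"
  proof (intro allI ballI)
    fix om k assume k: "k \<in> V"
    show "ix 0 om k \<in> idx a b k \<and> msg 0 om k < 2 ^ a k"
      using PiE_mem[OF ix[of 0 om] k] Suc.prems[OF k, of 0 om] Suc.prems[OF k, of 1 om] by (auto simp: idx_def)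
  qed
  from scheme[OF this] have "\<exists>word dec sel e. (\<forall>om. sel om \<in> PiE V (\<lambda>k. {msg 0 om k} \<times> {..<(2::nat) ^ b k})) \<and>
     block_stage n \<mu> sel (ix 0) word dec e \<epsilon>"
    unfolding block_scheme_def block_stage_def
    by (elim exE conjE) (intro exI conjI, assumption+)
  then obtain word0 dec0 sel e0 where s: "(\<forall>om. sel om \<in> PiE V (\<lambda>k. {msg 0 om k} \<times> {..<(2::nat) ^ b k})) \<and>
     block_stage n \<mu> sel (ix 0) word0 dec0 e0 \<epsilon>"
    by (elim exE) (rule that)
  show ?case
  proof (intro exI conjI allI impI)
    fix j om assume "j \<le> Suc B"
    then show "(case_nat sel ix j) om \<in> PiE V (\<lambda>k. {msg j om k} \<times> {..<(2::nat) ^ b k})"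
      using s ix by (cases j) simp_all
  next
    fix j assume "j < Suc B"
    then show "block_stage n \<mu> ((case_nat sel ix) j) ((case_nat sel ix) (Suc j)) ((case_nat word0 word) j)
       ((case_nat dec0 dec) j) ((case_nat e0 e) j) \<epsilon>"
      using s st by (cases j) simp_all
  qed
qed

lemma sum_if_less: "(\<Sum>\<sigma><(S::nat) + B. if \<sigma> < S then F else G) = real S * F + real B * (G::real)"
  by (induction B) (auto simp: algebra_simps)

text \<open>Stage \<open>\<sigma>\<close> below \<open>length es * s\<close> sends bit \<open>\<sigma> mod s\<close> of the initial indices over the edge
  \<open>es ! (\<sigma> div s)\<close>; the later stages are the blocks.\<close>

lemma protocol_code:
  fixes D :: "nat set" and R :: "nat \<Rightarrow> real" and Y :: "nat \<Rightarrow> 'y set"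
  assumes D: "D \<subseteq> V" and n: "n \<ge> 1"
    and es: "flooding N X W es" "V \<subseteq> snd ` set es"
    and bc: "\<And>e. e < length es \<Longrightarrow> bit_channel N X W (fst (es ! e)) (snd (es ! e)) (xb e) f"
    and s: "s \<ge> 1" "(\<Sum>k\<in>V. a k + b k) \<le> s"
    and len: "(length es * s + B) * n \<le> \<nu>"
    and rate: "\<And>k. k \<in> D \<Longrightarrow> nat \<lceil>real \<nu> * R k\<rceil> \<le> B * a k"
    and scheme: "\<And>(\<mu> :: (nat \<Rightarrow> nat) pmf) tgt msg.
      (\<forall>om. \<forall>k\<in>V. tgt om k \<in> idx a b k \<and> msg om k < 2 ^ a k) \<Longrightarrow> block_scheme n b \<mu> tgt msg \<epsilon>"
  shows "\<exists>c. is_code N X Y D R \<nu> c \<and> error_prob N W D R \<nu> c \<le> real (length es * s) * f n + real B * \<epsilon>"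
proof -
  let ?\<mu> = "pmf_of_set (msg_tuples D R \<nu>)"
  have finD: "finite D" using D finV finite_subset by blast
  \<comment> \<open>A message is written as B digits of \<open>a k\<close> bits, one for each of the
    indices 1 to B.\<close>
  have "\<exists>\<psi>. inj_on \<psi> (msg_set \<nu> (R k)) \<and> \<psi> ` msg_set \<nu> (R k) \<subseteq> PiE {1..B} (\<lambda>_. {..<(2::nat) ^ a k})" if "k \<in> D" for k
  proof -
    have "(2::nat) ^ nat \<lceil>real \<nu> * R k\<rceil> \<le> 2 ^ (B * a k)" using rate[OF that] by (intro power_increasing) auto
    moreover have "card (PiE {1..B} (\<lambda>_. {..<(2::nat) ^ a k})) = 2 ^ (B * a k)"
      by (simp add: card_PiE mult.commute[of B] power_mult)
    moreover have "card (msg_set \<nu> (R k)) = 2 ^ nat \<lceil>real \<nu> * R k\<rceil>"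
      unfolding msg_set_def by simp
    ultimately have "card (msg_set \<nu> (R k)) \<le> card (PiE {1..B} (\<lambda>_. {..<(2::nat) ^ a k}))"
      by simp
    moreover have "finite (msg_set \<nu> (R k))" "finite (PiE {1..B} (\<lambda>_. {..<(2::nat) ^ a k}))"
      by (auto simp: msg_set_def intro!: finite_PiE)
    ultimately show ?thesis
      using card_le_inj[of "msg_set \<nu> (R k)" "PiE {1..B} (\<lambda>_. {..<(2::nat) ^ a k})"] by blast
  qed
  then have "\<forall>k. \<exists>\<psi>. k \<in> D \<longrightarrow> inj_on \<psi> (msg_set \<nu> (R k)) \<and> \<psi> ` msg_set \<nu> (R k) \<subseteq> PiE {1..B} (\<lambda>_. {..<(2::nat) ^ a k})"
    by blast
  from choice[OF this] obtain \<psi> where \<psi>: "\<And>k. k \<in> D \<Longrightarrow> inj_on (\<psi> k) (msg_set \<nu> (R k))"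
    "\<And>k. k \<in> D \<Longrightarrow> \<psi> k ` msg_set \<nu> (R k) \<subseteq> PiE {1..B} (\<lambda>_. {..<(2::nat) ^ a k})"
    by blast
  \<comment> \<open>Index 0 is delivered by flooding and carries no message, and neither do the
    indices of nodes outside \<open>D\<close>; their message part is 0.\<close>
  define msg where "msg = (\<lambda>j (m :: nat \<Rightarrow> nat) k. if k \<in> D \<and> m k \<in> msg_set \<nu> (R k) \<and> j \<in> {1..B} then \<psi> k (m k) j else 0)"
  have msg: "msg j m k < 2 ^ a k" for j m k
  proof (cases "k \<in> D \<and> m k \<in> msg_set \<nu> (R k) \<and> j \<in> {1..B}")
    case True
    have "\<psi> k (m k) \<in> PiE {1..B} (\<lambda>_. {..<(2::nat) ^ a k})"
      by (rule subsetD[OF \<psi>(2) imageI]) (use True in auto)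
    from PiE_mem[OF this, of j] have "\<psi> k (m k) j < 2 ^ a k" using True by simp
    then show ?thesis using True by (simp add: msg_def)
  next
    case False
    then show ?thesis unfolding msg_def if_not_P[OF False] by simp
  qed
  let ?Q = "\<lambda>ix word dec ee. (\<forall>j. j \<le> B \<longrightarrow> (\<forall>m. ix j m \<in> PiE V (\<lambda>k. {msg j m k} \<times> {..<(2::nat) ^ b k}))) \<and>
     (\<forall>j<B. block_stage n ?\<mu> (ix j) (ix (Suc j)) (word j) (dec j) (ee j) \<epsilon>)"
  have "\<exists>ix word dec ee. ?Q ix word dec ee"
    by (rule block_chain, rule scheme, assumption, rule msg)
  then obtain ix word dec ee where chain: "?Q ix word dec ee"
    by (elim exE) (rule that)
  have ix: "ix j m \<in> PiE V (\<lambda>k. {msg j m k} \<times> {..<(2::nat) ^ b k})" if "j \<le> B" for j m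
    using conjunct1[OF chain] that by (elim allE impE) auto
  have stage: "block_stage n ?\<mu> (ix j) (ix (Suc j)) (word j) (dec j) (ee j) \<epsilon>" if "j < B" for j
    using conjunct2[OF chain] that by (elim allE impE) auto
  have wordX: "word j k l t \<in> X k" if "j < B" "k \<in> {2..N}" "t < n" for j k l t
    using stage[OF that(1), unfolded block_stage_def, THEN conjunct1, THEN bspec, OF that(2), THEN spec, of l] that(3)
    by simp
  have eeX: "ee j m t \<in> X 1" if "j < B" "t < n" for j m t
    using stage[OF that(1), unfolded block_stage_def, THEN conjunct2, THEN conjunct1, THEN spec, of m] that(2)
    by simp
  define A where "A = PiE V (idx a b)"
  have ix0: "ix 0 m \<in> A" for m
    using ix[of 0 m] msg[of 0 m] unfolding A_def idx_def
    by (auto simp: PiE_iff)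
  \<comment> \<open>The whole tuple of initial indices is packed into \<open>s\<close> bits; each
    node of \<open>V\<close> receives all of them and reads off its own component.\<close>
  have "\<exists>\<phi>. \<phi> ` A \<subseteq> PiE {..<s} (\<lambda>_. UNIV :: bool set) \<and> inj_on \<phi> A"
  proof (rule card_le_inj)
    show "finite A" unfolding A_def idx_def using finV by (intro finite_PiE) auto
    show "finite (PiE {..<s} (\<lambda>_. UNIV :: bool set))" by (intro finite_PiE) auto
    have "card A = (\<Prod>k\<in>V. 2 ^ (a k + b k))"
      unfolding A_def using finV by (simp add: card_PiE idx_def card_cartesian_product power_add)
    also have "\<dots> = 2 ^ (\<Sum>k\<in>V. a k + b k)" by (rule power_sum[symmetric])
    also have "\<dots> \<le> 2 ^ s" using s(2) by (intro power_increasing) auto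
    also have "\<dots> = card (PiE {..<s} (\<lambda>_. UNIV :: bool set))" by (simp add: card_PiE)
    finally show "card A \<le> card (PiE {..<s} (\<lambda>_. UNIV :: bool set))" .
  qed
  then obtain \<phi> where \<phi>: "\<phi> ` A \<subseteq> PiE {..<s} (\<lambda>_. UNIV :: bool set)" "inj_on \<phi> A" by blast
  define bt where "bt = (\<lambda>m. \<phi> (ix 0 m))"
  have bt: "(\<lambda>i\<in>{..<s}. bt m i) = bt m" for m
    using \<phi>(1) ix0[of m] unfolding bt_def by (intro extensional_restrict) (auto simp: PiE_def)
  define r0 where "r0 = length es"
  define S0 where "S0 = r0 * s"
  define K where "K = S0 + B"
  have "\<forall>e. \<exists>test. e < r0 \<longrightarrow> (\<forall>\<beta>. prob (iid_word n (W (xb e \<beta>))) {y. test (\<lambda>t. y t (snd (es ! e))) \<noteq> \<beta>} \<le> f n)"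
  proof
    fix e
    show "\<exists>test. e < r0 \<longrightarrow> (\<forall>\<beta>. prob (iid_word n (W (xb e \<beta>))) {y. test (\<lambda>t. y t (snd (es ! e))) \<noteq> \<beta>} \<le> f n)"
    proof (cases "e < r0")
      case True
      from bc[OF this[unfolded r0_def], unfolded bit_channel_def, THEN conjunct2, THEN conjunct2, THEN spec, of n]
      show ?thesis by (elim exE) (rule exI, rule impI)
    qed simp
  qed
  from choice[OF this] obtain tst where "\<forall>e. e < r0 \<longrightarrow> (\<forall>\<beta>.
     prob (iid_word n (W (xb e \<beta>))) {y. tst e (\<lambda>t. y t (snd (es ! e))) \<noteq> \<beta>} \<le> f n)" ..
  then have tst: "prob (iid_word n (W (xb e \<beta>))) {y. tst e (\<lambda>t. y t (snd (es ! e))) \<noteq> \<beta>} \<le> f n"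
    if "e < r0" for e \<beta>
    using that by (elim allE impE)
  have xb: "xb e \<beta> \<in> PiE {1..N} X" if "e < r0" for e \<beta>
    using bc[OF that[unfolded r0_def], unfolded bit_channel_def, THEN conjunct1, THEN spec] .
  have xb': "xb e True k = xb e False k" if "e < r0" "k \<noteq> fst (es ! e)" for e k
    using bc[OF that(1)[unfolded r0_def], unfolded bit_channel_def, THEN conjunct2, THEN conjunct1, rule_format, OF that(2)] .
  \<comment> \<open>\<open>es\<close> may contain several edges into k. The bits are read off the
    first of them, which precedes every stage in which k has to forward bits.\<close>
  define first where "first = (\<lambda>k. LEAST e. e < r0 \<and> snd (es ! e) = k)"
  define known where "known = (\<lambda>k (\<kappa> :: (nat \<times> nat) list) i. fst (\<kappa> ! (first k * s + i)) = 1)"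
  \<comment> \<open>For j > 0, index j was decoded in block j - 1 and is entry
    \<open>S0 + j - 1\<close> of the state. The value \<open>undefined\<close> outside
    \<open>V\<close> matches the selections, which lie in a \<open>PiE V\<close>.\<close>
  define cur where "cur = (\<lambda>k \<kappa> j. if k \<in> V then if j = 0 then inv_into A \<phi> (\<lambda>i\<in>{..<s}. known k \<kappa> i) k
     else \<kappa> ! (S0 + j - 1) else undefined)"
  define E where "E = (\<lambda>\<sigma> k \<kappa> t. if \<sigma> < S0 then
       if k = fst (es ! (\<sigma> div s)) then xb (\<sigma> div s) (known k \<kappa> (\<sigma> mod s)) k else xb (\<sigma> div s) False k
     else word (\<sigma> - S0) k (cur k \<kappa> (\<sigma> - S0)) t)"
  \<comment> \<open>On an edge that does not start at node 1 the source sends the component of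
    \<open>xb\<close> for \<open>False\<close>, like any other bystander.\<close>
  define S where "S = (\<lambda>\<sigma> m t. if \<sigma> < S0 then
       xb (\<sigma> div s) (fst (es ! (\<sigma> div s)) = 1 \<and> bt m (\<sigma> mod s)) 1 else ee (\<sigma> - S0) m t)"
  \<comment> \<open>Nodes that have nothing to decode record \<open>(0, 0)\<close>, which is also
    their intended symbol, so they never err.\<close>
  define Dd where "Dd = (\<lambda>\<sigma> k \<kappa> y. if \<sigma> < S0 then
       if k = snd (es ! (\<sigma> div s)) then (of_bool (tst (\<sigma> div s) y), 0) else (0, 0)
     else if k \<in> V then dec (\<sigma> - S0) k (cur k \<kappa> (\<sigma> - S0)) y else (0, 0))"
  define d where "d = (\<lambda>\<sigma> k m. if \<sigma> < S0 then
       if k = snd (es ! (\<sigma> div s)) then (of_bool (bt m (\<sigma> mod s)), 0) else (0, 0)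
     else if k \<in> V then ix (Suc (\<sigma> - S0)) m k else (0::nat, 0::nat))"
  define fin where "fin = (\<lambda>k (\<kappa> :: (nat \<times> nat) list). inv_into (msg_set \<nu> (R k)) (\<psi> k) (\<lambda>j\<in>{1..B}. fst (\<kappa> ! (S0 + j - 1))))"
  define \<kappa> where "\<kappa> = (\<lambda>\<sigma> k m. map (\<lambda>\<sigma>'. d \<sigma>' k m) [0..<\<sigma>])"
  have \<kappa>nth: "\<kappa> \<sigma> k m ! p = d p k m" if "p < \<sigma>" for \<sigma> k m p
    using that by (simp add: \<kappa>_def)
  have slot: "\<sigma> div s < r0" "\<sigma> mod s < s" if "\<sigma> < S0" for \<sigma>
    using that s(1) by (auto simp: S0_def div_less_iff_less_mult)
  have first: "first k < r0 \<and> snd (es ! first k) = k" "first k \<le> e" if "e < r0" "snd (es ! e) = k" for e k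
  proof -
    show "first k < r0 \<and> snd (es ! first k) = k"
      unfolding first_def by (rule LeastI[of _ e]) (use that in simp)
    show "first k \<le> e"
      unfolding first_def by (rule Least_le) (use that in simp)
  qed
  have known: "known k (\<kappa> \<sigma> k m) i = bt m i"
    if "e < r0" "snd (es ! e) = k" "e * s + s \<le> \<sigma>" "i < s" for e k \<sigma> m i
  proof -
    have "first k * s + s \<le> e * s + s" using first(2)[OF that(1,2)] by simp
    then have p: "first k * s + i < \<sigma>" using that(3,4) by linarith
    have "Suc (first k) * s \<le> r0 * s" using first(1)[OF that(1,2)] by (intro mult_right_mono) simp_all
    then have p': "first k * s + i < S0" using that(4) unfolding S0_def by simp
    have "(first k * s + i) div s = first k" "(first k * s + i) mod s = i" using that(4) by auto
    then show ?thesis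
      using \<kappa>nth[OF p] p' first(1)[OF that(1,2)] by (simp add: known_def d_def)
  qed
  have cur: "cur k (\<kappa> (S0 + j) k m) j = ix j m k" if "j < B" for k j m
  proof (cases "k \<in> V")
    case False
    have "ix j m \<in> extensional V" using ix[of j m] that by (auto simp: PiE_def)
    then show ?thesis using False by (simp add: cur_def extensional_def)
  next
    case True
    show ?thesis
    proof (cases "j = 0")
      case False
      then obtain p where p: "j = Suc p" by (cases j) auto
      have "\<kappa> (S0 + j) k m ! (S0 + p) = ix j m k"
        using \<kappa>nth[of "S0 + p" "S0 + j" k m] True p by (simp add: d_def)
      then show ?thesis using True p by (simp add: cur_def)
    next
      case j: True
      obtain e where e: "e < r0" "snd (es ! e) = k"
        using True es(2) by (force simp: in_set_conv_nth r0_def subset_eq image_iff)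
      have "Suc e * s \<le> r0 * s" using e by (intro mult_right_mono) auto
      then have "e * s + s \<le> S0" by (simp add: S0_def)
      then have "(\<lambda>i\<in>{..<s}. known k (\<kappa> (S0 + j) k m) i) = bt m"
        using known[OF e] j by (subst bt[symmetric]) (intro restrict_ext, auto)
      then have "cur k (\<kappa> (S0 + j) k m) j = inv_into A \<phi> (\<phi> (ix 0 m)) k"
        using True j by (simp add: cur_def bt_def)
      then show ?thesis using \<phi>(2) ix0[of m] j by simp
    qed
  qed
  define inp where "inp = (\<lambda>\<sigma> m t. \<lambda>k\<in>{1..N}. if k = 1 then S \<sigma> m t else E \<sigma> k (\<kappa> \<sigma> k m) t)"
  define pe where "pe = (\<lambda>\<sigma>. expect ?\<mu> (\<lambda>m.
        prob (Pi_pmf {..<n} undefined (\<lambda>t. W (inp \<sigma> m t)))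
          {y. \<exists>k\<in>{2..N}. Dd \<sigma> k (\<kappa> \<sigma> k m) (\<lambda>t. y t k) \<noteq> d \<sigma> k m}))"
  have D2: "D \<subseteq> {2..N}" using D V by blast
  obtain l0 where l0: "l0 \<in> set_pmf P" using set_pmf_not_empty[of P] by blast
  have "\<exists>c. is_code N X Y D R \<nu> c \<and> error_prob N W D R \<nu> c \<le> (\<Sum>\<sigma><K. pe \<sigma>)"
    unfolding pe_def inp_def \<kappa>_def
  proof (rule staged_code[where ?x0.0 = "\<lambda>k. xs k l0" and ?fin = fin])
    show "K * n \<le> \<nu>" using len by (simp add: K_def S0_def r0_def)
    show "E \<sigma> k \<kappa> t \<in> X k" if "\<sigma> < K" "k \<in> {2..N}" "t < n" for \<sigma> k \<kappa> t
    proof (cases "\<sigma> < S0")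
      case True
      have k: "k \<in> {1..N}" using that by auto
      have "xb (\<sigma> div s) \<beta> k \<in> X k" for \<beta> by (rule PiE_mem[OF xb[OF slot(1)[OF True]] k])
      then show ?thesis using True by (auto simp: E_def)
    next
      case False
      then have "\<sigma> - S0 < B" using that by (simp add: K_def)
      then show ?thesis using that False wordX by (simp add: E_def)
    qed
    show "S \<sigma> m t \<in> X 1" if "\<sigma> < K" "t < n" for \<sigma> m t
    proof (cases "\<sigma> < S0")
      case True
      have k: "1 \<in> {1..N}" using N by auto
      have "xb (\<sigma> div s) \<beta> 1 \<in> X 1" for \<beta> by (rule PiE_mem[OF xb[OF slot(1)[OF True]] k])
      then show ?thesis using True by (simp add: S_def)
    next
      case False
      then have "\<sigma> - S0 < B" using that by (simp add: K_def)
      then show ?thesis using that False eeX by (simp add: S_def)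
    qed
    show "fin k (map (\<lambda>\<sigma>. d \<sigma> k m) [0..<K]) = m k" if k: "k \<in> D" and m: "m \<in> msg_tuples D R \<nu>" for k m
    proof -
      have mk: "m k \<in> msg_set \<nu> (R k)" using k m by (auto simp: msg_tuples_def)
      have "fst (map (\<lambda>\<sigma>. d \<sigma> k m) [0..<K] ! (S0 + j - 1)) = \<psi> k (m k) j" if j: "j \<in> {1..B}" for j
      proof -
        have kV: "k \<in> V" using k D by auto
        have "S0 + j - 1 < K" "\<not> S0 + j - 1 < S0" "Suc (S0 + j - 1 - S0) = j" using j by (auto simp: K_def)
        then have "map (\<lambda>\<sigma>. d \<sigma> k m) [0..<K] ! (S0 + j - 1) = ix j m k"
          using kV by (simp add: d_def)
        moreover have "ix j m k \<in> {msg j m k} \<times> {..<(2::nat) ^ b k}" using j by (intro PiE_mem[OF ix]) (auto simp: kV)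
        ultimately show ?thesis using mk k j by (auto simp: msg_def)
      qed
      then have "(\<lambda>j\<in>{1..B}. fst (map (\<lambda>\<sigma>. d \<sigma> k m) [0..<K] ! (S0 + j - 1))) = (\<lambda>j\<in>{1..B}. \<psi> k (m k) j)"
        by (intro restrict_ext) auto
      also have "\<dots> = \<psi> k (m k)"
        using \<psi>(2)[OF k] mk by (intro extensional_restrict) (auto simp: PiE_def)
      finally show ?thesis
        unfolding fin_def using \<psi>(1)[OF k] mk by simp
    qed
  qed (use n N D2 xs[OF _ l0] in auto)
  moreover have "(\<Sum>\<sigma><K. pe \<sigma>) \<le> real S0 * f n + real B * \<epsilon>"
  proof -
    have "pe \<sigma> \<le> (if \<sigma> < S0 then f n else \<epsilon>)" if \<sigma>: "\<sigma> < K" for \<sigma>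
    proof (cases "\<sigma> < S0")
      case True
      define e where "e = \<sigma> div s"
      define i where "i = \<sigma> mod s"
      have ei: "e < r0" "i < s" "\<sigma> = e * s + i" using slot[OF True] by (auto simp: e_def i_def)
      \<comment> \<open>With the intended states the stage repeats the single vector
        \<open>xb e (bt m i)\<close>: the sender knows the bit, being the source or a node served by
        an earlier edge, and the other components do not depend on the bit.\<close>
      have inp: "inp \<sigma> m t = xb e (bt m i)" for m t
      proof (rule ext)
        fix k
        show "inp \<sigma> m t k = xb e (bt m i) k"
        proof (cases "k \<in> {1..N}")
          case False
          have "xb e (bt m i) \<in> extensional {1..N}" using xb[OF ei(1)] by (auto simp: PiE_def)
          then show ?thesis using False by (auto simp: inp_def extensional_def)
        next
          case k: True
          have eq: "xb e \<beta> k = xb e \<beta>' k" if "k \<noteq> fst (es ! e)" for \<beta> \<beta>'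
            using xb'[OF ei(1) that] by (cases \<beta>; cases \<beta>') auto
          show ?thesis
          proof (cases "k = 1")
            case True
            then show ?thesis using k \<open>\<sigma> < S0\<close> eq[of "bt m i" False]
              by (cases "fst (es ! e) = 1") (auto simp: inp_def S_def e_def[symmetric] i_def[symmetric])
          next
            case k1: False
            show ?thesis
            proof (cases "k = fst (es ! e)")
              case False
              then show ?thesis using k k1 \<open>\<sigma> < S0\<close> eq[OF False, of "bt m i" False]
                by (simp add: inp_def E_def e_def[symmetric])
            next
              case kv: True
              then obtain e' where e': "e' < e" "snd (es ! e') = k"
                using flooding_nth(2)[OF es(1), of e] ei(1) k1 by (auto simp: r0_def)
              have "Suc e' * s \<le> e * s" using e' by (intro mult_right_mono) auto
              then have "known k (\<kappa> \<sigma> k m) i = bt m i"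
                using ei e' by (intro known[of e']) auto
              then show ?thesis using k k1 kv \<open>\<sigma> < S0\<close>
                by (simp add: inp_def E_def e_def[symmetric] i_def[symmetric])
            qed
          qed
        qed
      qed
      have "prob (Pi_pmf {..<n} undefined (\<lambda>t. W (inp \<sigma> m t)))
          {y. \<exists>k\<in>{2..N}. Dd \<sigma> k (\<kappa> \<sigma> k m) (\<lambda>t. y t k) \<noteq> d \<sigma> k m} \<le> f n" for m
      proof -
        have "prob (Pi_pmf {..<n} undefined (\<lambda>t. W (inp \<sigma> m t)))
          {y. \<exists>k\<in>{2..N}. Dd \<sigma> k (\<kappa> \<sigma> k m) (\<lambda>t. y t k) \<noteq> d \<sigma> k m}
         \<le> prob (iid_word n (W (xb e (bt m i)))) {y. tst e (\<lambda>t. y t (snd (es ! e))) \<noteq> bt m i}"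
          unfolding inp using True
          by (intro measure_pmf.finite_measure_mono) (auto simp: Dd_def d_def e_def[symmetric] i_def[symmetric] split: if_splits)
        also have "\<dots> \<le> f n" by (rule tst[OF ei(1)])
        finally show ?thesis .
      qed
      then have "pe \<sigma> \<le> expect ?\<mu> (\<lambda>_. f n)"
        unfolding pe_def by (intro integral_mono measure_pmf.integrable_const_bound[where B = "max 1 \<bar>f n\<bar>"]) (auto simp: le_max_iff_disj)
      then show ?thesis using True by simp
    next
      case False
      define j where "j = \<sigma> - S0"
      have j: "j < B" "\<sigma> = S0 + j" using False \<sigma> by (auto simp: j_def K_def)
      \<comment> \<open>\<open>cur\<close> recovers the selected indices, so this stage is literally
        block j of the chain.\<close>
      have inp: "inp \<sigma> m t = (\<lambda>k\<in>{1..N}. if k = 1 then ee j m t else word j k (ix j m k) t)" for m t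
        unfolding inp_def by (intro restrict_ext) (simp add: S_def E_def j(2) cur[OF j(1)])
      have "{y. \<exists>k\<in>{2..N}. Dd \<sigma> k (\<kappa> \<sigma> k m) (\<lambda>t. y t k) \<noteq> d \<sigma> k m}
         = {y. \<exists>k\<in>V. dec j k (ix j m k) (\<lambda>t. y t k) \<noteq> ix (Suc j) m k}" for m
        using V by (auto simp: Dd_def d_def j(2) cur[OF j(1)])
      then have "pe \<sigma> \<le> \<epsilon>"
        using stage[OF j(1), unfolded block_stage_def, THEN conjunct2, THEN conjunct2] unfolding pe_def inp by simp
      then show ?thesis using False by simp
    qed
    then have "(\<Sum>\<sigma><K. pe \<sigma>) \<le> (\<Sum>\<sigma><K. if \<sigma> < S0 then f n else \<epsilon>)" by (intro sum_mono) auto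
    then show ?thesis unfolding K_def sum_if_less .
  qed
  ultimately show ?thesis
    unfolding S0_def r0_def by (meson order_trans)
qed

end

section \<open>Splitting the rates into message part and covering part\<close>

context relay_letters begin

text \<open>A single pair is its own marginal. Through the covering condition for \<open>{k}\<close>
  this makes \<open>r k\<close> positive in the rate split.\<close>

lemma tcorr_singleton: "tcorr {k} = 0"
proof -
  have "dT {k} l = 0" if l: "l \<in> set_pmf P" for l
  proof -
    have "pT {k} (qs l, \<lambda>i\<in>{k}. (xs i l, us i l)) = pV k (qs l, xs k l, us k l)"
      unfolding pT_def pV_def pmf_map
      by (intro arg_cong[where f = "prob P"]) (auto simp: fun_eq_iff restrict_def split: if_splits)
    moreover have "pV k (qs l, xs k l, us k l) > 0" "pQ (qs l) > 0"
      using pmf_map_pos[OF l, of "\<lambda>l. (qs l, xs k l, us k l)"] pmf_map_pos[OF l, of qs] by (simp_all add: pV_def pQ_def)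
    ultimately show ?thesis by (simp add: dT_def)
  qed
  then have "tcorr {k} = expect P (\<lambda>_. 0)"
    unfolding tcorr_def by (intro integral_cong_AE) (auto simp: AE_measure_pmf_iff)
  then show ?thesis by simp
qed

text \<open>Elimination of the covering rates: \<open>r k\<close> is taken almost as large as
  detection permits, \<open>minfo k - m k\<close> less a small \<open>\<gamma>\<close>, and the
  covering condition turns into the assumed rate constraint up to multiples of
  \<open>\<gamma>\<close>.\<close>

lemma split_rates:
  assumes D: "D \<subseteq> V" and R: "\<And>k. k \<in> D \<Longrightarrow> R k \<ge> (0::real)"
    and rates: "\<And>T. T \<subseteq> V \<Longrightarrow> T \<noteq> {} \<Longrightarrow> (\<Sum>k\<in>T \<inter> D. R k) < (\<Sum>k\<in>T. minfo k) - tcorr T"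
  obtains m r where "\<And>k. k \<in> V \<Longrightarrow> m k \<ge> (0::real)" "\<And>k. k \<in> V \<Longrightarrow> r k \<ge> 0" "\<And>k. k \<in> D \<Longrightarrow> R k < m k"
    "\<And>k. k \<in> V \<Longrightarrow> m k + r k < minfo k" "\<And>T. T \<subseteq> V \<Longrightarrow> T \<noteq> {} \<Longrightarrow> tcorr T < (\<Sum>k\<in>T. r k)"
proof -
  define gap where "gap = (\<lambda>T. (\<Sum>k\<in>T. minfo k) - tcorr T - (\<Sum>k\<in>T \<inter> D. R k))"
  \<comment> \<open>The inserted 1 keeps the minimum well defined and positive if \<open>V\<close>
    is empty.\<close>
  define g where "g = Min (insert 1 (gap ` (Pow V - {{}})))"
  have fin: "finite (insert 1 (gap ` (Pow V - {{}})))" using finV by simp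
  have g0: "g > 0"
    unfolding g_def using fin rates by (subst Min_gr_iff) (auto simp: gap_def)
  have gle: "g \<le> gap T" if "T \<subseteq> V" "T \<noteq> {}" for T
    unfolding g_def using fin that by (intro Min_le) auto
  \<comment> \<open>Raising the message rates and lowering the covering rates costs at most
    \<open>card V * \<gamma>\<close> each, and twice this stays below \<open>g\<close>.\<close>
  define \<gamma> where "\<gamma> = g / (4 * (real (card V) + 1))"
  have \<gamma>0: "\<gamma> > 0" using g0 by (simp add: \<gamma>_def)
  define m where "m = (\<lambda>k. if k \<in> D then R k + \<gamma> else 0)"
  define r where "r = (\<lambda>k. minfo k - m k - \<gamma>)"
  have cov: "tcorr T < (\<Sum>k\<in>T. r k)" if T: "T \<subseteq> V" "T \<noteq> {}" for T
  proof -
    have fT: "finite T" using T finV finite_subset by blast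
    have "(\<Sum>k\<in>T. m k) = (\<Sum>k\<in>T \<inter> D. R k + \<gamma>)"
      unfolding m_def using fT by (simp add: sum.inter_restrict)
    also have "\<dots> = (\<Sum>k\<in>T \<inter> D. R k) + real (card (T \<inter> D)) * \<gamma>" by (simp add: sum.distrib)
    also have "real (card (T \<inter> D)) * \<gamma> \<le> real (card V) * \<gamma>"
      using \<gamma>0 finV T by (intro mult_right_mono) (auto intro!: card_mono)
    finally have 1: "(\<Sum>k\<in>T. m k) \<le> (\<Sum>k\<in>T \<inter> D. R k) + real (card V) * \<gamma>" by simp
    have 2: "real (card T) * \<gamma> \<le> real (card V) * \<gamma>"
      using \<gamma>0 finV T by (intro mult_right_mono) (auto intro!: card_mono)
    have "2 * (real (card V) * \<gamma>) < g"
      using g0 by (simp add: \<gamma>_def field_simps add_pos_nonneg)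
    moreover have "(\<Sum>k\<in>T. r k) = (\<Sum>k\<in>T. minfo k) - (\<Sum>k\<in>T. m k) - real (card T) * \<gamma>"
      by (simp add: r_def sum_subtractf)
    ultimately show ?thesis using 1 2 gle[OF T] unfolding gap_def by linarith
  qed
  show thesis
  proof (rule that)
    show "m k \<ge> 0" for k using R \<gamma>0 by (auto simp: m_def intro!: add_nonneg_nonneg less_imp_le)
    show "r k \<ge> 0" if "k \<in> V" for k using cov[of "{k}"] that by (simp add: tcorr_singleton)
    show "R k < m k" if "k \<in> D" for k using that \<gamma>0 by (simp add: m_def)
    show "m k + r k < minfo k" for k using \<gamma>0 by (simp add: r_def)
  qed (rule cov)
qed

end

text \<open>Blocks of this length make the start-up phase, of order \<open>\<nu> powr (2 / 3)\<close>, negligible.\<close>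

definition cube_root :: "nat \<Rightarrow> nat" where "cube_root \<nu> = nat \<lfloor>real \<nu> powr (1 / 3)\<rfloor>"

lemma cube_root_bounds: "real (cube_root \<nu>) \<le> real \<nu> powr (1 / 3)" "real \<nu> powr (1 / 3) - 1 \<le> real (cube_root \<nu>)"
  unfolding cube_root_def by (auto simp: of_nat_floor)

text \<open>The factor \<open>\<nu>\<close> pays for the stages, of which there are at most
  \<open>\<nu>\<close>. The bound \<open>g\<close> is nonnegative so that it can be multiplied by
  the actual number of stages and then enlarged.\<close>

lemma expsmall_cube_root:
  assumes "expsmall f"
  shows "\<exists>g. (\<lambda>\<nu>. real \<nu> * g \<nu>) \<longlonglongrightarrow> 0 \<and> (\<forall>\<nu>. 0 \<le> g \<nu> \<and> f (cube_root \<nu>) \<le> g \<nu>)"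
proof -
  obtain C c where c: "c > 0" "\<And>n. f n \<le> C * exp (- c * real n)"
    using assms unfolding expsmall_def by blast
  define g where "g = (\<lambda>\<nu>. \<bar>C\<bar> * exp (- c * (real \<nu> powr (1 / 3) - 1)))"
  have "(\<lambda>\<nu>. real \<nu> * (\<bar>C\<bar> * exp (- c * (real \<nu> powr (1 / 3) - 1)))) \<longlonglongrightarrow> 0"
  proof -
    have "(\<lambda>\<nu>. real \<nu> * exp (- c * (real \<nu> powr (1 / 3) - 1))) \<longlonglongrightarrow> 0"
      using c(1) by real_asymp
    then have "(\<lambda>\<nu>. \<bar>C\<bar> * (real \<nu> * exp (- c * (real \<nu> powr (1 / 3) - 1)))) \<longlonglongrightarrow> \<bar>C\<bar> * 0"
      by (intro tendsto_mult tendsto_const)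
    then show ?thesis by (simp add: mult_ac)
  qed
  moreover have "f (cube_root \<nu>) \<le> g \<nu>" for \<nu>
  proof -
    have "f (cube_root \<nu>) \<le> C * exp (- c * real (cube_root \<nu>))" by (rule c(2))
    also have "\<dots> \<le> \<bar>C\<bar> * exp (- c * real (cube_root \<nu>))" by (intro mult_right_mono) auto
    also have "\<dots> \<le> g \<nu>"
      unfolding g_def using c(1) cube_root_bounds(2)[of \<nu>] by (intro mult_left_mono) auto
    finally show ?thesis .
  qed
  ultimately show ?thesis
    by (intro exI[of _ g] conjI allI) (auto simp: g_def)
qed

text \<open>With n the block length, \<open>r\<close> is the number of edges and
  \<open>C1 * n + C2\<close> bounds the bits sent over each. The last inequality starts from at
  least \<open>\<nu> / n - 1\<close> stages, removes those of the start-up, and lets every remaining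
  block carry at least \<open>n * m - 1\<close> message bits; the added 1 pays for rounding up
  \<open>\<nu> * R\<close>.\<close>

lemma cube_root_budget:
  fixes C1 C2 r m :: real
  assumes nn: "C1 \<ge> 0" "C2 \<ge> 0" "r \<ge> 0" "m \<ge> 0" and R: "R < m"
  shows "eventually (\<lambda>\<nu>. 1 \<le> cube_root \<nu> \<and> real (cube_root \<nu>) * (r * (C1 * real (cube_root \<nu>) + C2) + 1) \<le> real \<nu> \<and>
     real \<nu> * R + 1 \<le> (real \<nu> / real (cube_root \<nu>) - 1 - r * (C1 * real (cube_root \<nu>) + C2)) * (real (cube_root \<nu>) * m - 1)) sequentially"
proof -
  define t where "t = (\<lambda>\<nu>::nat. real \<nu> powr (1 / 3))"
  have "(\<lambda>\<nu>. (t \<nu> * (r * (C1 * t \<nu> + C2) + 1)) / real \<nu>) \<longlonglongrightarrow> 0"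
    unfolding t_def by real_asymp
  then have e1: "eventually (\<lambda>\<nu>. (t \<nu> * (r * (C1 * t \<nu> + C2) + 1)) / real \<nu> < 1) sequentially"
    by (rule order_tendstoD) simp
  \<comment> \<open>The numerator collects the losses against \<open>\<nu> * m\<close>: one bit of
    rounding per block, the lost stages, and the final rounding.\<close>
  have "(\<lambda>\<nu>. (real \<nu> / (t \<nu> - 1) + (1 + r * (C1 * t \<nu> + C2)) * (t \<nu> * m) + 1) / real \<nu>) \<longlonglongrightarrow> 0"
    unfolding t_def by real_asymp
  then have e2: "eventually (\<lambda>\<nu>. (real \<nu> / (t \<nu> - 1) + (1 + r * (C1 * t \<nu> + C2)) * (t \<nu> * m) + 1) / real \<nu> < m - R) sequentially"
    by (rule order_tendstoD) (use R in simp)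
  have e3: "eventually (\<lambda>\<nu>. t \<nu> > 2) sequentially"
    unfolding t_def by real_asymp
  show ?thesis
    using e1 e2 e3 eventually_gt_at_top[of 0]
  proof eventually_elim
    case (elim \<nu>)
    define n where "n = real (cube_root \<nu>)"
    have n: "n \<le> t \<nu>" "t \<nu> - 1 \<le> n" using cube_root_bounds[of \<nu>] by (auto simp: n_def t_def)
    have n1: "n > 1" using n elim by linarith
    have c1: "1 \<le> cube_root \<nu>" using n1 by (simp add: n_def)
    have "n * (r * (C1 * n + C2) + 1) \<le> t \<nu> * (r * (C1 * t \<nu> + C2) + 1)"
      using n n1 nn by (intro mult_mono add_mono mult_left_mono order_refl) auto
    also have "\<dots> \<le> real \<nu>" using elim by (simp add: field_simps)
    finally have c2: "n * (r * (C1 * n + C2) + 1) \<le> real \<nu>" .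
    have "real \<nu> / n \<le> real \<nu> / (t \<nu> - 1)" using n elim by (intro divide_left_mono mult_pos_pos) auto
    moreover have "(1 + r * (C1 * n + C2)) * (n * m) \<le> (1 + r * (C1 * t \<nu> + C2)) * (t \<nu> * m)"
      using n n1 nn by (intro mult_mono add_mono mult_left_mono mult_right_mono order_refl) auto
    moreover have "real \<nu> / (t \<nu> - 1) + (1 + r * (C1 * t \<nu> + C2)) * (t \<nu> * m) + 1 \<le> real \<nu> * (m - R)"
      using elim by (simp add: pos_divide_less_eq mult.commute)
    ultimately have le: "real \<nu> / n + (1 + r * (C1 * n + C2)) * (n * m) + 1 \<le> real \<nu> * (m - R)" by linarith
    have "(real \<nu> / n - 1 - r * (C1 * n + C2)) * (n * m - 1)
      = real \<nu> * m - real \<nu> / n - (1 + r * (C1 * n + C2)) * (n * m) + (1 + r * (C1 * n + C2))"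
      using n1 by (simp add: field_simps)
    moreover have "1 + r * (C1 * n + C2) \<ge> 0" using n1 nn by auto
    ultimately have "real \<nu> * R + 1 \<le> (real \<nu> / n - 1 - r * (C1 * n + C2)) * (n * m - 1)"
      using le by (simp add: right_diff_distrib)
    then show ?case using c1 c2 by (simp add: n_def)
  qed
qed

section \<open>Assembling codes of every length\<close>

context relay_letters begin

lemma achievable_if_reachable:
  fixes D :: "nat set" and R :: "nat \<Rightarrow> real" and Y :: "nat \<Rightarrow> 'y set"
  assumes D: "D \<subseteq> V" and R: "\<And>k. k \<in> D \<Longrightarrow> R k \<ge> 0"
    and reach: "\<And>k. k \<in> V \<Longrightarrow> reachable N X W k"
    and rates: "\<And>T. T \<subseteq> V \<Longrightarrow> T \<noteq> {} \<Longrightarrow> (\<Sum>k\<in>T \<inter> D. R k) < (\<Sum>k\<in>T. minfo k) - tcorr T"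
  shows "achievable N X Y W D R"
proof -
  obtain m r where mr: "\<And>k. k \<in> V \<Longrightarrow> m k \<ge> (0::real)" "\<And>k. k \<in> V \<Longrightarrow> r k \<ge> 0" "\<And>k. k \<in> D \<Longrightarrow> R k < m k"
    "\<And>k. k \<in> V \<Longrightarrow> m k + r k < minfo k" "\<And>T. T \<subseteq> V \<Longrightarrow> T \<noteq> {} \<Longrightarrow> tcorr T < (\<Sum>k\<in>T. r k)"
    using split_rates[OF D R rates] by blast
  define a where "a = (\<lambda>n k. nat \<lfloor>real n * m k\<rfloor>)"
  define b where "b = (\<lambda>n k. nat \<lceil>real n * r k\<rceil>)"
  let ?Q = "\<lambda>err. expsmall err \<and> (\<forall>n (\<mu> :: (nat \<Rightarrow> nat) pmf) tgt msg.
    (\<forall>om. \<forall>k\<in>V. tgt om k \<in> idx (a n) (b n) k \<and> msg om k < 2 ^ a n k) \<longrightarrow> block_scheme n (b n) \<mu> tgt msg (err n))"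
  have "\<exists>err. ?Q err"
    unfolding a_def b_def by (rule block_scheme_expsmall) (use mr in auto)
  then obtain err where err0: "?Q err" ..
  note err = conjunct1[OF err0] conjunct2[OF err0, THEN spec, THEN spec, THEN spec, THEN spec, THEN mp]
  obtain es where es: "flooding N X W es" "V - {1} \<subseteq> snd ` set es"
    using flooding_covers[OF finV reach] by blast
  have V1: "V \<subseteq> snd ` set es" using es(2) V by auto
  have "\<exists>xb f. expsmall f \<and> (\<forall>e<length es. bit_channel N X W (fst (es ! e)) (snd (es ! e)) (xb e) f)"
    by (rule flooding_bit_channels[OF es(1)]) (rule finW)
  then obtain xb f where
    xb0: "expsmall f \<and> (\<forall>e<length es. bit_channel N X W (fst (es ! e)) (snd (es ! e)) (xb e) f)"
    by (elim exE) (rule that)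
  note xb = conjunct1[OF xb0] conjunct2[OF xb0, rule_format]
  from expsmall_cube_root[OF xb(1)] obtain gf where gf0: "(\<lambda>\<nu>. real \<nu> * gf \<nu>) \<longlonglongrightarrow> 0 \<and> (\<forall>\<nu>. 0 \<le> gf \<nu> \<and> f (cube_root \<nu>) \<le> gf \<nu>)" ..
  from expsmall_cube_root[OF err(1)] obtain ge where ge0: "(\<lambda>\<nu>. real \<nu> * ge \<nu>) \<longlonglongrightarrow> 0 \<and> (\<forall>\<nu>. 0 \<le> ge \<nu> \<and> err (cube_root \<nu>) \<le> ge \<nu>)" ..
  define r0 where "r0 = length es"
  define s where "s = (\<lambda>n. (\<Sum>k\<in>V. a n k + b n k) + 1)"
  define C1 where "C1 = (\<Sum>k\<in>V. m k + r k)"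
  define C2 where "C2 = real (card V) + 1"
  have C: "C1 \<ge> 0" "C2 \<ge> 0" unfolding C1_def C2_def using mr by (auto intro!: sum_nonneg)
  have s: "real (s n) \<le> C1 * real n + C2" for n
  proof -
    have "real (\<Sum>k\<in>V. a n k + b n k) \<le> (\<Sum>k\<in>V. (m k + r k) * real n + 1)"
      unfolding of_nat_sum
    proof (intro sum_mono)
      fix k assume k: "k \<in> V"
      have "0 \<le> real n * m k" "0 \<le> real n * r k" using mr k by auto
      then have "real (a n k) \<le> real n * m k" "real (b n k) \<le> real n * r k + 1"
        unfolding a_def b_def by (auto simp: of_nat_floor)
      then show "real (a n k + b n k) \<le> (m k + r k) * real n + 1" by (simp add: algebra_simps)
    qed
    also have "\<dots> = C1 * real n + real (card V)"
      using sum.distrib[of "\<lambda>k. (m k + r k) * real n" "\<lambda>_. 1" V]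
      unfolding C1_def sum_distrib_right by simp
    finally show ?thesis unfolding s_def C2_def by simp
  qed
  have finD: "finite D" using D finV finite_subset by blast
  have budget: "eventually (\<lambda>\<nu>. 1 \<le> cube_root \<nu> \<and> real (cube_root \<nu>) * (real r0 * (C1 * real (cube_root \<nu>) + C2) + 1) \<le> real \<nu> \<and>
     real \<nu> * R' + 1 \<le> (real \<nu> / real (cube_root \<nu>) - 1 - real r0 * (C1 * real (cube_root \<nu>) + C2)) * (real (cube_root \<nu>) * m' - 1)) sequentially"
    if "m' \<ge> 0" "R' < m'" for m' R'
    using that C by (intro cube_root_budget) auto
  have "eventually (\<lambda>\<nu>. \<forall>k\<in>D. 1 \<le> cube_root \<nu> \<and> real (cube_root \<nu>) * (real r0 * (C1 * real (cube_root \<nu>) + C2) + 1) \<le> real \<nu> \<and>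
     real \<nu> * R k + 1 \<le> (real \<nu> / real (cube_root \<nu>) - 1 - real r0 * (C1 * real (cube_root \<nu>) + C2)) * (real (cube_root \<nu>) * m k - 1)) sequentially"
    using finD mr D by (subst eventually_ball_finite_distrib) (auto intro!: budget simp del: One_nat_def)
  then have "eventually (\<lambda>\<nu>. \<exists>c. is_code N X Y D R \<nu> c \<and> error_prob N W D R \<nu> c \<le> real \<nu> * gf \<nu> + real \<nu> * ge \<nu>) sequentially"
    \<comment> \<open>This instance supplies the bounds on the block length even if \<open>D\<close>
      is empty.\<close>
    using budget[of 1 0, simplified]
  proof eventually_elim
    case (elim \<nu>)
    define n where "n = cube_root \<nu>"
    \<comment> \<open>All stages that fit into \<open>\<nu>\<close> and are not taken by the
      start-up.\<close>
    define B where "B = \<nu> div n - r0 * s n"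
    have n1: "n \<ge> 1" using elim(2) by (simp add: n_def)
    have rs: "real (r0 * s n) \<le> real r0 * (C1 * real n + C2)"
      using s[of n] by (simp add: mult_left_mono)
    have "real n * (real (r0 * s n) + 1) \<le> real n * (real r0 * (C1 * real n + C2) + 1)"
      using rs by (intro mult_left_mono) auto
    also have "\<dots> \<le> real \<nu>" using elim(2) by (simp add: n_def)
    finally have "real (n * (r0 * s n + 1)) \<le> real \<nu>" by (simp add: distrib_left)
    then have "n * (r0 * s n + 1) \<le> \<nu>" unfolding of_nat_le_iff .
    then have "r0 * s n + 1 \<le> \<nu> div n" using n1 by (simp add: less_eq_div_iff_mult_less_eq mult.commute)
    then have SB: "r0 * s n + B = \<nu> div n" by (simp add: B_def)
    have "\<exists>c. is_code N X Y D R \<nu> c \<and> error_prob N W D R \<nu> c \<le> real (length es * s n) * f n + real B * err n"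
    proof (rule protocol_code)
      show "(length es * s n + B) * n \<le> \<nu>" using SB by (simp add: r0_def)
      show "nat \<lceil>real \<nu> * R k\<rceil> \<le> B * a n k" if k: "k \<in> D" for k
      proof -
        have mk: "m k \<ge> 0" using mr D k by auto
        have B: "real \<nu> / real n - 1 - real r0 * (C1 * real n + C2) \<le> real B"
        proof -
          have "real \<nu> / real n - 1 \<le> real (\<nu> div n)"
          proof -
            have "\<nu> < (\<nu> div n + 1) * n"
              using n1 by (metis add.commute div_less_iff_less_mult lessI less_le_trans plus_1_eq_Suc zero_less_one)
            then have "real \<nu> < (real (\<nu> div n) + 1) * real n"
              by (metis of_nat_1 of_nat_add of_nat_less_iff of_nat_mult)
            then show ?thesis using n1 by (simp add: field_simps)
          qed
          also have "\<dots> = real (r0 * s n) + real B" by (simp flip: SB)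
          finally show ?thesis using rs by linarith
        qed
        have A: "real n * m k - 1 \<le> real (a n k)" unfolding a_def by linarith
        have "real \<nu> * R k + 1 \<le> (real \<nu> / real n - 1 - real r0 * (C1 * real n + C2)) * (real n * m k - 1)"
          using elim(1) k by (auto simp: n_def)
        also have "\<dots> \<le> real B * real (a n k)"
        \<comment> \<open>If the second factor is negative, the first is still nonnegative, so the
          product is at most 0.\<close>
        proof (cases "real n * m k - 1 \<ge> 0")
          case True
          then show ?thesis using A B by (intro mult_mono) auto
        next
          case False
          have "real n * (real r0 * (C1 * real n + C2) + 1) \<le> real \<nu>" using elim(2) by (simp add: n_def)
          then have "real r0 * (C1 * real n + C2) + 1 \<le> real \<nu> / real n" using n1 by (simp add: field_simps)
          then have "(real \<nu> / real n - 1 - real r0 * (C1 * real n + C2)) * (real n * m k - 1) \<le> 0"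
            using False by (intro mult_nonneg_nonpos) auto
          then show ?thesis by (rule order_trans) simp
        qed
        finally have "real \<nu> * R k + 1 \<le> real (B * a n k)" by simp
        moreover have "real \<nu> * R k \<ge> 0" using R k by simp
        ultimately show ?thesis by linarith
      qed
      show "block_scheme n (b n) \<mu> tgt msg (err n)" if "\<forall>om. \<forall>k\<in>V. tgt om k \<in> idx (a n) (b n) k \<and> msg om k < 2 ^ a n k"
        for \<mu> :: "(nat \<Rightarrow> nat) pmf" and tgt msg
        using that by (rule err(2))
      show "bit_channel N X W (fst (es ! e)) (snd (es ! e)) (xb e) f" if "e < length es" for e
        using that by (rule xb(2))
    qed (use D n1 es V1 in \<open>auto simp: s_def\<close>)
    then obtain c where c: "is_code N X Y D R \<nu> c" "error_prob N W D R \<nu> c \<le> real (length es * s n) * f n + real B * err n"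
      by blast
    have "real (length es * s n) * f n + real B * err n \<le> real \<nu> * gf \<nu> + real \<nu> * ge \<nu>"
    proof (rule add_mono)
      have le: "r0 * s n \<le> \<nu>" "B \<le> \<nu>" using SB div_le_dividend[of \<nu> n] by linarith+
      have gf: "0 \<le> gf \<nu>" "f n \<le> gf \<nu>" and ge: "0 \<le> ge \<nu>" "err n \<le> ge \<nu>" using gf0 ge0 by (auto simp: n_def)
      have "real (r0 * s n) * f n \<le> real (r0 * s n) * gf \<nu>" using gf by (intro mult_left_mono) auto
      also have "\<dots> \<le> real \<nu> * gf \<nu>" using gf le by (intro mult_right_mono) (simp_all only: of_nat_le_iff)
      finally show "real (length es * s n) * f n \<le> real \<nu> * gf \<nu>" by (simp add: r0_def)
      have "real B * err n \<le> real B * ge \<nu>" using ge by (intro mult_left_mono) auto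
      also have "\<dots> \<le> real \<nu> * ge \<nu>" using ge le by (intro mult_right_mono) auto
      finally show "real B * err n \<le> real \<nu> * ge \<nu>" .
    qed
    with c show ?case by (intro exI[of _ c]) auto
  qed
  then obtain \<nu>0 where \<nu>0: "\<And>\<nu>. \<nu> \<ge> \<nu>0 \<Longrightarrow> \<exists>c. is_code N X Y D R \<nu> c \<and> error_prob N W D R \<nu> c \<le> real \<nu> * gf \<nu> + real \<nu> * ge \<nu>"
    unfolding eventually_sequentially by blast
  obtain l0 where l0: "l0 \<in> set_pmf P" using set_pmf_not_empty[of P] by blast
  \<comment> \<open>Finitely many lengths are too short for the protocol; there any valid code will
    do.\<close>
  define c0 :: "('x, 'y) code" where "c0 = \<lparr>src_enc = (\<lambda>_ _. xs 1 l0), relay_enc = (\<lambda>k _. xs k l0), decoder = (\<lambda>_ _. None)\<rparr>"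
  have c0: "is_code N X Y D R \<nu> c0" for \<nu>
    unfolding is_code_def c0_def using xs[OF _ l0] N by auto
  have "\<forall>\<nu>. \<exists>c. is_code N X Y D R \<nu> c \<and> (\<nu> \<ge> \<nu>0 \<longrightarrow> error_prob N W D R \<nu> c \<le> real \<nu> * gf \<nu> + real \<nu> * ge \<nu>)"
    using \<nu>0 c0 by meson
  from choice[OF this] obtain c where c: "\<And>\<nu>. is_code N X Y D R \<nu> (c \<nu>)"
    "\<And>\<nu>. \<nu> \<ge> \<nu>0 \<Longrightarrow> error_prob N W D R \<nu> (c \<nu>) \<le> real \<nu> * gf \<nu> + real \<nu> * ge \<nu>" by blast
  have "(\<lambda>\<nu>. error_prob N W D R \<nu> (c \<nu>)) \<longlonglongrightarrow> 0"
  proof (rule tendsto_sandwich)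
    show "eventually (\<lambda>\<nu>. 0 \<le> error_prob N W D R \<nu> (c \<nu>)) sequentially" by (simp add: error_prob_def)
    show "eventually (\<lambda>\<nu>. error_prob N W D R \<nu> (c \<nu>) \<le> real \<nu> * gf \<nu> + real \<nu> * ge \<nu>) sequentially"
      using c(2) by (auto simp: eventually_sequentially)
    show "(\<lambda>\<nu>. real \<nu> * gf \<nu> + real \<nu> * ge \<nu>) \<longlonglongrightarrow> 0"
      using tendsto_add[OF conjunct1[OF gf0] conjunct1[OF ge0]] by simp
  qed simp
  then show ?thesis
    unfolding achievable_def using R c(1) by blast
qed

end

section \<open>Entropy inequalities and unreachable nodes\<close>

definition ent :: "'w pmf \<Rightarrow> ('w \<Rightarrow> 'a) \<Rightarrow> real" where
  "ent P f = expect P (\<lambda>w. - log 2 (pmf (map_pmf f P) (f w)))"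

text \<open>Entropy depends on f only through the partition of the support into level sets. This is
  what allows tuples to be rearranged and determined components to be dropped.\<close>

lemma ent_cong:
  assumes "\<And>w w'. w \<in> set_pmf P \<Longrightarrow> w' \<in> set_pmf P \<Longrightarrow> f w = f w' \<longleftrightarrow> g w = g w'"
  shows "ent P f = ent P g"
  unfolding ent_def
proof (intro integral_cong_AE AE_pmfI)
  fix w assume w: "w \<in> set_pmf P"
  have "prob P (f -` {f w}) = prob P (f -` {f w} \<inter> set_pmf P)"
    by (simp add: measure_Int_set_pmf)
  also have "f -` {f w} \<inter> set_pmf P = g -` {g w} \<inter> set_pmf P"
    using assms[OF _ w] by auto
  also have "prob P \<dots> = prob P (g -` {g w})"
    by (simp add: measure_Int_set_pmf)
  finally show "- log 2 (pmf (map_pmf f P) (f w)) = - log 2 (pmf (map_pmf g P) (g w))"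
    by (simp add: pmf_map)
qed auto

lemma ent_map_pmf: "ent (map_pmf h P) f = ent P (\<lambda>w. f (h w))"
  by (simp add: ent_def pmf.map_comp o_def)

text \<open>Reduces every information quantity of the theorem to four entropies; from there on all
  comparisons are linear.\<close>

lemma cond_info_ent:
  assumes fin: "finite (set_pmf P)"
  shows "cond_info P A B C = ent P (\<lambda>w. (A w, C w)) + ent P (\<lambda>w. (B w, C w))
     - ent P (\<lambda>w. (A w, B w, C w)) - ent P C"
proof -
  note int = integrable_measure_pmf_finite[OF fin]
  let ?M = "map_pmf (\<lambda>w. (A w, B w, C w)) P"
  let ?h = "\<lambda>(a, b, c). log 2 (pmf ?M (a, b, c) / (pmf (map_pmf (\<lambda>w. (A w, C w)) P) (a, c) *
          (pmf (map_pmf (\<lambda>w. (B w, C w)) P) (b, c) / pmf (map_pmf C P) c)))"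
  have "cond_info P A B C = (\<Sum>v\<in>(\<lambda>w. (A w, B w, C w)) ` set_pmf P. pmf ?M v * ?h v)"
    unfolding cond_info_eq[OF fin] by (intro sum.cong) auto
  also have "\<dots> = expect ?M ?h"
    using fin by (subst integral_measure_pmf[where A = "(\<lambda>w. (A w, B w, C w)) ` set_pmf P"]) auto
  also have "\<dots> = expect P (\<lambda>w. ?h (A w, B w, C w))"
    by (rule integral_map_pmf)
  also have "\<dots> = expect P (\<lambda>w.
      - log 2 (pmf (map_pmf (\<lambda>w. (A w, C w)) P) (A w, C w)) + - log 2 (pmf (map_pmf (\<lambda>w. (B w, C w)) P) (B w, C w))
      - - log 2 (pmf ?M (A w, B w, C w)) - - log 2 (pmf (map_pmf C P) (C w)))"
  proof (intro integral_cong_AE AE_pmfI)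
    fix w assume w: "w \<in> set_pmf P"
    note p = pmf_map_pos[OF w, of "\<lambda>w. (A w, C w)"] pmf_map_pos[OF w, of "\<lambda>w. (B w, C w)"]
      pmf_map_pos[OF w, of "\<lambda>w. (A w, B w, C w)"] pmf_map_pos[OF w, of C]
    show "?h (A w, B w, C w) =
      - log 2 (pmf (map_pmf (\<lambda>w. (A w, C w)) P) (A w, C w)) + - log 2 (pmf (map_pmf (\<lambda>w. (B w, C w)) P) (B w, C w))
      - - log 2 (pmf ?M (A w, B w, C w)) - - log 2 (pmf (map_pmf C P) (C w))"
      using p by (simp add: log_divide log_mult)
  qed auto
  also have "\<dots> = ent P (\<lambda>w. (A w, C w)) + ent P (\<lambda>w. (B w, C w))
     - ent P (\<lambda>w. (A w, B w, C w)) - ent P C"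
    unfolding ent_def by (simp add: int)
  finally show ?thesis .
qed

lemma cond_info_nonneg:
  assumes fin: "finite (set_pmf P)"
  shows "cond_info P A B C \<ge> 0"
proof -
  interpret information_space "supp_measure P" 2
    by (rule information_space_supp_measure)
  have sf: "simple_function (supp_measure P) A" "simple_function (supp_measure P) B" "simple_function (supp_measure P) C"
    using fin by (simp_all add: simple_function_def)
  from conditional_mutual_information_nonneg[OF sf] show ?thesis
    unfolding cond_info_def space_supp_measure .
qed

lemma ent_submodular:
  assumes "finite (set_pmf P)"
  shows "ent P (\<lambda>w. (A w, B w, C w)) + ent P C \<le> ent P (\<lambda>w. (A w, C w)) + ent P (\<lambda>w. (B w, C w))"
  using cond_info_nonneg[OF assms, of A B C] cond_info_ent[OF assms, of A B C] by simp

text \<open>Conditioning on the finer \<open>D\<close> lowers entropy: this is submodularity for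
  \<open>A\<close> and \<open>D\<close> given \<open>C\<close>, where \<open>C\<close> is a function
  of \<open>D\<close>.\<close>

lemma ent_conditioning:
  assumes "finite (set_pmf P)"
    and "\<And>w w'. w \<in> set_pmf P \<Longrightarrow> w' \<in> set_pmf P \<Longrightarrow> D w = D w' \<Longrightarrow> C w = C w'"
  shows "ent P (\<lambda>w. (A w, D w)) - ent P D \<le> ent P (\<lambda>w. (A w, C w)) - ent P C"
proof -
  have e: "(A w, D w, C w) = (A w', D w', C w') \<longleftrightarrow> (A w, D w) = (A w', D w')"
    "(D w, C w) = (D w', C w') \<longleftrightarrow> D w = D w'" if "w \<in> set_pmf P" "w' \<in> set_pmf P" for w w'
    using assms(2)[OF that] by blast+
  have "ent P (\<lambda>w. (A w, D w, C w)) = ent P (\<lambda>w. (A w, D w))"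
    by (rule ent_cong) (rule e(1))
  moreover have "ent P (\<lambda>w. (D w, C w)) = ent P D"
    by (rule ent_cong) (rule e(2))
  ultimately show ?thesis using ent_submodular[OF assms(1), of A D C] by simp
qed

lemma restrict_eq_iff: "restrict f A = restrict g A \<longleftrightarrow> (\<forall>k\<in>A. f k = g k)"
  by (auto simp: fun_eq_iff restrict_def)

lemma ent_subadditive:
  assumes fin: "finite (set_pmf P)" and A: "finite A"
  shows "ent P (\<lambda>w. (\<lambda>k\<in>A. f k w, C w)) - ent P C \<le> (\<Sum>k\<in>A. ent P (\<lambda>w. (f k w, C w)) - ent P C)"
  using A
proof (induction A rule: finite_induct)
  case empty
  have e: "ent P (\<lambda>w. (\<lambda>k\<in>{}. f k w, C w)) = ent P C"
    by (intro ent_cong) auto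
  show ?case unfolding e by simp
next
  case (insert k A)
  have "ent P (\<lambda>w. (\<lambda>k\<in>insert k A. f k w, C w)) = ent P (\<lambda>w. (f k w, \<lambda>k\<in>A. f k w, C w))"
    by (rule ent_cong) (unfold prod.inject restrict_eq_iff, blast)
  moreover have "ent P (\<lambda>w. (f k w, \<lambda>k\<in>A. f k w, C w)) + ent P C
     \<le> ent P (\<lambda>w. (f k w, C w)) + ent P (\<lambda>w. (\<lambda>k\<in>A. f k w, C w))"
    by (rule ent_submodular[OF fin])
  moreover have "(\<Sum>j\<in>insert k A. ent P (\<lambda>w. (f j w, C w)) - ent P C)
     = (ent P (\<lambda>w. (f k w, C w)) - ent P C) + (\<Sum>j\<in>A. ent P (\<lambda>w. (f j w, C w)) - ent P C)"
    by (rule sum.insert[OF insert.hyps])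
  ultimately show ?case
    using insert.IH by linarith
qed

text \<open>Chain rule along increasing node numbers: \<open>T \<inter> {1..<k}\<close> with k added
  is the next set of this kind, so the sum telescopes. The condition on 0 matches intervals that
  start at 1.\<close>

lemma sum_chain:
  fixes h :: "nat set \<Rightarrow> real"
  assumes "finite T" "0 \<notin> T"
  shows "(\<Sum>k\<in>T. h (insert k (T \<inter> {1..<k})) - h (T \<inter> {1..<k})) = h T - h {}"
  using assms
proof (induction T rule: finite_linorder_max_induct)
  case (insert b A)
  have lt: "x < b" "1 \<le> x" if "x \<in> A" for x
  proof -
    show "x < b" using insert.hyps(2) that by blast
    have "x \<noteq> 0" using insert.prems that by (metis insertCI)
    then show "1 \<le> x" by simp
  qed
  have 1: "insert b A \<inter> {1..<b} = A"
  proof (intro equalityI subsetI)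
    fix x assume "x \<in> insert b A \<inter> {1..<b}"
    then show "x \<in> A" by simp
  next
    fix x assume "x \<in> A"
    then show "x \<in> insert b A \<inter> {1..<b}" using lt by simp
  qed
  have 2: "insert b A \<inter> {1..<k} = A \<inter> {1..<k}" if "k \<in> A" for k
    using lt(1)[OF that] by simp
  have "b \<notin> A" using lt(1) by blast
  then have "(\<Sum>k\<in>insert b A. h (insert k (insert b A \<inter> {1..<k})) - h (insert b A \<inter> {1..<k}))
    = (h (insert b (insert b A \<inter> {1..<b})) - h (insert b A \<inter> {1..<b}))
      + (\<Sum>k\<in>A. h (insert k (insert b A \<inter> {1..<k})) - h (insert b A \<inter> {1..<k}))"
    using insert.hyps(1) by (rule sum.insert[rotated])
  also have "(\<Sum>k\<in>A. h (insert k (insert b A \<inter> {1..<k})) - h (insert b A \<inter> {1..<k}))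
    = (\<Sum>k\<in>A. h (insert k (A \<inter> {1..<k})) - h (A \<inter> {1..<k}))"
    by (intro sum.cong refl) (simp only: 2)
  also have "\<dots> = h A - h {}"
    using insert.IH insert.prems by simp
  finally show ?case unfolding 1 by simp
qed simp

text \<open>The law of \<open>\<phi> y\<close> given l depends on \<open>a l\<close> only. The added
  expectation does not mention \<open>a\<close>, so it cancels when two choices of \<open>a\<close>
  are compared; this is how conditional independence is used below.\<close>

lemma ent_markov:
  fixes K :: "'l \<Rightarrow> 'y pmf"
  assumes finP: "finite (set_pmf P)" and finK: "\<And>l. l \<in> set_pmf P \<Longrightarrow> finite (set_pmf (K l))"
    and det: "\<And>l l'. l \<in> set_pmf P \<Longrightarrow> l' \<in> set_pmf P \<Longrightarrow> a l = a l' \<Longrightarrow> map_pmf \<phi> (K l) = map_pmf \<phi> (K l')"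
  defines "L \<equiv> bind_pmf P (\<lambda>l. map_pmf (Pair l) (K l))"
  shows "ent L (\<lambda>(l, y). (\<phi> y, a l)) = ent L (\<lambda>(l, y). a l)
    + expect L (\<lambda>(l, y). - log 2 (pmf (map_pmf \<phi> (K l)) (\<phi> y)))"
proof -
  have finL: "finite (set_pmf L)" using finP finK by (auto simp: L_def)
  have fstL: "map_pmf (\<lambda>(l, y). a l) L = map_pmf a P"
    by (simp add: L_def map_bind_pmf pmf.map_comp o_def map_pmf_const) (simp add: map_pmf_def)
  have "pmf (map_pmf (\<lambda>(l, y). (\<phi> y, a l)) L) (\<phi> y, a l) = pmf (map_pmf a P) (a l) * pmf (map_pmf \<phi> (K l)) (\<phi> y)"
    if l: "l \<in> set_pmf P" for l y
  proof -
    have "pmf (map_pmf (\<lambda>(l, y). (\<phi> y, a l)) L) (\<phi> y, a l)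
      = prob (bind_pmf P (\<lambda>l. map_pmf (Pair l) (K l))) {(l', y'). \<phi> y' = \<phi> y \<and> a l' = a l}"
      unfolding L_def pmf_map by (intro arg_cong[where f = "prob _"]) auto
    also have "\<dots> = expect P (\<lambda>l'. prob (K l') {y'. \<phi> y' = \<phi> y \<and> a l' = a l})"
      by (simp add: measure_bind_pmf vimage_def)
    also have "\<dots> = expect P (\<lambda>l'. indicator {l'. a l' = a l} l' * pmf (map_pmf \<phi> (K l)) (\<phi> y))"
    proof (intro integral_cong_AE AE_pmfI)
      fix l' assume l': "l' \<in> set_pmf P"
      show "prob (K l') {y'. \<phi> y' = \<phi> y \<and> a l' = a l} = indicator {l'. a l' = a l} l' * pmf (map_pmf \<phi> (K l)) (\<phi> y)"
        using det[OF l' l] by (cases "a l' = a l") (auto simp: pmf_map vimage_def dest: arg_cong[where f = "\<lambda>p. pmf p (\<phi> y)"])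
    qed auto
    also have "\<dots> = pmf (map_pmf a P) (a l) * pmf (map_pmf \<phi> (K l)) (\<phi> y)"
      by (simp add: pmf_map vimage_def)
    finally show ?thesis .
  qed
  note fac = this
  have "ent L (\<lambda>(l, y). (\<phi> y, a l)) = expect L
     (\<lambda>z. (case z of (l, y) \<Rightarrow> - log 2 (pmf (map_pmf (\<lambda>(l, y). a l) L) (a l))) + (case z of (l, y) \<Rightarrow> - log 2 (pmf (map_pmf \<phi> (K l)) (\<phi> y))))"
    unfolding ent_def
  proof (intro integral_cong_AE AE_pmfI)
    fix z assume z: "z \<in> set_pmf L"
    obtain l y where zly: "z = (l, y)" by (cases z)
    have l: "l \<in> set_pmf P" and y: "y \<in> set_pmf (K l)" using z by (auto simp: zly L_def)
    show "- log 2 (pmf (map_pmf (\<lambda>(l, y). (\<phi> y, a l)) L) ((\<lambda>(l, y). (\<phi> y, a l)) z)) =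
       (case z of (l, y) \<Rightarrow> - log 2 (pmf (map_pmf (\<lambda>(l, y). a l) L) (a l))) + (case z of (l, y) \<Rightarrow> - log 2 (pmf (map_pmf \<phi> (K l)) (\<phi> y)))"
      using pmf_map_pos[OF l, of a] pmf_map_pos[OF y, of \<phi>]
      by (simp add: zly fac[OF l] fstL log_mult)
  qed auto
  also have "\<dots> = ent L (\<lambda>(l, y). a l)
    + expect L (\<lambda>(l, y). - log 2 (pmf (map_pmf \<phi> (K l)) (\<phi> y)))"
    unfolding ent_def by (simp add: integrable_measure_pmf_finite[OF finL] case_prod_beta')
  finally show ?thesis .
qed

text \<open>The inputs of reachable nodes are changed one at a time. A change that altered the law
  at w would be an edge from a reachable node and would make w reachable.\<close>

lemma output_depends_on_unreachable:
  assumes w: "w \<in> {2..N}" "\<not> reachable N X W w" and x: "x \<in> PiE {1..N} X" "x' \<in> PiE {1..N} X"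
    and eq: "\<And>k. k \<in> {1..N} \<Longrightarrow> \<not> reachable N X W k \<Longrightarrow> x k = x' k"
  shows "map_pmf (\<lambda>y. y w) (W x) = map_pmf (\<lambda>y. y w) (W x')"
proof -
  define R where "R = {k\<in>{1..N}. reachable N X W k}"
  have ov: "map_pmf (\<lambda>y. y w) (W x) = map_pmf (\<lambda>y. y w) (W (\<lambda>k. if k \<in> A then x' k else x k))"
    if "finite A" "A \<subseteq> R" for A
    using that
  proof (induction A rule: finite_induct)
    case (insert v A)
    let ?z = "\<lambda>k. if k \<in> A then x' k else x k"
    have v: "v \<in> {1..N}" "reachable N X W v" using insert.prems by (auto simp: R_def)
    have "\<not> edge N X W v w" using reachable_edge[OF v(2)] w(2) by blast
    moreover have "?z \<in> PiE {1..N} X"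
      using x by (auto simp: PiE_iff extensional_def)
    moreover have "x' v \<in> X v" using x v by (auto simp: PiE_iff)
    ultimately have "map_pmf (\<lambda>y. y w) (W ?z) = map_pmf (\<lambda>y. y w) (W (?z(v := x' v)))"
      using v w(1) unfolding edge_def by blast
    moreover have "?z(v := x' v) = (\<lambda>k. if k \<in> insert v A then x' k else x k)"
      by (auto simp: fun_eq_iff)
    ultimately show ?case using insert by simp
  qed simp
  have "(\<lambda>k. if k \<in> R then x' k else x k) = x'"
  proof
    fix k
    show "(if k \<in> R then x' k else x k) = x' k"
    proof (cases "k \<in> {1..N}")
      case True
      then show ?thesis using eq[OF True] by (simp add: R_def)
    next
      case False
      then show ?thesis using PiE_arb[OF x(1) False] PiE_arb[OF x(2) False] by simp
    qed
  qed
  then show ?thesis using ov[of R] by (simp add: R_def)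
qed

section \<open>The letter quantities expressed by entropies\<close>

context relay_letters begin

lemma ent_LL_fst: "ent LL (\<lambda>(l, y). f l) = ent P f"
  using ent_map_pmf[of fst LL f] unfolding map_fst_LL by (simp add: case_prod_beta')

lemma map_P_LL: "map_pmf f P = map_pmf (\<lambda>z. f (fst z)) LL"
proof -
  have "map_pmf (\<lambda>z. f (fst z)) LL = map_pmf f (map_pmf fst LL)" by (simp add: pmf.map_comp o_def)
  then show ?thesis by (simp only: map_fst_LL)
qed

lemma minfo_ent:
  "minfo k = ent LL (\<lambda>(l, y). (qs l, xs k l, y k)) + ent P (\<lambda>l. (qs l, xs k l, us k l))
    - ent LL (\<lambda>(l, y). (qs l, xs k l, us k l, y k)) - ent P (\<lambda>l. (qs l, xs k l))"
proof -
  note int = integrable_measure_pmf_finite[OF finLL]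
  have "minfo k = expect LL (\<lambda>z.
      - log 2 (pXY k (qs (fst z), xs k (fst z), snd z k)) + - log 2 (pV k (qs (fst z), xs k (fst z), us k (fst z)))
      - - log 2 (pVY k (qs (fst z), xs k (fst z), us k (fst z), snd z k)) - - log 2 (pX k (qs (fst z), xs k (fst z))))"
    unfolding minfo_def
  proof (intro integral_cong_AE AE_pmfI)
    fix z assume z: "z \<in> set_pmf LL"
    obtain l y where zly: "z = (l, y)" by (cases z)
    have l: "l \<in> set_pmf P" using z by (auto simp: zly LL_def)
    have "pXY k (qs l, xs k l, y k) > 0" "pV k (qs l, xs k l, us k l) > 0" "pVY k (qs l, xs k l, us k l, y k) > 0" "pX k (qs l, xs k l) > 0"
      using pmf_map_pos[OF z, of "\<lambda>(l, y). (qs l, xs k l, us k l, y k)"]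
      pmf_map_pos[OF z, of "\<lambda>(l, y). (qs l, xs k l, y k)"]
      pmf_map_pos[OF l, of "\<lambda>l. (qs l, xs k l, us k l)"]
      pmf_map_pos[OF l, of "\<lambda>l. (qs l, xs k l)"]
      by (simp_all add: pVY_def pX_def pV_def pXY_def zly)
    then show "(case z of (l, y) \<Rightarrow> log 2 (\<rho> k (qs l) (xs k l) (us k l) (y k))) =
      - log 2 (pXY k (qs (fst z), xs k (fst z), snd z k)) + - log 2 (pV k (qs (fst z), xs k (fst z), us k (fst z)))
      - - log 2 (pVY k (qs (fst z), xs k (fst z), us k (fst z), snd z k)) - - log 2 (pX k (qs (fst z), xs k (fst z)))"
      by (simp add: zly \<rho>_def log_mult log_divide)
  qed auto
  also have "\<dots> = ent LL (\<lambda>(l, y). (qs l, xs k l, y k)) + ent LL (\<lambda>(l, y). (qs l, xs k l, us k l))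
    - ent LL (\<lambda>(l, y). (qs l, xs k l, us k l, y k)) - ent LL (\<lambda>(l, y). (qs l, xs k l))"
  proof -
    have "pV k = pmf (map_pmf (\<lambda>z. (qs (fst z), xs k (fst z), us k (fst z))) LL)"
      unfolding pV_def by (rule arg_cong[where f = pmf, OF map_P_LL])
    moreover have "pX k = pmf (map_pmf (\<lambda>z. (qs (fst z), xs k (fst z))) LL)"
      unfolding pX_def by (rule arg_cong[where f = pmf, OF map_P_LL])
    ultimately show ?thesis
      unfolding ent_def pXY_def pVY_def by (simp add: int case_prod_beta')
  qed
  finally show ?thesis
    unfolding ent_LL_fst .
qed

lemma tcorr_ent:
  assumes T: "finite T"
  shows "tcorr T = (\<Sum>k\<in>T. ent P (\<lambda>l. (qs l, xs k l, us k l)) - ent P qs) + ent P qs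
    - ent P (\<lambda>l. (qs l, \<lambda>k\<in>T. (xs k l, us k l)))"
proof -
  note int = integrable_measure_pmf_finite[OF finP]
  have "tcorr T = expect P (\<lambda>l.
      (\<Sum>k\<in>T. - log 2 (pV k (qs l, xs k l, us k l)) - - log 2 (pQ (qs l))) + - log 2 (pQ (qs l))
      - - log 2 (pT T (qs l, \<lambda>k\<in>T. (xs k l, us k l))))"
    unfolding tcorr_def
  proof (intro integral_cong_AE AE_pmfI)
    fix l assume l: "l \<in> set_pmf P"
    have p: "pQ (qs l) > 0" "pT T (qs l, \<lambda>k\<in>T. (xs k l, us k l)) > 0" "pV k (qs l, xs k l, us k l) > 0" for k
      using pmf_map_pos[OF l, of "\<lambda>l. (qs l, \<lambda>k\<in>T. (xs k l, us k l))"]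
      pmf_map_pos[OF l, of qs] pmf_map_pos[OF l, of "\<lambda>l. (qs l, xs k l, us k l)"]
      by (simp_all add: pT_def pQ_def pV_def)
    have pp: "(\<Prod>k\<in>T. pV k (qs l, xs k l, us k l) / pQ (qs l)) > 0" using p by (intro prod_pos) auto
    have lp: "log 2 (\<Prod>k\<in>T. pV k (qs l, xs k l, us k l) / pQ (qs l)) = (\<Sum>k\<in>T. log 2 (pV k (qs l, xs k l, us k l) / pQ (qs l)))"
    proof -
      have "pV k (qs l, xs k l, us k l) \<noteq> 0" "pQ (qs l) \<noteq> 0" for k
        using p(1) p(3)[of k] by simp_all
      then show ?thesis using T p unfolding log_def by (subst ln_prod) (auto simp: sum_divide_distrib)
    qed
    have "dT T l = log 2 (pT T (qs l, \<lambda>k\<in>T. (xs k l, us k l)) / pQ (qs l)) - (\<Sum>k\<in>T. log 2 (pV k (qs l, xs k l, us k l) / pQ (qs l)))"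
      unfolding dT_def lp[symmetric] using p pp by (intro log_divide_pos) auto
    then show "dT T l = (\<Sum>k\<in>T. - log 2 (pV k (qs l, xs k l, us k l)) - - log 2 (pQ (qs l))) + - log 2 (pQ (qs l))
      - - log 2 (pT T (qs l, \<lambda>k\<in>T. (xs k l, us k l)))"
      using p by (simp add: log_divide_pos sum_subtractf sum_negf)
  qed auto
  also have "\<dots> = (\<Sum>k\<in>T. ent P (\<lambda>l. (qs l, xs k l, us k l)) - ent P qs) + ent P qs
    - ent P (\<lambda>l. (qs l, \<lambda>k\<in>T. (xs k l, us k l)))"
    unfolding ent_def pV_def pQ_def pT_def by (simp add: int)
  finally show ?thesis .
qed

text \<open>Regroups the entropies of \<open>minfo_ent\<close> and \<open>tcorr_ent\<close> into a
  joint entropy minus one cost per node, which is the shape of \<open>cut_value\<close>.\<close>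

lemma rate_gap:
  assumes T: "finite T"
  shows "(\<Sum>k\<in>T. minfo k) - tcorr T = ent LL (\<lambda>(l, y). (qs l, \<lambda>k\<in>T. (xs k l, us k l))) - ent LL (\<lambda>(l, y). qs l)
     - (\<Sum>k\<in>T. (ent LL (\<lambda>(l, y). (qs l, xs k l)) - ent LL (\<lambda>(l, y). qs l))
         + (ent LL (\<lambda>(l, y). (qs l, xs k l, us k l, y k)) - ent LL (\<lambda>(l, y). (qs l, xs k l, y k))))"
  unfolding ent_LL_fst tcorr_ent[OF T] minfo_ent by (simp add: sum.distrib sum_subtractf)

text \<open>Nodes that the source cannot reach receive no information beyond their own inputs, so the
  rate constraints force every node of V to be reachable.\<close>

lemma unreachable_gap:
  defines "T \<equiv> {k \<in> V. \<not> reachable N X W k}"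
  shows "(\<Sum>k\<in>T. minfo k) - tcorr T \<le> 0"
proof -
  have T: "finite T" "T \<subseteq> V" using finV by (auto simp: T_def)
  \<comment> \<open>\<open>a\<close> determines the inputs of all unreachable nodes: those in
    \<open>V\<close> are listed, and those outside \<open>V\<close> are functions of
    \<open>qs\<close> by \<open>\<xi>\<close>.\<close>
  define a where "a = (\<lambda>l. (\<lambda>k\<in>T. xs k l, qs l))"
  have det: "map_pmf (\<lambda>y. y k) (W (inp l)) = map_pmf (\<lambda>y. y k) (W (inp l'))"
    if k: "k \<in> T" and l: "l \<in> set_pmf P" "l' \<in> set_pmf P" and eq: "a l = a l'" for k l l'
  proof (rule output_depends_on_unreachable[where N = N and X = X])
    show "k \<in> {2..N}" "\<not> reachable N X W k" using k V by (auto simp: T_def)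
    show "inp l \<in> PiE {1..N} X" "inp l' \<in> PiE {1..N} X" using l inp by auto
    fix i assume i: "i \<in> {1..N}" "\<not> reachable N X W i"
    have q: "qs l = qs l'" and x: "(\<lambda>k\<in>T. xs k l) = (\<lambda>k\<in>T. xs k l')" using eq by (auto simp: a_def)
    have "i \<noteq> 1" using i by (auto simp: reachable_def)
    then have i2: "i \<in> {2..N}" using i by auto
    have "xs i l = xs i l'"
    proof (cases "i \<in> V")
      case True
      then have "i \<in> T" using i by (simp add: T_def)
      then show ?thesis using fun_cong[OF x, of i] by simp
    next
      case False
      then show ?thesis using \<xi>[of i l] \<xi>[of i l'] l i2 q by simp
    qed
    then show "inp l i = inp l' i" using i by (simp add: inp_def)
  qed
  \<comment> \<open>Given \<open>a\<close>, the output at k is independent of U_k, so H(U_k | a) =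
    H(U_k | Y_k, a), which is at most H(U_k | Q, X_k, Y_k) because \<open>a\<close> determines Q and
    X_k.\<close>
  have node: "ent LL (\<lambda>(l, y). (us k l, a l)) - ent LL (\<lambda>(l, y). a l)
     \<le> ent LL (\<lambda>(l, y). (qs l, xs k l, us k l, y k)) - ent LL (\<lambda>(l, y). (qs l, xs k l, y k))" if k: "k \<in> T" for k
  proof -
    let ?E = "expect LL (\<lambda>(l, y). - log 2 (pmf (map_pmf (\<lambda>y. y k) (W (inp l))) (y k)))"
    have fW: "\<And>l. l \<in> set_pmf P \<Longrightarrow> finite (set_pmf (W (inp l)))" using finW inp by auto
    have m0: "ent LL (\<lambda>(l, y). (y k, a l)) = ent LL (\<lambda>(l, y). a l) + ?E"
      unfolding LL_def
    proof (rule ent_markov[where a = a and K = "\<lambda>l. W (inp l)" and \<phi> = "\<lambda>y. y k", OF finP])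
      show "map_pmf (\<lambda>y. y k) (W (inp l)) = map_pmf (\<lambda>y. y k) (W (inp l'))"
        if "l \<in> set_pmf P" "l' \<in> set_pmf P" "a l = a l'" for l l'
        using that by (rule det[OF k])
    qed (rule fW)
    have m1: "ent LL (\<lambda>(l, y). (y k, us k l, a l)) = ent LL (\<lambda>(l, y). (us k l, a l)) + ?E"
      unfolding LL_def
    proof (rule ent_markov[where a = "\<lambda>l. (us k l, a l)" and K = "\<lambda>l. W (inp l)" and \<phi> = "\<lambda>y. y k", OF finP])
      show "map_pmf (\<lambda>y. y k) (W (inp l)) = map_pmf (\<lambda>y. y k) (W (inp l'))"
        if "l \<in> set_pmf P" "l' \<in> set_pmf P" "(us k l, a l) = (us k l', a l')" for l l'
        using that by (intro det[OF k]) auto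
    qed (rule fW)
    have m2: "ent LL (\<lambda>(l, y). (y k, us k l, a l)) = ent LL (\<lambda>z. (us k (fst z), (snd z k, a (fst z))))"
      by (intro ent_cong) auto
    have m3: "ent LL (\<lambda>(l, y). (y k, a l)) = ent LL (\<lambda>z. (snd z k, a (fst z)))"
      by (intro ent_cong) auto
    have m4: "ent LL (\<lambda>z. (us k (fst z), (snd z k, a (fst z)))) - ent LL (\<lambda>z. (snd z k, a (fst z)))
      \<le> ent LL (\<lambda>z. (us k (fst z), (qs (fst z), xs k (fst z), snd z k))) - ent LL (\<lambda>z. (qs (fst z), xs k (fst z), snd z k))"
    proof (rule ent_conditioning[OF finLL])
      fix w w' :: "'l \<times> (nat \<Rightarrow> 'y)"
      assume "(snd w k, a (fst w)) = (snd w' k, a (fst w'))"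
      then show "(qs (fst w), xs k (fst w), snd w k) = (qs (fst w'), xs k (fst w'), snd w' k)"
        using k by (auto simp: a_def dest: fun_cong[where x = k])
    qed
    have m5: "ent LL (\<lambda>z. (us k (fst z), (qs (fst z), xs k (fst z), snd z k))) = ent LL (\<lambda>(l, y). (qs l, xs k l, us k l, y k))"
      by (intro ent_cong) auto
    have m6: "ent LL (\<lambda>z. (qs (fst z), xs k (fst z), snd z k)) = ent LL (\<lambda>(l, y). (qs l, xs k l, y k))"
      by (intro ent_cong) auto
    \<comment> \<open>Linear arithmetic for plain reals, instantiated with the entropies by
      resolution.\<close>
    have gen: "a1y = a1 + E \<Longrightarrow> yua = ua + E \<Longrightarrow> yua = uya \<Longrightarrow> a1y = ya \<Longrightarrow> uya - ya \<le> uc - c \<Longrightarrow>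
      uc = c4 \<Longrightarrow> c = c3 \<Longrightarrow> ua - a1 \<le> c4 - c3" for a1y a1 E yua ua uya ya uc c c4 c3 :: real
      by linarith
    show ?thesis by (rule gen[OF m0 m1 m2 m3 m4 m5 m6])
  qed
  \<comment> \<open>H(X_T, U_T | Q) is the sum of H(X_T | Q) and H(U_T | a). Both are subadditive
    over the nodes, and the second is then bounded node by node.\<close>
  have m0: "ent LL (\<lambda>(l, y). (qs l, \<lambda>k\<in>T. (xs k l, us k l))) = ent LL (\<lambda>z. (\<lambda>k\<in>T. us k (fst z), a (fst z)))"
    by (rule ent_cong) (unfold a_def case_prod_beta' prod.inject restrict_eq_iff, blast)
  have m1: "ent LL (\<lambda>z. (\<lambda>k\<in>T. us k (fst z), a (fst z))) - ent LL (\<lambda>z. a (fst z))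
     \<le> (\<Sum>k\<in>T. ent LL (\<lambda>z. (us k (fst z), a (fst z))) - ent LL (\<lambda>z. a (fst z)))"
    by (rule ent_subadditive[OF finLL T(1)])
  have m2: "ent LL (\<lambda>z. a (fst z)) = ent LL (\<lambda>z. (\<lambda>k\<in>T. xs k (fst z), qs (fst z)))"
    by (simp add: a_def)
  have m3: "ent LL (\<lambda>z. (\<lambda>k\<in>T. xs k (fst z), qs (fst z))) - ent LL (\<lambda>z. qs (fst z))
     \<le> (\<Sum>k\<in>T. ent LL (\<lambda>z. (xs k (fst z), qs (fst z))) - ent LL (\<lambda>z. qs (fst z)))"
    by (rule ent_subadditive[OF finLL T(1)])
  have m4: "(\<Sum>k\<in>T. ent LL (\<lambda>z. (us k (fst z), a (fst z))) - ent LL (\<lambda>z. a (fst z)))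
     \<le> (\<Sum>k\<in>T. ent LL (\<lambda>(l, y). (qs l, xs k l, us k l, y k)) - ent LL (\<lambda>(l, y). (qs l, xs k l, y k)))"
    using node by (intro sum_mono) (simp add: case_prod_beta')
  have m5: "(\<Sum>k\<in>T. ent LL (\<lambda>z. (xs k (fst z), qs (fst z))) - ent LL (\<lambda>z. qs (fst z)))
     = (\<Sum>k\<in>T. ent LL (\<lambda>(l, y). (qs l, xs k l)) - ent LL (\<lambda>(l, y). qs l))"
  proof (intro sum.cong refl)
    fix k
    have "ent LL (\<lambda>z. (xs k (fst z), qs (fst z))) = ent LL (\<lambda>(l, y). (qs l, xs k l))"
      by (intro ent_cong) auto
    moreover have "ent LL (\<lambda>z. qs (fst z)) = ent LL (\<lambda>(l, y). qs l)"
      by (intro ent_cong) auto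
    ultimately show "ent LL (\<lambda>z. (xs k (fst z), qs (fst z))) - ent LL (\<lambda>z. qs (fst z))
      = ent LL (\<lambda>(l, y). (qs l, xs k l)) - ent LL (\<lambda>(l, y). qs l)" by (simp only:)
  qed
  have m6: "ent LL (\<lambda>z. qs (fst z)) = ent LL (\<lambda>(l, y). qs l)" by (simp add: case_prod_beta')
  have gen: "A = B \<Longrightarrow> B - Ca \<le> S1 \<Longrightarrow> Ca = Cx \<Longrightarrow> Cx - Cq \<le> S2 \<Longrightarrow> S1 \<le> S3 \<Longrightarrow> S2 = S4 \<Longrightarrow>
      Cq = Cq' \<Longrightarrow> A - Cq' - (S4 + S3) \<le> 0" for A B Ca S1 Cx Cq S2 S3 S4 Cq' :: real
    by linarith
  show ?thesis
    by (subst rate_gap[OF T(1)], subst sum.distrib, rule gen[OF m0 m1 m2 m3 m4 m5 m6])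
qed

lemma achievable_letters:
  fixes D :: "nat set" and R :: "nat \<Rightarrow> real" and Y :: "nat \<Rightarrow> 'y set"
  assumes D: "D \<subseteq> V" and R: "\<And>k. k \<in> D \<Longrightarrow> R k \<ge> 0"
    and rates: "\<And>T. T \<subseteq> V \<Longrightarrow> T \<noteq> {} \<Longrightarrow> (\<Sum>k\<in>T \<inter> D. R k) < (\<Sum>k\<in>T. minfo k) - tcorr T"
  shows "achievable N X Y W D R"
proof (rule achievable_if_reachable[OF D R _ rates])
  define T where "T = {k \<in> V. \<not> reachable N X W k}"
  have "T = {}"
  proof (rule ccontr)
    assume "T \<noteq> {}"
    then have "(\<Sum>k\<in>T \<inter> D. R k) < 0"
      using rates[of T] unreachable_gap by (force simp: T_def)
    moreover have "(\<Sum>k\<in>T \<inter> D. R k) \<ge> 0" using R by (intro sum_nonneg) auto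
    ultimately show False by simp
  qed
  then show "reachable N X W k" if "k \<in> V" for k using that by (auto simp: T_def)
qed

end

section \<open>Cut values and idle relays\<close>

abbreviation X_of :: "('a \<Rightarrow> 'x) \<times> 'b \<Rightarrow> 'a \<Rightarrow> 'x" where "X_of z \<equiv> fst z"
abbreviation U_of :: "'d \<times> ('a \<Rightarrow> 'u) \<times> 'b \<Rightarrow> 'a \<Rightarrow> 'u" where "U_of z \<equiv> fst (snd z)"
abbreviation Q_of :: "'d \<times> 'e \<times> 'q \<times> 'b \<Rightarrow> 'q" where "Q_of z \<equiv> fst (snd (snd z))"
abbreviation Y_of :: "'d \<times> 'e \<times> 'q \<times> ('a \<Rightarrow> 'y) \<Rightarrow> 'a \<Rightarrow> 'y" where "Y_of z \<equiv> snd (snd (snd z))"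

text \<open>H(X_k | C) + H(U_k | X_k, Y_k, C). The conditioning is a parameter because the letters
  of idle relays are added to Q later.\<close>

definition node_cost where
  "node_cost L C k = (ent L (\<lambda>z. (X_of z k, C z)) - ent L C)
     + (ent L (\<lambda>z. (U_of z k, X_of z k, Y_of z k, C z)) - ent L (\<lambda>z. (X_of z k, Y_of z k, C z)))"

text \<open>With \<open>C = Q_of\<close> this is the sum over k in T of \<open>I(U_k; Y_k | X_k, Q)\<close> minus the total
  correlation of the pairs \<open>(X_k, U_k)\<close>, k in T, given Q.\<close>

definition cut_value where
  "cut_value L C T = ent L (\<lambda>z. ((\<lambda>k\<in>T. (X_of z k, U_of z k)), C z)) - ent L C - (\<Sum>k\<in>T. node_cost L C k)"

lemma cut_value_empty: "cut_value L C {} = 0"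
proof -
  have "ent L (\<lambda>z. ((\<lambda>k\<in>{}. (X_of z k, U_of z k)), C z)) = ent L C"
    by (rule ent_cong) (unfold prod.inject restrict_eq_iff, blast)
  then show ?thesis by (simp only: cut_value_def sum.empty)
qed

lemma node_cost_antimono:
  assumes fin: "finite (set_pmf L)"
    and CD: "\<And>w w'. w \<in> set_pmf L \<Longrightarrow> w' \<in> set_pmf L \<Longrightarrow> D w = D w' \<Longrightarrow> C w = C w'"
  shows "node_cost L D k \<le> node_cost L C k"
  unfolding node_cost_def
proof (intro add_mono)
  show "ent L (\<lambda>z. (X_of z k, D z)) - ent L D \<le> ent L (\<lambda>z. (X_of z k, C z)) - ent L C"
    by (rule ent_conditioning[OF fin CD])
  show "ent L (\<lambda>z. (U_of z k, X_of z k, Y_of z k, D z)) - ent L (\<lambda>z. (X_of z k, Y_of z k, D z))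
    \<le> ent L (\<lambda>z. (U_of z k, X_of z k, Y_of z k, C z)) - ent L (\<lambda>z. (X_of z k, Y_of z k, C z))"
    by (rule ent_conditioning[OF fin]) (use CD in blast)
qed

text \<open>The joint entropy obeys the chain rule with equality, while conditioning on the letters
  of \<open>T0\<close> can only lower the node costs of \<open>T\<close>. So revealing these letters
  never hurts the remaining cuts.\<close>

lemma cut_value_given_nodes:
  assumes fin: "finite (set_pmf L)" and T: "finite T" "finite T0" "T \<inter> T0 = {}"
  defines "C \<equiv> \<lambda>z. (Q_of z, restrict (X_of z) T0, restrict (U_of z) T0)"
  shows "cut_value L Q_of (T \<union> T0) - cut_value L Q_of T0 \<le> cut_value L C T"
proof -
  have 1: "ent L (\<lambda>z. ((\<lambda>k\<in>T \<union> T0. (X_of z k, U_of z k)), Q_of z)) = ent L (\<lambda>z. ((\<lambda>k\<in>T. (X_of z k, U_of z k)), C z))"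
    by (rule ent_cong) (simp only: C_def prod.inject restrict_eq_iff ball_Un ball_conj_distrib conj_ac)
  have 2: "ent L (\<lambda>z. ((\<lambda>k\<in>T0. (X_of z k, U_of z k)), Q_of z)) = ent L C"
    by (rule ent_cong) (simp only: C_def prod.inject restrict_eq_iff ball_Un ball_conj_distrib conj_ac)
  have 3: "(\<Sum>k\<in>T \<union> T0. node_cost L Q_of k) = (\<Sum>k\<in>T. node_cost L Q_of k) + (\<Sum>k\<in>T0. node_cost L Q_of k)"
    using T by (rule sum.union_disjoint)
  have 4: "(\<Sum>k\<in>T. node_cost L C k) \<le> (\<Sum>k\<in>T. node_cost L Q_of k)"
    by (rule sum_mono, rule node_cost_antimono[OF fin]) (simp only: C_def prod.inject)
  have gen: "s12 = s1 + s2 \<Longrightarrow> s1' \<le> s1 \<Longrightarrow> (e1 - q - s12) - (c - q - s2) \<le> e1 - c - s1'"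
    for s12 s1 s2 s1' e1 q c :: real by linarith
  show ?thesis unfolding cut_value_def 1 2 by (rule gen[OF 3 4])
qed

text \<open>Written as entropies, the terms with the preceding nodes telescope by
  \<open>sum_chain\<close>, so the ordering of the nodes disappears and what is left cancels against
  the first information term. The only inequality drops Y_k from the conditioning in the entropy of
  U_k given U(T_k), X^N, Y_k and Q.\<close>

lemma ddf_bound_le_cut_value:
  fixes P :: "((nat \<Rightarrow> 'x) \<times> (nat \<Rightarrow> 'u) \<times> 'q) pmf" and W :: "(nat \<Rightarrow> 'x) \<Rightarrow> (nat \<Rightarrow> 'y) pmf"
  assumes finL: "finite (set_pmf (joint_law P W))" and S: "S \<subseteq> {1..N}"
  shows "ddf_bound N P W S \<le> cut_value (joint_law P W) Q_of ({1..N} - S)"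
proof -
  define L where "L = joint_law P W"
  define T where "T = {1..N} - S"
  have fin: "finite (set_pmf L)" using finL by (simp add: L_def)
  have T: "finite T" "0 \<notin> T" by (auto simp: T_def)
  define XN where "XN = (\<lambda>z::(nat \<Rightarrow> 'x) \<times> (nat \<Rightarrow> 'u) \<times> 'q \<times> (nat \<Rightarrow> 'y). (restrict (X_of z) {1..N}, Q_of z))"
  define hU where "hU = (\<lambda>A. ent L (\<lambda>z. (restrict (U_of z) A, XN z)))"
  define hX where "hX = (\<lambda>A. ent L (\<lambda>z. (restrict (X_of z) A, Q_of z)))"
  define Tk where "Tk = (\<lambda>k. T \<inter> {1..<k})"
  define I1 where "I1 = cond_info L (\<lambda>z. restrict (X_of z) S) (\<lambda>z. restrict (U_of z) T) (\<lambda>z. (restrict (X_of z) T, Q_of z))"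
  define I2 where "I2 = (\<lambda>k. cond_info L (\<lambda>z. U_of z k) (\<lambda>z. (restrict (U_of z) (Tk k), restrict (X_of z) {1..N})) (\<lambda>z. (X_of z k, Y_of z k, Q_of z)))"
  define I3 where "I3 = (\<lambda>k. cond_info L (\<lambda>z. X_of z k) (\<lambda>z. restrict (X_of z) (Tk k)) Q_of)"
  define n2 where "n2 = (\<lambda>k. ent L (\<lambda>z. (U_of z k, X_of z k, Y_of z k, Q_of z)) - ent L (\<lambda>z. (X_of z k, Y_of z k, Q_of z)))"
  define n1 where "n1 = (\<lambda>k. ent L (\<lambda>z. (X_of z k, Q_of z)) - ent L Q_of)"
  have ddf: "ddf_bound N P W S = I1 - (\<Sum>k\<in>T. I2 k + I3 k)"
    unfolding ddf_bound_def Let_def L_def[symmetric] T_def[symmetric] I1_def I2_def I3_def Tk_def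
    by (simp only: case_prod_beta')
  have ST: "{1..N} = S \<union> T" using S by (auto simp: T_def)
  have I1: "I1 = ent L XN + ent L (\<lambda>z. ((\<lambda>k\<in>T. (X_of z k, U_of z k)), Q_of z)) - hU T - hX T"
  proof -
    have "ent L (\<lambda>z. (restrict (U_of z) T, restrict (X_of z) T, Q_of z)) = ent L (\<lambda>z. ((\<lambda>k\<in>T. (X_of z k, U_of z k)), Q_of z))"
      by (rule ent_cong) (simp only: prod.inject restrict_eq_iff ball_Un ball_conj_distrib conj_ac)
    moreover have "ent L (\<lambda>z. (restrict (X_of z) S, restrict (X_of z) T, Q_of z)) = ent L XN"
      by (rule ent_cong) (simp only: XN_def ST prod.inject restrict_eq_iff ball_Un ball_conj_distrib conj_ac)
    moreover have "ent L (\<lambda>z. (restrict (X_of z) S, restrict (U_of z) T, restrict (X_of z) T, Q_of z)) = hU T"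
      unfolding hU_def by (rule ent_cong) (simp only: XN_def ST prod.inject restrict_eq_iff ball_Un ball_conj_distrib conj_ac)
    ultimately show ?thesis
      unfolding I1_def cond_info_ent[OF fin] hX_def by simp
  qed
  have I2: "n2 k + hU (Tk k) - hU (insert k (Tk k)) \<le> I2 k" if k: "k \<in> T" for k
  proof -
    have kN: "k \<in> {1..N}" using k by (simp add: T_def)
    have "ent L (\<lambda>z. ((restrict (U_of z) (Tk k), restrict (X_of z) {1..N}), X_of z k, Y_of z k, Q_of z))
       = ent L (\<lambda>z. (Y_of z k, restrict (U_of z) (Tk k), XN z))"
      by (rule ent_cong) (unfold XN_def prod.inject restrict_eq_iff, intro iffI conjI; elim conjE; (assumption | (erule bspec, rule kN)))
    moreover have "ent L (\<lambda>z. (U_of z k, (restrict (U_of z) (Tk k), restrict (X_of z) {1..N}), X_of z k, Y_of z k, Q_of z))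
       = ent L (\<lambda>z. (U_of z k, Y_of z k, restrict (U_of z) (Tk k), XN z))"
      by (rule ent_cong) (unfold XN_def prod.inject restrict_eq_iff, intro iffI conjI; elim conjE; (assumption | (erule bspec, rule kN)))
    moreover have "ent L (\<lambda>z. (U_of z k, restrict (U_of z) (Tk k), XN z)) = hU (insert k (Tk k))"
      unfolding hU_def by (rule ent_cong) (unfold XN_def prod.inject restrict_eq_iff, blast)
    moreover have "ent L (\<lambda>z. (U_of z k, Y_of z k, restrict (U_of z) (Tk k), XN z)) + ent L (\<lambda>z. (restrict (U_of z) (Tk k), XN z))
      \<le> ent L (\<lambda>z. (U_of z k, restrict (U_of z) (Tk k), XN z)) + ent L (\<lambda>z. (Y_of z k, restrict (U_of z) (Tk k), XN z))"
      by (rule ent_submodular[OF fin])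
    ultimately show ?thesis
      unfolding I2_def cond_info_ent[OF fin] n2_def hU_def by simp
  qed
  have I3: "I3 k = n1 k - (hX (insert k (Tk k)) - hX (Tk k))" for k
  proof -
    have "ent L (\<lambda>z. (X_of z k, restrict (X_of z) (Tk k), Q_of z)) = hX (insert k (Tk k))"
      unfolding hX_def by (rule ent_cong) (unfold prod.inject restrict_eq_iff, blast)
    then show ?thesis
      unfolding I3_def cond_info_ent[OF fin] n1_def hX_def by simp
  qed
  have "(\<Sum>k\<in>T. n1 k + n2 k) - (\<Sum>k\<in>T. hU (insert k (Tk k)) - hU (Tk k)) - (\<Sum>k\<in>T. hX (insert k (Tk k)) - hX (Tk k))
    \<le> (\<Sum>k\<in>T. I2 k + I3 k)"
    unfolding sum_subtractf[symmetric]
  proof (rule sum_mono)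
    fix k assume "k \<in> T"
    from I2[OF this] show "n1 k + n2 k - (hU (insert k (Tk k)) - hU (Tk k)) - (hX (insert k (Tk k)) - hX (Tk k)) \<le> I2 k + I3 k"
      unfolding I3 by simp
  qed
  moreover have "(\<Sum>k\<in>T. hU (insert k (Tk k)) - hU (Tk k)) = hU T - hU {}"
    unfolding Tk_def by (rule sum_chain[OF T])
  moreover have "(\<Sum>k\<in>T. hX (insert k (Tk k)) - hX (Tk k)) = hX T - hX {}"
    unfolding Tk_def by (rule sum_chain[OF T])
  moreover have "hU {} = ent L XN"
    unfolding hU_def by (rule ent_cong) (unfold prod.inject restrict_eq_iff, blast)
  moreover have "hX {} = ent L Q_of"
    unfolding hX_def by (rule ent_cong) (unfold prod.inject restrict_eq_iff, blast)
  moreover have "cut_value L Q_of T = ent L (\<lambda>z. ((\<lambda>k\<in>T. (X_of z k, U_of z k)), Q_of z)) - ent L Q_of - (\<Sum>k\<in>T. n1 k + n2 k)"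
    unfolding cut_value_def node_cost_def n1_def n2_def ..
  ultimately have "ddf_bound N P W S \<le> cut_value L Q_of T"
    unfolding ddf I1 by simp
  then show ?thesis unfolding L_def T_def .
qed

text \<open>Relays whose decoding constraints fail are not used: for a minimiser \<open>T0\<close> of the cut value
  among the sets of non-destinations, moving \<open>(X(T0), U(T0))\<close> into Q makes every remaining cut
  satisfy its constraint.\<close>

lemma ex_idle_relays:
  fixes F :: "nat set \<Rightarrow> real"
  assumes empty: "F {} = 0" and D: "D \<subseteq> {2..N}" and R: "\<And>k. k \<in> D \<Longrightarrow> R k \<ge> 0"
    and F: "\<And>T. T \<subseteq> {2..N} \<Longrightarrow> T \<inter> D \<noteq> {} \<Longrightarrow> (\<Sum>k\<in>T \<inter> D. R k) < F T"
  shows "\<exists>T0\<subseteq>{2..N} - D. \<forall>T\<subseteq>{2..N} - T0. T \<noteq> {} \<longrightarrow> (\<Sum>k\<in>T \<inter> D. R k) < F (T \<union> T0) - F T0"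
proof -
  define A where "A = Pow ({2..N} - D)"
  define M where "M = {T\<in>A. \<forall>T'\<in>A. F T \<le> F T'}"
  have A: "finite A" "A \<noteq> {}" by (auto simp: A_def)
  have "Min (F ` A) \<in> F ` A" using A by (intro Min_in) auto
  then obtain T1 where T1: "T1 \<in> A" "F T1 = Min (F ` A)" by auto
  have "F T1 \<le> F T'" if "T' \<in> A" for T'
    unfolding T1(2) using A that by (intro Min_le) auto
  then have "T1 \<in> M" using T1(1) by (simp add: M_def)
  then have M: "finite (card ` M)" "card ` M \<noteq> {}" using A by (auto simp: M_def)
  \<comment> \<open>Among the minimisers one of largest cardinality is taken: then a nonempty
    \<open>T\<close> without destinations raises \<open>F\<close> strictly, since
    \<open>T \<union> T0\<close> cannot be a minimiser.\<close>
  from Max_in[OF M] obtain T0 where T0: "T0 \<in> M" "card T0 = Max (card ` M)" by (metis imageE)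
  have T0A: "T0 \<subseteq> {2..N} - D" using T0(1) by (auto simp: M_def A_def)
  have min: "F T0 \<le> F T'" if "T' \<subseteq> {2..N} - D" for T'
    using T0(1) that by (simp add: M_def A_def)
  show ?thesis
  proof (intro exI[of _ T0] conjI T0A allI impI)
    fix T assume T: "T \<subseteq> {2..N} - T0" "T \<noteq> {}"
    show "(\<Sum>k\<in>T \<inter> D. R k) < F (T \<union> T0) - F T0"
    proof (cases "T \<inter> D = {}")
      case True
      have sub: "T \<union> T0 \<subseteq> {2..N} - D" using True T T0A by blast
      have "finite (T \<union> T0)" using sub finite_subset by blast
      then have "card T0 < card (T \<union> T0)" using T by (intro psubset_card_mono) auto
      then have "T \<union> T0 \<notin> M" using T0(2) Max_ge[OF M(1)] by (metis image_eqI leD)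
      have "F T0 < F (T \<union> T0)"
      proof (rule ccontr)
        assume "\<not> F T0 < F (T \<union> T0)"
        then have "F (T \<union> T0) \<le> F T'" if "T' \<in> A" for T'
          using min[of T'] that by (simp add: A_def)
        then have "T \<union> T0 \<in> M" using sub by (simp add: M_def A_def)
        with \<open>T \<union> T0 \<notin> M\<close> show False ..
      qed
      then show ?thesis using True by simp
    next
      case False
      have "T \<union> T0 \<subseteq> {2..N}" "(T \<union> T0) \<inter> D \<noteq> {}" "(T \<union> T0) \<inter> D = T \<inter> D" using T T0A False by blast+
      then have "(\<Sum>k\<in>T \<inter> D. R k) < F (T \<union> T0)" using F[of "T \<union> T0"] by simp
      \<comment> \<open>The empty set competes in the minimum, so subtracting \<open>F T0\<close>
        can only enlarge the right-hand side.\<close>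
      moreover have "F T0 \<le> 0" using min[of "{}"] empty by simp
      ultimately show ?thesis by linarith
    qed
  qed
qed

theorem theorem2:
  fixes N :: nat
    and X :: "nat \<Rightarrow> 'x set" and Y :: "nat \<Rightarrow> 'y set"
    and W :: "(nat \<Rightarrow> 'x) \<Rightarrow> (nat \<Rightarrow> 'y) pmf"
    and D :: "nat set" and R :: "nat \<Rightarrow> real"
  assumes "dm_network N X Y W"
    and "D \<subseteq> {2..N}"
    and "\<forall>k\<in>D. 0 \<le> R k"
    and "\<exists>(U :: nat \<Rightarrow> 'u set) (Qs :: 'q set) P.
           aux_pmf N X U Qs P \<and>
           (\<forall>S\<subseteq>{1..N}. 1 \<in> S \<longrightarrow> ({1..N} - S) \<inter> D \<noteq> {} \<longrightarrow>
              (\<Sum>k\<in>({1..N} - S) \<inter> D. R k) < ddf_bound N P W S)"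
  shows "achievable N X Y W D R"
proof -
  from assms(4) obtain U :: "nat \<Rightarrow> 'u set" and Qs :: "'q set" and P where
    ex: "aux_pmf N X U Qs P \<and> (\<forall>S\<subseteq>{1..N}. 1 \<in> S \<longrightarrow> ({1..N} - S) \<inter> D \<noteq> {} \<longrightarrow>
              (\<Sum>k\<in>({1..N} - S) \<inter> D. R k) < ddf_bound N P W S)"
    by (elim exE) (rule that)
  note aux = conjunct1[OF ex]
  have bound: "(\<Sum>k\<in>({1..N} - S) \<inter> D. R k) < ddf_bound N P W S"
    if "S \<subseteq> {1..N}" "1 \<in> S" "({1..N} - S) \<inter> D \<noteq> {}" for S
    using conjunct2[OF ex, rule_format, OF that] .
  have N: "1 \<le> N" and finXY: "\<And>k. k \<in> {1..N} \<Longrightarrow> finite (X k)" "\<And>k. k \<in> {1..N} \<Longrightarrow> finite (Y k)"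
    and W: "\<And>x. x \<in> PiE {1..N} X \<Longrightarrow> set_pmf (W x) \<subseteq> PiE {1..N} Y"
    using assms(1) unfolding dm_network_def by simp_all
  have Psub: "set_pmf P \<subseteq> PiE {1..N} X \<times> PiE {2..N} U \<times> Qs"
    and finU: "\<And>k. k \<in> {2..N} \<Longrightarrow> finite (U k)" "finite Qs"
    using aux unfolding aux_pmf_def by simp_all
  have finP: "finite (set_pmf P)"
    by (rule finite_subset[OF Psub]) (intro finite_cartesian_product finite_PiE finXY finU finite_atLeastAtMost)
  have finW: "finite (set_pmf (W x))" if "x \<in> PiE {1..N} X" for x
    by (rule finite_subset[OF W[OF that]]) (intro finite_PiE finXY finite_atLeastAtMost)
  have Px: "fst l \<in> PiE {1..N} X" if "l \<in> set_pmf P" for l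
    using subsetD[OF Psub that] by (simp only: mem_Times_iff)
  define L where "L = joint_law P W"
  have finL: "finite (set_pmf L)"
    using finP finW Px unfolding L_def joint_law_def by (fastforce intro!: finite_UN_I)
  define F where "F = cut_value L Q_of"
  have F: "(\<Sum>k\<in>T \<inter> D. R k) < F T" if T: "T \<subseteq> {2..N}" "T \<inter> D \<noteq> {}" for T
  proof -
    have S: "{1..N} - T \<subseteq> {1..N}" "1 \<in> {1..N} - T" using T(1) N by auto
    have eq: "{1..N} - ({1..N} - T) = T" using T(1) by auto
    have "(\<Sum>k\<in>T \<inter> D. R k) < ddf_bound N P W ({1..N} - T)"
      using bound[OF S] T(2) unfolding eq by blast
    also have "\<dots> \<le> F T"
      using ddf_bound_le_cut_value[OF finL[unfolded L_def] S(1)] unfolding eq F_def L_def .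
    finally show ?thesis .
  qed
  have "F {} = 0" unfolding F_def by (rule cut_value_empty)
  then have "\<exists>T0\<subseteq>{2..N} - D. \<forall>T\<subseteq>{2..N} - T0. T \<noteq> {} \<longrightarrow> (\<Sum>k\<in>T \<inter> D. R k) < F (T \<union> T0) - F T0"
    by (rule ex_idle_relays) (use assms(2,3) F in auto)
  then obtain T0 where T0: "T0 \<subseteq> {2..N} - D"
    and gap': "\<forall>T\<subseteq>{2..N} - T0. T \<noteq> {} \<longrightarrow> (\<Sum>k\<in>T \<inter> D. R k) < F (T \<union> T0) - F T0"
    by (elim exE conjE)
  note gap = gap'[rule_format]
  define V where "V = {2..N} - T0"
  \<comment> \<open>The letters of the idle relays join the time-sharing variable, so that they are
    known everywhere in advance; the interpretation below reads the input of such a relay off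
    \<open>qs\<close>.\<close>
  define qs :: "(nat \<Rightarrow> 'x) \<times> (nat \<Rightarrow> 'u) \<times> 'q \<Rightarrow> 'q \<times> (nat \<Rightarrow> 'x) \<times> (nat \<Rightarrow> 'u)"
    where "qs = (\<lambda>l. (snd (snd l), restrict (fst l) T0, restrict (fst (snd l)) T0))"
  interpret relay_letters N X W V P qs "\<lambda>k l. fst l k" "\<lambda>k l. fst (snd l) k" "\<lambda>k q. fst (snd q) k"
  proof
    show "fst l k \<in> X k" if "k \<in> {1..N}" "l \<in> set_pmf P" for k l
      using PiE_mem[OF Px[OF that(2)] that(1)] .
    show "fst l k = fst (snd (qs l)) k" if "k \<in> {2..N} - V" "l \<in> set_pmf P" for k l
      using that by (auto simp: V_def qs_def)
  qed (use N finP finW in \<open>auto simp: V_def\<close>)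
  have inp_eq: "inp l = fst l" if "l \<in> set_pmf P" for l
    using Px[OF that] unfolding inp_def by (intro extensional_restrict) (auto simp: PiE_def)
  let ?h = "\<lambda>(l, y). (fst l, fst (snd l), snd (snd l), y)"
  have L: "L = map_pmf ?h LL"
  proof -
    have "map_pmf ?h LL = bind_pmf P (\<lambda>l. map_pmf (\<lambda>y. (fst l, fst (snd l), snd (snd l), y)) (W (inp l)))"
      by (simp add: LL_def map_bind_pmf pmf.map_comp o_def)
    also have "\<dots> = L"
      unfolding L_def joint_law_def by (intro bind_pmf_cong refl) (auto simp: inp_eq split: prod.splits)
    finally show ?thesis ..
  qed
  define C where "C = (\<lambda>z :: (nat \<Rightarrow> 'x) \<times> (nat \<Rightarrow> 'u) \<times> 'q \<times> (nat \<Rightarrow> 'y). (Q_of z, restrict (X_of z) T0, restrict (U_of z) T0))"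
  have rate: "(\<Sum>k\<in>T. minfo k) - tcorr T = cut_value L C T" if "finite T" for T
  proof -
    have a: "ent L C = ent LL (\<lambda>(l, y). qs l)"
      unfolding L ent_map_pmf by (rule ent_cong) (simp add: C_def qs_def case_prod_beta')
    have b: "ent L (\<lambda>z. ((\<lambda>k\<in>T. (X_of z k, U_of z k)), C z)) = ent LL (\<lambda>(l, y). (qs l, \<lambda>k\<in>T. (fst l k, fst (snd l) k)))"
      unfolding L ent_map_pmf by (rule ent_cong) (auto simp: C_def qs_def)
    have c: "ent L (\<lambda>z. (X_of z k, C z)) = ent LL (\<lambda>(l, y). (qs l, fst l k))" for k
      unfolding L ent_map_pmf by (rule ent_cong) (auto simp: C_def qs_def)
    have d: "ent L (\<lambda>z. (U_of z k, X_of z k, Y_of z k, C z)) = ent LL (\<lambda>(l, y). (qs l, fst l k, fst (snd l) k, y k))" for k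
      unfolding L ent_map_pmf by (rule ent_cong) (auto simp: C_def qs_def)
    have e: "ent L (\<lambda>z. (X_of z k, Y_of z k, C z)) = ent LL (\<lambda>(l, y). (qs l, fst l k, y k))" for k
      unfolding L ent_map_pmf by (rule ent_cong) (auto simp: C_def qs_def)
    show ?thesis
      unfolding rate_gap[OF that] cut_value_def node_cost_def a b c d e ..
  qed
  show ?thesis
  proof (rule achievable_letters)
    show "D \<subseteq> V" using assms(2) T0 by (auto simp: V_def)
    show "R k \<ge> 0" if "k \<in> D" for k using assms(3) that by blast
    fix T assume T: "T \<subseteq> V" "T \<noteq> {}"
    have fT: "finite T" "finite T0" "T \<inter> T0 = {}"
      using T T0 finite_subset[of T V] finite_subset[of T0 "{2..N}"] finV by (auto simp: V_def)
    have "(\<Sum>k\<in>T \<inter> D. R k) < F (T \<union> T0) - F T0" using gap T by (simp add: V_def)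
    also have "\<dots> \<le> cut_value L C T"
      using cut_value_given_nodes[OF finL fT] unfolding F_def C_def .
    finally show "(\<Sum>k\<in>T \<inter> D. R k) < (\<Sum>k\<in>T. minfo k) - tcorr T"
      unfolding rate[OF fT(1)] .
  qed
qed

end
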